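(* Let $r\in\{0,1,2,3,4\}$, let $n$ be an integer with $n+1\equiv r\pmod 5$ and $n\ge 69-4r$, and let $\alpha=n-5$. Then the minimizer graphs $T^*$ of $\mathbb{G}_{n,\alpha}$ are (up to isomorphism) exactly: - if $r=0$: $F^5_1\circ(\frac{n-4}{5},\frac{n-29}{5},\frac{n-4}{5},\frac{n-4}{5},\frac{n-4}{5})$, with $\rho(T^* )=\sqrt{\frac{n-4}{5}+\sqrt5}$; - if $r=1$: $F^5_3\circ(\frac{n-5}{5},\frac{n-10}{5},\frac{n-15}{5},\frac{n-10}{5},\frac{n-5}{5})$, with $\rho(T^* )=\sqrt{\frac{n-5}{5}+2.4812}$; - if $r=2$: $F^5_3\circ(\frac{n-1}{5},\frac{n-16}{5},\frac{n-11}{5},\frac{n-16}{5},\frac{n-1}{5})$, with $\rho(T^* )=\sqrt{\frac{n-6}{5}+2.6751}$; - if $r=3$: $F^5_1\circ(\frac{n-2}{5},\frac{n-37}{5},\frac{n-2}{5},\frac{n-2}{5},\frac{n-2}{5})$, with $\rho(T^* )=\sqrt{\frac{n-7}{5}+\sqrt8}$; - if $r=4$: $F^5_1\circ(\frac{n-3}{5},\frac{n-33}{5},\frac{n-3}{5},\frac{n-3}{5},\frac{n-3}{5})$, $F^5_2\circ(\frac{n-3}{5},\frac{n-23}{5},\frac{n-13}{5},\frac{n-3}{5},\frac{n-3}{5})$ and $F^5_3\circ(\frac{n-3}{5},\frac{n-13}{5},\frac{n-13}{5},\frac{n-13}{5},\frac{n-3}{5})$, with $\rho(T^* )=\sqrt{\frac{n+7}{5}}$.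 (The constants $2.4812$ and $2.6751$ are numerical approximations.)
   Context: $\mathbb{G}_{n,\alpha}$ is the set of connected simple graphs on $n$ vertices with independence number $\alpha$; a minimizer graph of $\mathbb{G}_{n,\alpha}$ is one whose spectral radius $\rho$ (largest adjacency eigenvalue) is minimum in $\mathbb{G}_{n,\alpha}$. Trees: $F^5_1$ consists of the path $v_0v_1v_2v_3v_4$ together with vertices $x_{11},y_{11},x_{12},y_{12}$ and edges $v_2x_{11},x_{11}y_{11},v_2x_{12},x_{12}y_{12}$; its vertices are ordered $(v_0,v_2,v_4,y_{11},y_{12})$. $F^5_2$ consists of the path $v_0v_1\cdots v_6$ together with edges $v_2x_{11},x_{11}y_{11}$; ordered $(v_0,v_2,v_4,v_6,y_{11})$. $F^5_3$ is the path $v_0v_1\cdots v_8$; ordered $(v_0,v_2,v_4,v_6,v_8)$. For such a tree $F$ with ordered vertices $(u_1,\dots,u_5)$ and nonnegative integers $a_1,\dots,a_5$, $F\circ(a_1,\dots,a_5)$ is the tree obtained from $F$ by attaching $a_i$ new pendant vertices to $u_i$ for each $i$. *)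

theory Defs
  imports
    "Graph_Theory.Digraph_Isomorphism"
    "Jordan_Normal_Form.Char_Poly"
    "HOL-Number_Theory.Cong"
begin

text \<open>
  A simple graph is a \<open>pair_graph\<close> of the AFP entry \<open>Graph_Theory\<close>: a finite loop-free digraph
  with a symmetric set of arcs, where the edge \<open>uv\<close> is the pair of arcs \<open>(u, v)\<close>, \<open>(v, u)\<close>.
  Connectedness is \<open>Digraph_Component.connected\<close> (qualified, as \<open>connected\<close> also names the
  topological notion), and graph isomorphism is \<open>digraph_iso\<close>.
\<close>

definition independent_set :: "'a pair_pre_digraph \<Rightarrow> 'a set \<Rightarrow> bool" where
  "independent_set G S \<longleftrightarrow> S \<subseteq> pverts G \<and> (\<forall>u\<in>S. \<forall>v\<in>S. (u, v) \<notin> parcs G)"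

definition independence_number :: "'a pair_pre_digraph \<Rightarrow> nat" where
  "independence_number G = Max (card ` {S. independent_set G S})"

definition adjacency_mat :: "'a pair_pre_digraph \<Rightarrow> 'a list \<Rightarrow> real mat" where
  "adjacency_mat G vs =
     mat (length vs) (length vs) (\<lambda>(i, j). if (vs ! i, vs ! j) \<in> parcs G then 1 else 0)"

text \<open>
  Vertices carry no order, so the adjacency matrix depends on an enumeration \<open>vs\<close> of them.
  Different enumerations give permutation-similar matrices and hence the same eigenvalues.
\<close>

definition adjacency_eigenvalues :: "'a pair_pre_digraph \<Rightarrow> real set" where
  "adjacency_eigenvalues G =
     {k. \<exists>vs. distinct vs \<and> set vs = pverts G \<and> eigenvalue (adjacency_mat G vs) k}"

definition graph_spectral_radius :: "'a pair_pre_digraph \<Rightarrow> real" where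
  "graph_spectral_radius G = Max (adjacency_eigenvalues G)"

definition graph_class :: "nat \<Rightarrow> nat \<Rightarrow> 'a pair_pre_digraph set" where
  "graph_class n \<alpha> =
     {G. pair_graph G \<and> Digraph_Component.connected (with_proj G) \<and>
         card (pverts G) = n \<and> independence_number G = \<alpha>}"

definition minimizer_graph :: "nat \<Rightarrow> nat \<Rightarrow> 'a pair_pre_digraph \<Rightarrow> bool" where
  "minimizer_graph n \<alpha> T \<longleftrightarrow> is_arg_min graph_spectral_radius (\<lambda>G. G \<in> graph_class n \<alpha>) T"

text \<open>
  \<open>PathV i\<close>, \<open>MidV i j\<close> and \<open>EndV i j\<close> are the vertices \<open>v\<^sub>i\<close>, \<open>x\<^sub>i\<^sub>j\<close> and \<open>y\<^sub>i\<^sub>j\<close>;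
  \<open>Pendant u j\<close> is the \<open>j\<close>-th new pendant vertex attached to \<open>u\<close>.
\<close>

datatype tree_vertex =
  PathV nat | MidV nat nat | EndV nat nat | Pendant tree_vertex nat

definition graph_of_edges :: "('a \<times> 'a) set \<Rightarrow> 'a pair_pre_digraph" where
  "graph_of_edges E = \<lparr> pverts = Field E, parcs = E \<union> E\<inverse> \<rparr>"

definition path_edges :: "nat \<Rightarrow> (tree_vertex \<times> tree_vertex) set" where
  "path_edges m = {(PathV i, PathV (Suc i)) | i. i < m}"

text \<open>A tree together with its ordered vertices \<open>(u\<^sub>1, \<dots>, u\<^sub>5)\<close>.\<close>

type_synonym ordered_tree = "tree_vertex pair_pre_digraph \<times> tree_vertex list"

definition F5_1 :: ordered_tree where
  "F5_1 =
     (graph_of_edges (path_edges 4 \<union>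
        {(PathV 2, MidV 1 1), (MidV 1 1, EndV 1 1), (PathV 2, MidV 1 2), (MidV 1 2, EndV 1 2)}),
      [PathV 0, PathV 2, PathV 4, EndV 1 1, EndV 1 2])"

definition F5_2 :: ordered_tree where
  "F5_2 =
     (graph_of_edges (path_edges 6 \<union> {(PathV 2, MidV 1 1), (MidV 1 1, EndV 1 1)}),
      [PathV 0, PathV 2, PathV 4, PathV 6, EndV 1 1])"

definition F5_3 :: ordered_tree where
  "F5_3 = (graph_of_edges (path_edges 8), [PathV 0, PathV 2, PathV 4, PathV 6, PathV 8])"

definition pendant_edges :: "tree_vertex list \<Rightarrow> nat list \<Rightarrow> (tree_vertex \<times> tree_vertex) set" where
  "pendant_edges us as = {(us ! i, Pendant (us ! i) j) | i j. i < length us \<and> j < as ! i}"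

definition attach_pendants :: "ordered_tree \<Rightarrow> nat list \<Rightarrow> tree_vertex pair_pre_digraph" where
  "attach_pendants F as =
     (let N = pendant_edges (snd F) as
      in \<lparr> pverts = pverts (fst F) \<union> Range N, parcs = parcs (fst F) \<union> N \<union> N\<inverse> \<rparr>)"

definition isomorphic :: "'a pair_pre_digraph \<Rightarrow> 'b pair_pre_digraph \<Rightarrow> bool" (infix \<open>\<cong>\<^sub>g\<close> 50) where
  "G \<cong>\<^sub>g H \<longleftrightarrow> digraph_iso (with_proj G) (with_proj H)"

end

theory Submission
  imports Defs "HOL-Analysis.Function_Topology"
begin

text \<open>
  Let \<open>C\<close> be the complement of a maximum independent set, so \<open>C\<close> is a vertex cover with five elements.
  Eliminating the coordinates outside \<open>C\<close> from the Rayleigh quotient shows that \<open>\<rho>(G) \<le> \<sigma>\<close> forces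
  \<open>\<sigma> x\<^sup>T A\<^sub>C x + (\<Sum>w\<notin>C. x(N(w))\<^sup>2) \<le> \<sigma>\<^sup>2 |x|\<^sup>2\<close> for all \<open>x\<close> on \<open>C\<close>. For \<open>x = 1\<close>, together with the count of
  edges that connectedness requires, this leaves only the graphs without edges inside \<open>C\<close> in which four
  outer vertices have degree 2 and all others are pendant: subdivided trees on five vertices with
  pendant vertices attached to \<open>C\<close>. The inequality then says that the largest eigenvalue of \<open>D + A(H)\<close> is
  at most \<open>\<sigma>\<^sup>2\<close>, where \<open>H\<close> is a star, a fork or a path and \<open>D\<close> is an integer diagonal matrix with trace
  \<open>n - 1\<close>. Shifting \<open>D\<close> by a multiple of the identity leaves a finite problem for each residue of \<open>n\<close>
  modulo 5, which is settled by finitely many integer test vectors \<open>x\<close>.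
\<close>

text \<open>The constant test vector decides so much because of a narrow margin. The optimum
  \<open>\<theta> = \<sigma>^2\<close> satisfies \<open>5 * \<theta> < n + 8\<close>, and
  \<open>n + 8 = (n - 5) + 13\<close>: beyond the unavoidable 1 for each outer vertex the budget is
  less than 13. Connecting five cover vertices takes four links. A link through a second neighbour
  of an outer vertex costs 3, an edge inside \<open>C\<close> costs \<open>2 * \<sigma>\<close>, at
  least 5. So only four links of the first kind fit, at cost 12.

  No two graphs are ever compared. Every graph with radius at most \<open>sqrt \<theta>\<close> is
  shown to be a listed tree, and a positive eigenvector shows that the listed trees attain
  \<open>sqrt \<theta>\<close>; minimality and uniqueness come from the same enumeration.

  Writing \<open>n = 5 * k + 4 + r\<close> and shifting by \<open>k\<close> gives trace
  \<open>3 + r\<close> and a bound \<open>\<theta> - k\<close> that does not depend on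
  \<open>n\<close>. For \<open>r = 4\<close> the bound is 3, attained on each of the three trees by
  the constant vector; hence the three minimizers.

  Minimality refers to graphs over one vertex type, possibly a finite one, so a competitor must be
  placed on the vertices of the given graph.\<close>

definition nbrs :: "'a pair_pre_digraph \<Rightarrow> 'a \<Rightarrow> 'a set" where
  "nbrs G v = {u. (v, u) \<in> parcs G}"

lemma (in pair_graph) nbrs_subset: "nbrs G v \<subseteq> pverts G"
  by (auto simp: nbrs_def dest: in_arcsD2)

lemma (in pair_graph) finite_nbrs [simp]: "finite (nbrs G v)"
  using nbrs_subset pair_finite_verts finite_subset by metis

lemma (in pair_graph) nbrs_sym: "u \<in> nbrs G v \<longleftrightarrow> v \<in> nbrs G u"
  by (auto simp: nbrs_def intro: arcs_symmetric)

text \<open>Both sides run over the edges between \<open>X\<close> and \<open>Y\<close>. The sets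
  are kept apart because the swap serves both for the symmetry of the adjacency form and for the
  edges between a cover and its complement.\<close>

lemma (in pair_graph) sum_nbrs_swap:
  fixes h :: "'a \<Rightarrow> 'a \<Rightarrow> real"
  assumes "X \<subseteq> pverts G" "Y \<subseteq> pverts G"
  shows "(\<Sum>v\<in>X. \<Sum>u\<in>nbrs G v \<inter> Y. h v u) = (\<Sum>u\<in>Y. \<Sum>v\<in>nbrs G u \<inter> X. h v u)"
proof -
  have fin: "finite X" "finite Y"
    using assms finite_subset[OF _ pair_finite_verts] by auto
  have "(\<Sum>v\<in>X. \<Sum>u\<in>nbrs G v \<inter> Y. h v u) = (\<Sum>v\<in>X. \<Sum>u\<in>Y. if u \<in> nbrs G v then h v u else 0)"
    using fin by (simp add: sum.inter_restrict Int_commute[of "nbrs G _"])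
  also have "\<dots> = (\<Sum>u\<in>Y. \<Sum>v\<in>X. if v \<in> nbrs G u then h v u else 0)"
    by (subst sum.swap) (simp add: nbrs_sym)
  also have "\<dots> = (\<Sum>u\<in>Y. \<Sum>v\<in>nbrs G u \<inter> X. h v u)"
    using fin by (simp add: sum.inter_restrict Int_commute[of "nbrs G _"])
  finally show ?thesis .
qed

section \<open>Adjacency eigenvalues\<close>

lemma adjacency_mat_mult_vec:
  assumes "distinct vs" "set vs = pverts G" "pair_graph G" "i < length vs"
  shows "(adjacency_mat G vs *\<^sub>v vec (length vs) (\<lambda>i. f (vs ! i))) $ i = (\<Sum>u\<in>nbrs G (vs ! i). f u)"
proof -
  interpret pair_graph G by fact
  let ?g = "\<lambda>u. if u \<in> nbrs G (vs ! i) then f u else 0"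
  have "(adjacency_mat G vs *\<^sub>v vec (length vs) (\<lambda>i. f (vs ! i))) $ i
      = (\<Sum>j\<in>{0..<length vs}. ?g (vs ! j))"
    using assms(4) by (auto simp: adjacency_mat_def scalar_prod_def nbrs_def intro!: sum.cong)
  also have "\<dots> = (\<Sum>u\<in>pverts G. ?g u)"
    using sum.reindex_bij_betw[OF bij_betw_nth[OF assms(1) refl refl], of ?g] assms(2)
    by (simp add: lessThan_atLeast0)
  also have "\<dots> = (\<Sum>u\<in>nbrs G (vs ! i). f u)"
    using nbrs_subset by (simp add: sum.inter_restrict[symmetric] pair_finite_verts Int_absorb1)
  finally show ?thesis .
qed

text \<open>Removes the enumeration: an eigenvector becomes a function on the vertices. Only the
  finiteness of the spectrum below returns to matrices.\<close>

lemma adjacency_eigenvalues_iff: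
  assumes "pair_graph G"
  shows "k \<in> adjacency_eigenvalues G \<longleftrightarrow>
    (\<exists>f. (\<exists>v\<in>pverts G. f v \<noteq> 0) \<and> (\<forall>v\<in>pverts G. (\<Sum>u\<in>nbrs G v. f u) = k * f v))"
    (is "?L \<longleftrightarrow> ?R")
proof
  assume ?L
  then obtain vs x where vs: "distinct vs" "set vs = pverts G"
    and x: "eigenvector (adjacency_mat G vs) x k"
    by (auto simp: adjacency_eigenvalues_def eigenvalue_def)
  define f where "f v = x $ (THE i. i < length vs \<and> vs ! i = v)" for v
  have f: "f (vs ! i) = x $ i" if "i < length vs" for i
  proof -
    have "(THE j. j < length vs \<and> vs ! j = vs ! i) = i"
      using that vs(1) by (intro the_equality) (auto simp: nth_eq_iff_index_eq)
    then show ?thesis by (simp add: f_def)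
  qed
  have dim: "dim_vec x = length vs" and x0: "x \<noteq> 0\<^sub>v (length vs)"
    and ev: "adjacency_mat G vs *\<^sub>v x = k \<cdot>\<^sub>v x"
    using x by (auto simp: eigenvector_def adjacency_mat_def)
  have xf: "x = vec (length vs) (\<lambda>i. f (vs ! i))"
    using dim f by auto
  have "\<exists>i<length vs. x $ i \<noteq> 0"
    using x0 dim by (metis eq_vecI index_zero_vec(1) index_zero_vec(2))
  then have 1: "\<exists>v\<in>pverts G. f v \<noteq> 0"
    using f vs(2) nth_mem by metis
  have "(\<Sum>u\<in>nbrs G v. f u) = k * f v" if v: "v \<in> pverts G" for v
  proof -
    obtain i where i: "i < length vs" "v = vs ! i"
      using v vs(2) by (metis in_set_conv_nth)
    have "(\<Sum>u\<in>nbrs G v. f u) = (adjacency_mat G vs *\<^sub>v x) $ i"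
      unfolding i(2) by (subst xf, rule adjacency_mat_mult_vec[symmetric]) (use vs assms i in auto)
    also have "\<dots> = k * f v"
      using i dim f by (simp add: ev)
    finally show ?thesis .
  qed
  with 1 show ?R by blast
next
  assume ?R
  then obtain f where f: "\<exists>v\<in>pverts G. f v \<noteq> 0"
    "\<And>v. v \<in> pverts G \<Longrightarrow> (\<Sum>u\<in>nbrs G v. f u) = k * f v" by blast
  interpret pair_graph G by fact
  obtain vs where vs: "set vs = pverts G" "distinct vs"
    using finite_distinct_list[OF pair_finite_verts] by blast
  let ?x = "vec (length vs) (\<lambda>i. f (vs ! i))"
  have "?x \<noteq> 0\<^sub>v (length vs)"
  proof
    assume "?x = 0\<^sub>v (length vs)"
    then have "\<forall>i<length vs. f (vs ! i) = 0"
      by (metis index_vec index_zero_vec(1))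
    with f(1) vs(1) show False by (metis in_set_conv_nth)
  qed
  moreover have "adjacency_mat G vs *\<^sub>v ?x = k \<cdot>\<^sub>v ?x"
  proof (rule eq_vecI)
    fix i assume "i < dim_vec (k \<cdot>\<^sub>v ?x)"
    then have i: "i < length vs" by simp
    have "(adjacency_mat G vs *\<^sub>v ?x) $ i = (\<Sum>u\<in>nbrs G (vs ! i). f u)"
      by (rule adjacency_mat_mult_vec) (use vs i assms in auto)
    then show "(adjacency_mat G vs *\<^sub>v ?x) $ i = (k \<cdot>\<^sub>v ?x) $ i"
      using f(2)[of "vs ! i"] i vs(1) nth_mem[OF i] by simp
  qed (simp add: adjacency_mat_def)
  ultimately have "eigenvector (adjacency_mat G vs) ?x k"
    by (auto simp: eigenvector_def adjacency_mat_def)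
  then show ?L
    using vs by (auto simp: adjacency_eigenvalues_def eigenvalue_def)
qed

text \<open>Finitely many enumerations, each with finitely many roots of its characteristic
  polynomial. Without this, \<open>Max\<close> in \<open>graph_spectral_radius\<close> would say
  nothing.\<close>

lemma finite_adjacency_eigenvalues:
  assumes "pair_graph G"
  shows "finite (adjacency_eigenvalues G)"
proof -
  interpret pair_graph G by fact
  let ?L = "{vs. distinct vs \<and> set vs = pverts G}"
  have "finite ?L"
    by (rule finite_subset[OF _ finite_subset_distinct[OF pair_finite_verts]]) auto
  moreover have "finite {k. eigenvalue (adjacency_mat G vs) k}" for vs
  proof -
    have A: "adjacency_mat G vs \<in> carrier_mat (length vs) (length vs)"
      by (simp add: adjacency_mat_def)
    have "char_poly (adjacency_mat G vs) \<noteq> 0"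
      using degree_monic_char_poly[OF A] by auto
    then show ?thesis
      unfolding eigenvalue_root_char_poly[OF A] by (rule poly_roots_finite)
  qed
  ultimately have "finite (\<Union>vs\<in>?L. {k. eigenvalue (adjacency_mat G vs) k})" by blast
  then show ?thesis
    by (rule finite_subset[rotated]) (auto simp: adjacency_eigenvalues_def)
qed

section \<open>Rayleigh quotient and Perron criterion\<close>

context pair_graph
begin

definition adj_form :: "('a \<Rightarrow> real) \<Rightarrow> ('a \<Rightarrow> real) \<Rightarrow> real" where
  "adj_form f g = (\<Sum>v\<in>pverts G. f v * (\<Sum>u\<in>nbrs G v. g u))"

lemma adj_form_sym: "adj_form f g = adj_form g f"
proof -
  have "adj_form f g = (\<Sum>v\<in>pverts G. \<Sum>u\<in>nbrs G v \<inter> pverts G. f v * g u)" for f g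
    using nbrs_subset by (simp add: adj_form_def sum_distrib_left Int_absorb2)
  then show ?thesis
    using sum_nbrs_swap[OF order_refl order_refl, of "\<lambda>v u. f v * g u"] by (simp add: mult.commute)
qed

lemma adj_form_add: "adj_form f (\<lambda>v. g v + c * h v) = adj_form f g + c * adj_form f h"
  by (simp add: adj_form_def sum.distrib sum_distrib_left algebra_simps)

lemma adj_form_add_left: "adj_form (\<lambda>v. g v + c * h v) f = adj_form g f + c * adj_form h f"
  by (simp add: adj_form_def sum.distrib sum_distrib_left algebra_simps)

text \<open>Compactness of the unit sphere gives the maximizer; both sides are homogeneous of degree
  two, so the bound extends from the sphere to every \<open>g\<close>.\<close>

lemma adj_form_maximum:
  assumes "pverts G \<noteq> {}"
  obtains f where "(\<Sum>v\<in>pverts G. (f v)\<^sup>2) = 1"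
    "\<And>g. adj_form g g \<le> adj_form f f * (\<Sum>v\<in>pverts G. (g v)\<^sup>2)"
proof -
  let ?V = "pverts G"
  let ?N = "\<lambda>f :: 'a \<Rightarrow> real. \<Sum>v\<in>?V. (f v)\<^sup>2"
  \<comment> \<open>The norm sees only coordinates in \<open>pverts G\<close>, so its sphere is
    unbounded in all others. Freezing those at 0 and boxing the rest makes \<open>?S\<close> a
    closed part of a product of compact sets.\<close>
  let ?K = "\<lambda>v. if v \<in> ?V then {-1..1} else {0 :: real}"
  let ?S = "PiE UNIV ?K \<inter> {f. ?N f = 1}"
  have "compactin euclidean (PiE UNIV ?K)"
    unfolding euclidean_product_topology[symmetric]
    by (subst compactin_PiE) auto
  moreover have "closed {f. ?N f = 1}"
    by (intro closed_Collect_eq continuous_intros continuous_on_product_coordinates)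
  ultimately have comp: "compact ?S" by auto
  obtain v0 where v0: "v0 \<in> ?V" using assms by blast
  have "(\<lambda>v. if v = v0 then 1 else 0) \<in> ?S"
    using v0 pair_finite_verts by (auto simp: if_distrib[of "\<lambda>x. x\<^sup>2"] cong: if_cong)
  then have ne: "?S \<noteq> {}" by blast
  have cont: "continuous_on ?S (\<lambda>f. adj_form f f)"
    unfolding adj_form_def
    by (rule continuous_on_subset[OF _ subset_UNIV])
       (intro continuous_intros continuous_on_product_coordinates)
  obtain f where f: "f \<in> ?S" and max: "\<And>g. g \<in> ?S \<Longrightarrow> adj_form g g \<le> adj_form f f"
    using continuous_attains_sup[OF comp ne cont] by blast
  have "adj_form g g \<le> adj_form f f * ?N g" for g
  proof (cases "?N g = 0")
    case True
    then have "g v = 0" if "v \<in> ?V" for v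
      using that pair_finite_verts by (simp add: sum_nonneg_eq_0_iff)
    then have "adj_form g g = 0" by (simp add: adj_form_def)
    with True show ?thesis by simp
  next
    case False
    then have pos: "?N g > 0" by (simp add: order_less_le sum_nonneg)
    define c where "c = sqrt (?N g)"
    have c: "c > 0" "c\<^sup>2 = ?N g" using pos by (auto simp: c_def)
    define h where "h v = (if v \<in> ?V then g v / c else 0)" for v
    have Nh: "?N h = 1"
      using c False by (simp add: h_def power_divide sum_divide_distrib[symmetric])
    have "- 1 \<le> h v \<and> h v \<le> 1" if "v \<in> ?V" for v
    proof -
      have "(h v)\<^sup>2 \<le> ?N h" using that pair_finite_verts by (intro member_le_sum) auto
      then show ?thesis using Nh by (simp add: abs_square_le_1 abs_le_iff)
    qed
    then have "h v \<in> ?K v" for v by (cases "v \<in> ?V") (auto simp: h_def)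
    then have "h \<in> ?S" using Nh by blast
    then have "adj_form h h \<le> adj_form f f" by (rule max)
    moreover have "adj_form h h = adj_form g g / c\<^sup>2"
    proof -
      have "(\<Sum>u\<in>nbrs G v. h u) = (\<Sum>u\<in>nbrs G v. g u) / c" for v
        using nbrs_subset[of v] by (auto simp: h_def sum_divide_distrib intro!: sum.cong)
      then have "h v * (\<Sum>u\<in>nbrs G v. h u) = g v * (\<Sum>u\<in>nbrs G v. g u) / c\<^sup>2" if "v \<in> ?V" for v
        using that by (simp add: h_def[of v] power2_eq_square)
      then show ?thesis
        by (simp add: adj_form_def sum_divide_distrib cong: sum.cong)
    qed
    ultimately show ?thesis using pos c(2) by (simp add: pos_divide_le_eq)
  qed
  then show thesis using f that by blast
qed

text \<open>The maximal Rayleigh quotient is itself an eigenvalue, hence at most the largest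
  one.\<close>

lemma adj_form_le_spectral_radius:
  assumes "pverts G \<noteq> {}"
  shows "adj_form g g \<le> graph_spectral_radius G * (\<Sum>v\<in>pverts G. (g v)\<^sup>2)"
proof -
  let ?V = "pverts G"
  let ?N = "\<lambda>f :: 'a \<Rightarrow> real. \<Sum>v\<in>?V. (f v)\<^sup>2"
  obtain f where f: "?N f = 1" and max: "\<And>g. adj_form g g \<le> adj_form f f * ?N g"
    using adj_form_maximum[OF assms] by blast
  define k where "k = adj_form f f"
  have "(\<Sum>u\<in>nbrs G v. f u) = k * f v" if v: "v \<in> ?V" for v
  proof -
    define e where "e u = (if u = v then 1 else 0 :: real)" for u
    define b where "b = (\<Sum>u\<in>nbrs G v. f u) - k * f v"
    have ef: "adj_form e f = (\<Sum>u\<in>nbrs G v. f u)"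
      using v pair_finite_verts by (simp add: adj_form_def e_def if_distrib[of "\<lambda>x. x * _"] cong: if_cong)
    \<comment> \<open>First-order condition at the maximizer: moving the coordinate at
      \<open>v\<close> by \<open>t\<close> changes the form at first order by the residual
      \<open>b\<close> of the eigenvalue equation, and a quadratic term must dominate this for every
      \<open>t\<close>.\<close>
    have "2 * t * b \<le> t\<^sup>2 * (k - adj_form e e)" for t
    proof -
      have "adj_form (\<lambda>v. f v + t * e v) (\<lambda>v. f v + t * e v) \<le> k * ?N (\<lambda>v. f v + t * e v)"
        unfolding k_def by (rule max)
      moreover have "adj_form (\<lambda>v. f v + t * e v) (\<lambda>v. f v + t * e v)
          = k + 2 * t * adj_form e f + t\<^sup>2 * adj_form e e"
        by (simp add: adj_form_add adj_form_add_left k_def adj_form_sym[of f e] algebra_simps power2_eq_square)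
      moreover have "?N (\<lambda>v. f v + t * e v) = 1 + 2 * t * f v + t\<^sup>2"
      proof -
        have "?N (\<lambda>v. f v + t * e v) = (\<Sum>u\<in>?V. (f u)\<^sup>2 + (if u = v then 2 * t * f v + t\<^sup>2 else 0))"
          by (intro sum.cong refl) (auto simp: e_def power2_sum)
        then show ?thesis using v pair_finite_verts f by (simp add: sum.distrib)
      qed
      ultimately show ?thesis unfolding ef b_def by (simp add: algebra_simps)
    qed
    note * = this
    have "b = 0"
    proof (rule ccontr)
      assume "b \<noteq> 0"
      \<comment> \<open>A positive upper bound for the quadratic coefficient. The choice
        \<open>t = b / a\<close> maximizes \<open>2 * t * b - t^2 * a\<close>, whose value
        \<open>b^2 / a\<close> would then be positive.\<close>
      define a where "a = \<bar>k - adj_form e e\<bar> + 1"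
      have a: "a > 0" "k - adj_form e e \<le> a" by (auto simp: a_def)
      have "2 * (b / a) * b \<le> (b / a)\<^sup>2 * (k - adj_form e e)" by (rule *)
      also have "\<dots> \<le> (b / a)\<^sup>2 * a" using a by (intro mult_left_mono) auto
      finally have "2 * b\<^sup>2 / a \<le> b\<^sup>2 / a"
        using a by (simp add: power2_eq_square field_simps)
      then show False using a \<open>b \<noteq> 0\<close> by (simp add: field_simps)
    qed
    then show ?thesis by (simp add: b_def)
  qed
  moreover have "\<exists>v\<in>?V. f v \<noteq> 0" using f by (metis sum.neutral zero_neq_one zero_power2)
  ultimately have "k \<in> adjacency_eigenvalues G"
    using adjacency_eigenvalues_iff[OF pair_graph] by blast
  then have "k \<le> graph_spectral_radius G"
    unfolding graph_spectral_radius_def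
    using finite_adjacency_eigenvalues[OF pair_graph] by (intro Max_ge)
  then have "k * ?N g \<le> graph_spectral_radius G * ?N g"
    by (intro mult_right_mono sum_nonneg) auto
  with max[of g] show ?thesis unfolding k_def by linarith
qed

text \<open>The easy half of Perron-Frobenius. For an eigenvector \<open>g\<close> of another
  eigenvalue \<open>l\<close>, scale \<open>f\<close> to dominate \<open>\<bar>g\<bar>\<close> with
  equality at some \<open>v\<close>; the eigenvalue equations at \<open>v\<close> then give
  \<open>l \<le> k\<close>.\<close>

lemma spectral_radius_eqI:
  assumes "pverts G \<noteq> {}" "\<And>v. v \<in> pverts G \<Longrightarrow> f v > 0"
    and eig: "\<And>v. v \<in> pverts G \<Longrightarrow> (\<Sum>u\<in>nbrs G v. f u) = k * f v"
  shows "graph_spectral_radius G = k"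
  unfolding graph_spectral_radius_def
proof (rule Max_eqI)
  show "finite (adjacency_eigenvalues G)" by (rule finite_adjacency_eigenvalues[OF pair_graph])
  show "k \<in> adjacency_eigenvalues G"
    unfolding adjacency_eigenvalues_iff[OF pair_graph] using assms by (metis all_not_in_conv less_irrefl)
  fix l assume "l \<in> adjacency_eigenvalues G"
  then obtain g where g: "\<exists>v\<in>pverts G. g v \<noteq> 0"
    "\<And>v. v \<in> pverts G \<Longrightarrow> (\<Sum>u\<in>nbrs G v. g u) = l * g v"
    unfolding adjacency_eigenvalues_iff[OF pair_graph] by blast
  let ?q = "\<lambda>v. \<bar>g v\<bar> / f v"
  define m where "m = Max (?q ` pverts G)"
  have fin: "finite (?q ` pverts G)" using pair_finite_verts by simp
  have m: "\<bar>g v\<bar> \<le> m * f v" if "v \<in> pverts G" for v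
  proof -
    have "?q v \<le> m" unfolding m_def using that fin by (intro Max_ge) auto
    then show ?thesis using assms(2)[OF that] by (simp add: pos_divide_le_eq)
  qed
  obtain v where v: "v \<in> pverts G" "m = ?q v"
    using Max_in[OF fin] assms(1) unfolding m_def by (metis (no_types, lifting) image_iff image_is_empty)
  obtain w where w: "w \<in> pverts G" "g w \<noteq> 0" using g(1) by blast
  have "m > 0"
  proof -
    have "0 < m * f w" using m[OF w(1)] w(2) by linarith
    then show ?thesis using assms(2)[OF w(1)] by (simp add: zero_less_mult_iff)
  qed
  have fv: "f v > 0" using assms(2) v(1) by blast
  have gv: "\<bar>g v\<bar> = m * f v" using v fv by simp
  have "l * (m * f v) \<le> \<bar>l * g v\<bar>" unfolding gv[symmetric] abs_mult by (intro mult_right_mono) auto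
  also have "\<dots> = \<bar>\<Sum>u\<in>nbrs G v. g u\<bar>" using g(2) v(1) by simp
  also have "\<dots> \<le> (\<Sum>u\<in>nbrs G v. \<bar>g u\<bar>)" by (rule sum_abs)
  also have "\<dots> \<le> (\<Sum>u\<in>nbrs G v. m * f u)" using m nbrs_subset by (intro sum_mono) auto
  also have "\<dots> = k * (m * f v)" using eig[OF v(1)] by (simp add: sum_distrib_left[symmetric])
  finally show "l \<le> k" using fv \<open>m > 0\<close> by simp
qed

end

section \<open>Connectedness\<close>

text \<open>Walks occur only here. Later arguments extract connectedness by exhibiting a set that is
  not closed, or prove it by showing that a closed set is everything.\<close>

lemma (in pair_graph) connected_iff_cut:
  "Digraph_Component.connected (with_proj G) \<longleftrightarrow>
    pverts G \<noteq> {} \<and> (\<forall>X\<subseteq>pverts G. X \<noteq> {} \<longrightarrow> (\<forall>u\<in>X. nbrs G u \<subseteq> X) \<longrightarrow> X = pverts G)"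
    (is "?L \<longleftrightarrow> ?R")
proof
  assume L: ?L
  have sc: "strongly_connected (with_proj G)"
    using symmetric_connected_imp_strongly_connected[OF sym_arcs L] .
  have "v \<in> X" if X: "X \<subseteq> pverts G" "\<forall>u\<in>X. nbrs G u \<subseteq> X" "u \<in> X" and v: "v \<in> pverts G" for u v X
  proof -
    have "u \<rightarrow>\<^sup>*\<^bsub>with_proj G\<^esub> v"
      using sc X v by (auto simp: strongly_connected_def)
    then show ?thesis
      using X(2,3) by (induction rule: reachable_induct) (auto simp: nbrs_def)
  qed
  then show ?R using sc by (auto simp: strongly_connected_def)
next
  assume R: ?R
  have "u \<rightarrow>\<^sup>*\<^bsub>with_proj G\<^esub> v" if uv: "u \<in> pverts G" "v \<in> pverts G" for u v
  proof -
    let ?X = "{v. u \<rightarrow>\<^sup>*\<^bsub>with_proj G\<^esub> v}"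
    have "?X \<subseteq> pverts G" using reachable_in_verts by auto
    moreover have "?X \<noteq> {}" using uv reachable_refl by auto
    moreover have "\<forall>v\<in>?X. nbrs G v \<subseteq> ?X" using reachable_adj_trans by (auto simp: nbrs_def)
    ultimately have "?X = pverts G" using R by blast
    then show ?thesis using uv by blast
  qed
  then have "strongly_connected (with_proj G)" using R by (auto simp: strongly_connected_def)
  then show ?L
    using reachable_mk_symmetric_eq[OF sym_arcs] by (simp add: connected_def strongly_connected_def)
qed

section \<open>Graphs with a small vertex cover\<close>

text \<open>Stated for any set with independent complement, because it is used twice: for the
  complement of a maximum independent set of an arbitrary graph, and for the centres of a given
  tree.\<close>

locale cover_graph = pair_graph +
  fixes C
  assumes cover_subset: "C \<subseteq> pverts G"
    and nbrs_outside: "w \<in> pverts G - C \<Longrightarrow> nbrs G w \<subseteq> C"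
begin

lemma finite_cover [simp]: "finite C"
  using cover_subset pair_finite_verts finite_subset by blast

lemma finite_outside [simp]: "finite (pverts G - C)"
  using pair_finite_verts by blast

text \<open>Eliminating the values of an eigenvector outside the cover turns a bound on the spectral
  radius into a bound for a quadratic form on the cover only.\<close>

lemma cover_form_le:
  fixes \<sigma> :: real and x :: "'a \<Rightarrow> real"
  assumes ne: "pverts G \<noteq> {}" and pos: "\<sigma> > 0" and le: "graph_spectral_radius G \<le> \<sigma>"
  shows "\<sigma> * (\<Sum>u\<in>C. x u * (\<Sum>v\<in>nbrs G u \<inter> C. x v)) + (\<Sum>w\<in>pverts G - C. (\<Sum>u\<in>nbrs G w. x u)\<^sup>2)
    \<le> \<sigma>\<^sup>2 * (\<Sum>u\<in>C. (x u)\<^sup>2)"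
proof -
  let ?I = "pverts G - C"
  define y where "y w = (\<Sum>u\<in>nbrs G w. x u)" for w
  \<comment> \<open>At an outer vertex the eigenvalue equation for \<open>\<sigma>\<close> forces
    the value \<open>y w / \<sigma>\<close>. It is also the value that maximizes
    \<open>f^T A f - \<sigma> * |f|^2\<close> for fixed \<open>x\<close>.\<close>
  define f where "f v = (if v \<in> C then x v else y v / \<sigma>)" for v
  let ?a = "\<Sum>u\<in>C. x u * (\<Sum>v\<in>nbrs G u \<inter> C. x v)"
  let ?b = "\<Sum>w\<in>?I. (y w)\<^sup>2"
  have split: "(\<Sum>v\<in>pverts G. h v) = (\<Sum>v\<in>C. h v) + (\<Sum>w\<in>?I. h w)" for h :: "'a \<Rightarrow> real"
    using sum.subset_diff[OF cover_subset pair_finite_verts, of h] by simp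
  have nC: "(\<Sum>u\<in>nbrs G v. f u) = (\<Sum>u\<in>nbrs G v \<inter> C. x u) + (\<Sum>u\<in>nbrs G v \<inter> ?I. y u / \<sigma>)" for v
  proof -
    have "(nbrs G v \<inter> C) \<union> (nbrs G v \<inter> ?I) = nbrs G v" using nbrs_subset by blast
    then have "(\<Sum>u\<in>nbrs G v. f u) = (\<Sum>u\<in>nbrs G v \<inter> C. f u) + (\<Sum>u\<in>nbrs G v \<inter> ?I. f u)"
      using sum.union_disjoint[of "nbrs G v \<inter> C" "nbrs G v \<inter> ?I" f] by auto
    also have "(\<Sum>u\<in>nbrs G v \<inter> C. f u) = (\<Sum>u\<in>nbrs G v \<inter> C. x u)"
      by (intro sum.cong) (auto simp: f_def)
    also have "(\<Sum>u\<in>nbrs G v \<inter> ?I. f u) = (\<Sum>u\<in>nbrs G v \<inter> ?I. y u / \<sigma>)"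
      by (intro sum.cong) (auto simp: f_def)
    finally show ?thesis .
  qed
  have nI: "(\<Sum>u\<in>nbrs G w. f u) = y w" if "w \<in> ?I" for w
    unfolding y_def using nbrs_outside[OF that] by (intro sum.cong) (auto simp: f_def)
  have "(\<Sum>v\<in>C. x v * (\<Sum>u\<in>nbrs G v \<inter> ?I. y u / \<sigma>)) = (\<Sum>v\<in>C. \<Sum>u\<in>nbrs G v \<inter> ?I. x v * y u / \<sigma>)"
    by (simp add: sum_distrib_left)
  also have "\<dots> = (\<Sum>w\<in>?I. \<Sum>v\<in>nbrs G w \<inter> C. x v * y w / \<sigma>)"
    by (rule sum_nbrs_swap) (use cover_subset in auto)
  also have "\<dots> = (\<Sum>w\<in>?I. (y w)\<^sup>2 / \<sigma>)"
  proof (intro sum.cong refl)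
    fix w assume w: "w \<in> ?I"
    have "nbrs G w \<inter> C = nbrs G w" using nbrs_outside[OF w] by blast
    then show "(\<Sum>v\<in>nbrs G w \<inter> C. x v * y w / \<sigma>) = (y w)\<^sup>2 / \<sigma>"
      by (simp add: y_def power2_eq_square sum_divide_distrib sum_distrib_right)
  qed
  finally have cross: "(\<Sum>v\<in>C. x v * (\<Sum>u\<in>nbrs G v \<inter> ?I. y u / \<sigma>)) = ?b / \<sigma>"
    by (simp add: sum_divide_distrib)
  have "adj_form f f = (\<Sum>v\<in>C. x v * (\<Sum>u\<in>nbrs G v. f u)) + (\<Sum>w\<in>?I. y w / \<sigma> * (\<Sum>u\<in>nbrs G w. f u))"
    unfolding adj_form_def split by (intro arg_cong2[where f = "(+)"] sum.cong refl) (auto simp: f_def)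
  also have "(\<Sum>w\<in>?I. y w / \<sigma> * (\<Sum>u\<in>nbrs G w. f u)) = ?b / \<sigma>"
    unfolding sum_divide_distrib by (intro sum.cong refl) (simp add: nI power2_eq_square)
  also have "(\<Sum>v\<in>C. x v * (\<Sum>u\<in>nbrs G v. f u)) = ?a + ?b / \<sigma>"
    by (simp add: nC distrib_left sum.distrib cross)
  finally have Q: "adj_form f f = ?a + 2 * ?b / \<sigma>" by simp
  have N: "(\<Sum>v\<in>pverts G. (f v)\<^sup>2) = (\<Sum>u\<in>C. (x u)\<^sup>2) + ?b / \<sigma>\<^sup>2"
    unfolding split sum_divide_distrib
    by (intro arg_cong2[where f = "(+)"] sum.cong refl) (auto simp: f_def power_divide)
  have "adj_form f f \<le> graph_spectral_radius G * (\<Sum>v\<in>pverts G. (f v)\<^sup>2)"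
    by (rule adj_form_le_spectral_radius[OF ne])
  also have "\<dots> \<le> \<sigma> * (\<Sum>v\<in>pverts G. (f v)\<^sup>2)"
    using le by (intro mult_right_mono sum_nonneg) auto
  \<comment> \<open>After the multiplication by \<open>\<sigma>\<close> the form contributes
    \<open>?b\<close> twice and the norm contributes it once, so one copy survives.\<close>
  finally have "\<sigma> * (?a + 2 * ?b / \<sigma>) \<le> \<sigma> * (\<sigma> * ((\<Sum>u\<in>C. (x u)\<^sup>2) + ?b / \<sigma>\<^sup>2))"
    unfolding Q N using pos by (intro mult_left_mono) auto
  moreover have "\<sigma> * (?a + 2 * ?b / \<sigma>) = \<sigma> * ?a + 2 * ?b"
    using pos by (simp add: field_simps)
  moreover have "\<sigma> * (\<sigma> * ((\<Sum>u\<in>C. (x u)\<^sup>2) + ?b / \<sigma>\<^sup>2)) = \<sigma>\<^sup>2 * (\<Sum>u\<in>C. (x u)\<^sup>2) + ?b"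
    using pos by (simp add: field_simps power2_eq_square)
  ultimately show ?thesis unfolding y_def by linarith
qed

text \<open>Adjacency on \<open>C\<close> after every outer vertex has been replaced by edges
  between all its neighbours; connectedness of \<open>G\<close> is inherited by this
  relation.\<close>

definition linked :: "'a \<Rightarrow> 'a \<Rightarrow> bool" where
  "linked u v \<longleftrightarrow> v \<in> nbrs G u \<or> (\<exists>w\<in>pverts G - C. {u, v} \<subseteq> nbrs G w)"

end

section \<open>Counting the links that connectedness requires\<close>

locale connected_cover_graph = cover_graph +
  assumes conn: "Digraph_Component.connected (with_proj G)"
begin

lemma verts_ne: "pverts G \<noteq> {}"
  using conn connected_iff_cut by blast

text \<open>\<open>S\<close> together with the outer vertices touching it misses a vertex of
  \<open>C\<close>, so it is not closed. An arc leaving it must end in \<open>C - S\<close>, and it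
  starts in \<open>S\<close> or at an outer vertex next to \<open>S\<close>.\<close>

lemma exists_linked:
  assumes S: "S \<subseteq> C" "S \<noteq> {}" "S \<noteq> C"
  obtains u v where "u \<in> S" "v \<in> C - S" "linked u v"
proof -
  let ?X = "S \<union> {w \<in> pverts G - C. nbrs G w \<inter> S \<noteq> {}}"
  have "?X \<noteq> pverts G" using S cover_subset by blast
  moreover have "?X \<subseteq> pverts G" "?X \<noteq> {}" using S cover_subset by blast+
  ultimately obtain a where a: "a \<in> ?X" "\<not> nbrs G a \<subseteq> ?X"
    using conn[unfolded connected_iff_cut] by meson
  then obtain b where b: "b \<in> nbrs G a" "b \<notin> ?X" by blast
  have bV: "b \<in> pverts G" using b nbrs_subset by blast
  show thesis
  proof (cases "a \<in> S")
    case True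
    have "b \<in> C" using b bV True nbrs_sym by blast
    then show thesis using that[of a b] True b by (auto simp: linked_def)
  next
    case False
    then have aI: "a \<in> pverts G - C" and "nbrs G a \<inter> S \<noteq> {}" using a by auto
    then obtain u where u: "u \<in> S" "u \<in> nbrs G a" by blast
    have "b \<in> C" using b aI nbrs_outside by blast
    then show thesis using that[of u b] u b aI by (auto simp: linked_def)
  qed
qed

lemma card_nbrs_pos:
  assumes "w \<in> pverts G - C" "C \<noteq> {}"
  shows "card (nbrs G w) \<ge> 1"
proof -
  have "{w} \<noteq> pverts G" using assms cover_subset by auto
  then have "\<not> nbrs G w \<subseteq> {w}"
    using assms(1) conn[unfolded connected_iff_cut, THEN conjunct2, rule_format, of "{w}"] by blast
  then have "nbrs G w \<noteq> {}" by blast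
  then show ?thesis by (simp add: Suc_le_eq card_gt_0_iff)
qed

text \<open>Grow \<open>S\<close> by one linked vertex at a time. The new vertex either brings an
  edge inside \<open>S\<close>, counted at both ends, or raises the excess
  \<open>card (nbrs G w \<inter> S) - 1\<close> of an outer vertex by one, counted with factor 2.
  Either way the right-hand side gains at least 2.\<close>

lemma growth_count:
  assumes "1 \<le> k" "k \<le> card C"
  shows "\<exists>S\<subseteq>C. card S = k \<and>
    2 * (k - 1) \<le> 2 * (\<Sum>w\<in>pverts G - C. card (nbrs G w \<inter> S) - 1) + (\<Sum>u\<in>S. card (nbrs G u \<inter> S))"
  using assms
proof (induction k rule: nat_induct_at_least)
  case base
  then obtain c where "c \<in> C" by fastforce
  then show ?case by (intro exI[of _ "{c}"]) auto
next
  case (Suc k)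
  then obtain S where S: "S \<subseteq> C" "card S = k" and
    IH: "2 * (k - 1) \<le> 2 * (\<Sum>w\<in>pverts G - C. card (nbrs G w \<inter> S) - 1) + (\<Sum>u\<in>S. card (nbrs G u \<inter> S))"
    by auto
  have fS: "finite S" using S(1) finite_cover by (rule finite_subset)
  obtain u v where uv: "u \<in> S" "v \<in> C - S" "linked u v"
    using exists_linked[of S] S Suc.hyps Suc.prems by (metis Suc_n_not_le_n card.empty not_one_le_zero)
  let ?S = "insert v S"
  have cS: "card ?S = Suc k" "?S \<subseteq> C" using uv S fS by auto
  have mono1: "card (nbrs G w \<inter> S) - 1 \<le> card (nbrs G w \<inter> ?S) - 1" for w
    by (intro diff_le_mono card_mono) auto
  have mono2: "card (nbrs G w \<inter> S) \<le> card (nbrs G w \<inter> ?S)" for w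
    by (intro card_mono) auto
  have m1: "(\<Sum>w\<in>pverts G - C. card (nbrs G w \<inter> S) - 1) \<le> (\<Sum>w\<in>pverts G - C. card (nbrs G w \<inter> ?S) - 1)"
    by (intro sum_mono mono1)
  have m2: "(\<Sum>u\<in>S. card (nbrs G u \<inter> S)) \<le> (\<Sum>u\<in>S. card (nbrs G u \<inter> ?S))"
    by (intro sum_mono mono2)
  have ins: "(\<Sum>u\<in>?S. card (nbrs G u \<inter> ?S)) = card (nbrs G v \<inter> ?S) + (\<Sum>u\<in>S. card (nbrs G u \<inter> ?S))"
    using uv fS by simp
  have "2 * (\<Sum>w\<in>pverts G - C. card (nbrs G w \<inter> S) - 1) + (\<Sum>u\<in>S. card (nbrs G u \<inter> S)) + 2
      \<le> 2 * (\<Sum>w\<in>pverts G - C. card (nbrs G w \<inter> ?S) - 1) + (\<Sum>u\<in>?S. card (nbrs G u \<inter> ?S))"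
  proof (cases "v \<in> nbrs G u")
    case True
    then have "u \<in> nbrs G v \<inter> ?S" using uv nbrs_sym by blast
    then have 1: "card (nbrs G v \<inter> ?S) \<ge> 1"
      by (metis One_nat_def Suc_leI card_gt_0_iff empty_iff finite_Int finite_nbrs)
    have "(\<Sum>u\<in>S. card (nbrs G u \<inter> S)) < (\<Sum>u\<in>S. card (nbrs G u \<inter> ?S))"
    proof (rule sum_strict_mono_ex1[OF fS])
      show "\<forall>x\<in>S. card (nbrs G x \<inter> S) \<le> card (nbrs G x \<inter> ?S)" using mono2 by blast
      have "nbrs G u \<inter> S \<subset> nbrs G u \<inter> ?S" using True uv by blast
      then have "card (nbrs G u \<inter> S) < card (nbrs G u \<inter> ?S)" by (intro psubset_card_mono) auto
      then show "\<exists>a\<in>S. card (nbrs G a \<inter> S) < card (nbrs G a \<inter> ?S)" using uv by blast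
    qed
    with 1 m1 ins show ?thesis by linarith
  next
    case False
    then obtain w where w: "w \<in> pverts G - C" "u \<in> nbrs G w" "v \<in> nbrs G w"
      using uv(3) by (auto simp: linked_def)
    have "(\<Sum>w\<in>pverts G - C. card (nbrs G w \<inter> S) - 1) < (\<Sum>w\<in>pverts G - C. card (nbrs G w \<inter> ?S) - 1)"
    proof (rule sum_strict_mono_ex1[OF finite_outside])
      show "\<forall>x\<in>pverts G - C. card (nbrs G x \<inter> S) - 1 \<le> card (nbrs G x \<inter> ?S) - 1"
        using mono1 by blast
      have "nbrs G w \<inter> S \<subset> nbrs G w \<inter> ?S" using w uv by blast
      then have "card (nbrs G w \<inter> S) < card (nbrs G w \<inter> ?S)" by (intro psubset_card_mono) auto
      \<comment> \<open>Needed because of truncated subtraction: going from 0 to 1 neighbours in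
        \<open>S\<close> would not raise the excess.\<close>
      moreover have "card (nbrs G w \<inter> S) \<ge> 1"
        using w uv by (metis IntI One_nat_def Suc_leI card_gt_0_iff empty_iff finite_Int finite_nbrs)
      ultimately have "card (nbrs G w \<inter> S) - 1 < card (nbrs G w \<inter> ?S) - 1" by linarith
      then show "\<exists>a\<in>pverts G - C. card (nbrs G a \<inter> S) - 1 < card (nbrs G a \<inter> ?S) - 1"
        using w by blast
    qed
    with m2 ins show ?thesis by linarith
  qed
  then show ?case using IH cS Suc(1) by (intro exI[of _ ?S]) auto
qed

lemma cover_count:
  assumes "C \<noteq> {}"
  shows "2 * (card C - 1) \<le> 2 * (\<Sum>w\<in>pverts G - C. card (nbrs G w) - 1) + (\<Sum>u\<in>C. card (nbrs G u \<inter> C))"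
proof -
  have "1 \<le> card C" using assms by (simp add: Suc_le_eq card_gt_0_iff)
  then obtain S where S: "S \<subseteq> C" "card S = card C" and
    *: "2 * (card C - 1) \<le> 2 * (\<Sum>w\<in>pverts G - C. card (nbrs G w \<inter> S) - 1) + (\<Sum>u\<in>S. card (nbrs G u \<inter> S))"
    using growth_count[of "card C"] by blast
  have "S = C" using S card_subset_eq finite_cover by blast
  moreover have "(\<Sum>w\<in>pverts G - C. card (nbrs G w \<inter> C) - 1) = (\<Sum>w\<in>pverts G - C. card (nbrs G w) - 1)"
    using nbrs_outside by (intro sum.cong refl) (simp add: Int_absorb2)
  ultimately show ?thesis using * by metis
qed

text \<open>\<open>a\<close> is twice the number of edges inside \<open>C\<close>, \<open>p\<close>
  the total excess of the outer degrees over 1, and \<open>q\<close> vanishes just when all outer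
  degrees are at most 2. The quadratic form at the constant vector bounds a weighted sum of the
  three from above; the link count bounds \<open>a + 2 * p\<close> from below.\<close>

lemma bipartite_tree_if_spectral_radius_small:
  fixes \<sigma> :: real
  assumes card: "card C = 5" and \<sigma>: "\<sigma> \<ge> 5 / 2" "5 * \<sigma>\<^sup>2 < card (pverts G) + 8"
    and le: "graph_spectral_radius G \<le> \<sigma>"
  shows "\<And>u. u \<in> C \<Longrightarrow> nbrs G u \<inter> C = {}"
    and "\<And>w. w \<in> pverts G - C \<Longrightarrow> card (nbrs G w) = 1 \<or> card (nbrs G w) = 2"
    and "card {w \<in> pverts G - C. card (nbrs G w) = 2} = 4"
proof -
  let ?I = "pverts G - C"
  let ?d = "\<lambda>w. card (nbrs G w)"
  define a where "a = (\<Sum>u\<in>C. card (nbrs G u \<inter> C))"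
  define p where "p = (\<Sum>w\<in>?I. ?d w - 1)"
  define q where "q = (\<Sum>w\<in>?I. (?d w - 1) * (?d w - 2))"
  have ne: "C \<noteq> {}" using card by auto
  have cI: "card (pverts G) = card ?I + 5"
    using card_Diff_subset[OF finite_cover cover_subset] card card_mono[OF pair_finite_verts cover_subset] by simp
  \<comment> \<open>The expansion prices the first extra neighbour at 3 and puts everything beyond
    degree 2 into the last product. Degree 0, where the identity fails for truncated subtraction, is
    excluded by connectedness.\<close>
  have d: "(?d w)\<^sup>2 = 1 + 3 * (?d w - 1) + (?d w - 1) * (?d w - 2)" if "w \<in> ?I" for w
  proof -
    have "?d w = 1 \<or> ?d w \<ge> 2" using card_nbrs_pos[OF that ne] by linarith
    then show ?thesis
    proof
      assume "?d w \<ge> 2"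
      then obtain e where "?d w = e + 2" by (metis le_add_diff_inverse2)
      then show ?thesis by (simp add: power2_eq_square)
    qed simp
  qed
  have sq: "(\<Sum>w\<in>?I. (?d w)\<^sup>2) = card ?I + 3 * p + q"
    by (subst sum.cong[OF refl d]) (auto simp: p_def q_def sum.distrib sum_distrib_left sum_Suc)
  have "\<sigma> * (\<Sum>u\<in>C. 1 * (\<Sum>v\<in>nbrs G u \<inter> C. 1)) + (\<Sum>w\<in>?I. (\<Sum>u\<in>nbrs G w. 1)\<^sup>2) \<le> \<sigma>\<^sup>2 * (\<Sum>u\<in>C. 1\<^sup>2)"
    using cover_form_le[OF verts_ne _ le, of "\<lambda>_. 1"] \<sigma>(1) by simp
  then have "\<sigma> * real a + real (\<Sum>w\<in>?I. (?d w)\<^sup>2) \<le> 5 * \<sigma>\<^sup>2"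
    using card by (simp add: a_def mult.commute)
  then have "\<sigma> * real a + 3 * real p + real q < 13"
    using \<sigma>(2) unfolding sq cI by simp
  moreover have "5 / 2 * real a \<le> \<sigma> * real a" using \<sigma>(1) by (intro mult_right_mono) auto
  ultimately have "5 / 2 * real a + 3 * real p + real q < 13" by linarith
  then have "5 * a + 6 * p + 2 * q < 26" by linarith
  moreover have "8 \<le> 2 * p + a"
    using cover_count[OF ne] card by (simp add: a_def p_def)
  \<comment> \<open>Subtracting three times \<open>8 \<le> 2 * p + a\<close> from the strict bound
    leaves \<open>2 * a + 2 * q < 2\<close>; then \<open>p\<close> lies between 4 and 26/6.\<close>
  ultimately have a0: "a = 0" and p4: "p = 4" and q0: "q = 0" by linarith+
  show "\<And>u. u \<in> C \<Longrightarrow> nbrs G u \<inter> C = {}"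
    using a0 by (auto simp: a_def)
  show d12: "?d w = 1 \<or> ?d w = 2" if "w \<in> ?I" for w
  proof -
    have "(?d w - 1) * (?d w - 2) = 0" using q0 that by (simp add: q_def)
    then show ?thesis using card_nbrs_pos[OF that ne] by auto
  qed
  have "p = (\<Sum>w\<in>?I. if ?d w = 2 then 1 else 0)"
    unfolding p_def using d12 by (intro sum.cong refl) force
  also have "\<dots> = card {w \<in> ?I. ?d w = 2}"
    by (simp add: sum.inter_filter[symmetric])
  finally show "card {w \<in> ?I. ?d w = 2} = 4" using p4 by simp
qed

end

section \<open>Isomorphisms\<close>

lemma isomorphicI:
  assumes "pair_graph G" "pair_graph H" and f: "bij_betw f (pverts G) (pverts H)"
    and arcs: "\<And>u v. u \<in> pverts G \<Longrightarrow> v \<in> pverts G \<Longrightarrow> (f u, f v) \<in> parcs H \<longleftrightarrow> (u, v) \<in> parcs G"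
  shows "G \<cong>\<^sub>g H"
proof -
  interpret G: pair_graph G by fact
  interpret H: pair_graph H by fact
  let ?h = "\<lparr>iso_verts = f, iso_arcs = map_prod f f, iso_head = snd, iso_tail = fst\<rparr>"
  have fV: "f ` pverts G = pverts H" and inj: "inj_on f (pverts G)"
    using f by (auto simp: bij_betw_def)
  have "inj_on (map_prod f f) (parcs G)"
  proof (rule inj_on_subset[OF map_prod_inj_on[OF inj inj]])
    show "parcs G \<subseteq> pverts G \<times> pverts G" using G.in_arcsD1 G.in_arcsD2 by auto
  qed
  then have 1: "pre_digraph.digraph_isomorphism (with_proj G) ?h"
    using inj G.wf_digraph by (auto simp: pre_digraph.digraph_isomorphism_def)
  have "parcs H = map_prod f f ` parcs G"
  proof (intro equalityI subsetI)
    fix e assume e: "e \<in> parcs H"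
    obtain x y where xy: "e = (x, y)" by (cases e)
    then obtain u v where "u \<in> pverts G" "v \<in> pverts G" "x = f u" "y = f v"
      using e fV H.in_arcsD1 H.in_arcsD2 by blast
    then show "e \<in> map_prod f f ` parcs G" using arcs e xy by (auto intro!: image_eqI[of _ _ "(u, v)"])
  next
    fix e assume "e \<in> map_prod f f ` parcs G"
    then show "e \<in> parcs H" using arcs G.in_arcsD1 G.in_arcsD2 by auto
  qed
  then have "with_proj H = app_iso ?h (with_proj G)"
    by (simp add: app_iso_def fV with_proj_def)
  with 1 show ?thesis by (auto simp: isomorphic_def digraph_iso_def)
qed

text \<open>The theorem speaks about an arbitrary \<open>T\<close>, so that \<open>T\<close> is a
  finite simple graph has to be read off from the isomorphism, hence the conclusion
  \<open>pair_graph G\<close>.\<close>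

lemma isomorphicE:
  assumes iso: "G \<cong>\<^sub>g H" and H: "pair_graph H"
  obtains f where "pair_graph G" "bij_betw f (pverts G) (pverts H)"
    "\<And>u v. u \<in> pverts G \<Longrightarrow> v \<in> pverts G \<Longrightarrow> (f u, f v) \<in> parcs H \<longleftrightarrow> (u, v) \<in> parcs G"
proof -
  interpret H: pair_graph H by fact
  obtain h where h: "pre_digraph.digraph_isomorphism (with_proj G) h"
    and eq: "with_proj H = app_iso h (with_proj G)"
    using iso by (auto simp: isomorphic_def digraph_iso_def)
  define f where "f = iso_verts h"
  have wf: "pair_wf_digraph G" and inj: "inj_on f (pverts G)" and inja: "inj_on (iso_arcs h) (parcs G)"
    using h by (auto simp: pre_digraph.digraph_isomorphism_def f_def wf_digraph_wp_iff)
  interpret G: pair_wf_digraph G by fact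
  have V: "pverts H = f ` pverts G" and A: "parcs H = iso_arcs h ` parcs G"
    and ht: "iso_tail h = fst" "iso_head h = snd"
    using eq by (auto simp: app_iso_def f_def with_proj_def)
  have "iso_arcs h e = map_prod f f e" if "e \<in> parcs G" for e
    using h that ht by (auto simp: pre_digraph.digraph_isomorphism_def f_def prod_eq_iff)
  then have A': "parcs H = map_prod f f ` parcs G" using A by force
  have arcs: "(f u, f v) \<in> parcs H \<longleftrightarrow> (u, v) \<in> parcs G" if "u \<in> pverts G" "v \<in> pverts G" for u v
  proof
    assume "(f u, f v) \<in> parcs H"
    then obtain u' v' where "(u', v') \<in> parcs G" "f u = f u'" "f v = f v'" unfolding A' by auto
    then show "(u, v) \<in> parcs G" using inj that G.in_arcsD1 G.in_arcsD2 by (metis inj_onD)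
  qed (auto simp: A')
  have "pair_graph G"
  proof
    show "finite (pverts G)" using H.pair_finite_verts V inj by (simp add: finite_image_iff)
    show "finite (parcs G)" using H.pair_finite_arcs A inja by (simp add: finite_image_iff)
    show "symmetric (with_proj G)"
      using arcs H.arcs_symmetric G.in_arcsD1 G.in_arcsD2 unfolding symmetric_def
      by (auto intro!: symI) metis
    show "fst e \<noteq> snd e" if "e \<in> parcs G" for e
      using H.pair_no_loops[of "map_prod f f e"] that A' by auto
  qed
  moreover have "bij_betw f (pverts G) (pverts H)" using inj V by (simp add: bij_betw_def)
  ultimately show thesis using that arcs by blast
qed

text \<open>Used to move a tree with vertices of type \<open>tree_vertex\<close> onto the vertex set
  of a given graph.\<close>

definition image_graph :: "('a \<Rightarrow> 'b) \<Rightarrow> 'a pair_pre_digraph \<Rightarrow> 'b pair_pre_digraph" where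
  "image_graph f G = \<lparr>pverts = f ` pverts G, parcs = map_prod f f ` parcs G\<rparr>"

lemma image_graph:
  assumes "pair_graph G" and inj: "inj_on f (pverts G)"
  shows "pair_graph (image_graph f G)"
    and "\<And>u v. u \<in> pverts G \<Longrightarrow> v \<in> pverts G \<Longrightarrow> (f u, f v) \<in> parcs (image_graph f G) \<longleftrightarrow> (u, v) \<in> parcs G"
proof -
  interpret G: pair_graph G by fact
  show "(f u, f v) \<in> parcs (image_graph f G) \<longleftrightarrow> (u, v) \<in> parcs G"
    if "u \<in> pverts G" "v \<in> pverts G" for u v
  proof
    assume "(f u, f v) \<in> parcs (image_graph f G)"
    then obtain u' v' where "(u', v') \<in> parcs G" "f u = f u'" "f v = f v'" by (auto simp: image_graph_def)
    then show "(u, v) \<in> parcs G" using inj that G.in_arcsD1 G.in_arcsD2 by (metis inj_onD)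
  qed (auto simp: image_graph_def)
  show "pair_graph (image_graph f G)"
  proof
    fix e assume "e \<in> parcs (image_graph f G)"
    then obtain u v where e: "e = (f u, f v)" "(u, v) \<in> parcs G" by (auto simp: image_graph_def)
    then have uv: "u \<in> pverts G" "v \<in> pverts G" "u \<noteq> v"
      using G.in_arcsD1 G.in_arcsD2 G.pair_no_loops[of "(u, v)"] by auto
    show "fst e \<in> pverts (image_graph f G)" "snd e \<in> pverts (image_graph f G)"
      using e uv by (auto simp: image_graph_def)
    show "fst e \<noteq> snd e" using e uv inj by (auto dest: inj_onD)
  next
    show "finite (pverts (image_graph f G))" "finite (parcs (image_graph f G))"
      using G.pair_finite_verts G.pair_finite_arcs by (auto simp: image_graph_def)
    show "symmetric (with_proj (image_graph f G))"
      using G.arcs_symmetric by (auto simp: image_graph_def symmetric_def intro!: symI)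
  qed
qed

section \<open>Trees with pendant vertices attached to five centres\<close>

text \<open>An edge \<open>(i, j)\<close> of the index tree \<open>E\<close> stands for a vertex adjacent to exactly the centres
  \<open>us ! i\<close> and \<open>us ! j\<close>, so \<open>E\<close> is the tree whose subdivision carries the pendant vertices.\<close>

definition multiplicity_of :: "(nat \<times> nat) list \<Rightarrow> (nat \<Rightarrow> nat) \<Rightarrow> nat set \<Rightarrow> nat" where
  "multiplicity_of E a S =
     (\<Sum>i<5. if S = {i} then a i else 0) + (if S \<in> (\<lambda>(i, j). {i, j}) ` set E then 1 else 0)"

text \<open>If the outer vertices are independent, a graph is determined up to isomorphism by how
  many of them have each neighbourhood. Recording only these numbers avoids naming the outer
  vertices; sets with multiplicity 0 exclude everything else.\<close>

definition tree_model ::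
    "'a pair_pre_digraph \<Rightarrow> 'a list \<Rightarrow> (nat \<times> nat) list \<Rightarrow> (nat \<Rightarrow> nat) \<Rightarrow> bool" where
  "tree_model G us E a \<longleftrightarrow>
     pair_graph G \<and> length us = 5 \<and> distinct us \<and> set us \<subseteq> pverts G \<and>
     (\<forall>u\<in>set us. nbrs G u \<inter> set us = {}) \<and>
     (\<forall>w\<in>pverts G - set us. nbrs G w \<subseteq> set us) \<and>
     (\<forall>S\<subseteq>{..<5}. card {w \<in> pverts G - set us. nbrs G w = (!) us ` S} = multiplicity_of E a S)"

lemma tree_model_cong:
  assumes "\<And>i. i < 5 \<Longrightarrow> a i = b i"
  shows "tree_model G us E a \<longleftrightarrow> tree_model G us E b"
proof -
  have "multiplicity_of E a = multiplicity_of E b"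
    using assms by (auto simp: multiplicity_of_def fun_eq_iff intro!: sum.cong)
  then show ?thesis by (simp add: tree_model_def)
qed

lemma tree_model_transfer:
  assumes G: "tree_model G us E a" and H: "pair_graph H" and f: "bij_betw f (pverts G) (pverts H)"
    and arcs: "\<And>u v. u \<in> pverts G \<Longrightarrow> v \<in> pverts G \<Longrightarrow> (f u, f v) \<in> parcs H \<longleftrightarrow> (u, v) \<in> parcs G"
  shows "tree_model H (map f us) E a"
proof -
  interpret G: pair_graph G using G by (simp add: tree_model_def)
  interpret H: pair_graph H by fact
  have us: "length us = 5" "distinct us" "set us \<subseteq> pverts G"
    and nC: "\<And>u. u \<in> set us \<Longrightarrow> nbrs G u \<inter> set us = {}"
    and nI: "\<And>w. w \<in> pverts G - set us \<Longrightarrow> nbrs G w \<subseteq> set us"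
    and card: "\<And>S. S \<subseteq> {..<5} \<Longrightarrow>
      card {w \<in> pverts G - set us. nbrs G w = (!) us ` S} = multiplicity_of E a S"
    using G by (auto simp: tree_model_def)
  have fV: "pverts H = f ` pverts G" and inj: "inj_on f (pverts G)"
    using f by (auto simp: bij_betw_def)
  have nb: "nbrs H (f v) = f ` nbrs G v" if v: "v \<in> pverts G" for v
  proof (intro equalityI subsetI)
    fix y assume y: "y \<in> nbrs H (f v)"
    then obtain u where "u \<in> pverts G" "y = f u" using H.nbrs_subset fV by blast
    then show "y \<in> f ` nbrs G v" using y v arcs by (auto simp: nbrs_def)
  next
    fix y assume "y \<in> f ` nbrs G v"
    then show "y \<in> nbrs H (f v)" using v arcs G.in_arcsD2 by (auto simp: nbrs_def)
  qed
  have diff: "pverts H - set (map f us) = f ` (pverts G - set us)"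
    using us(3) inj by (simp add: fV inj_on_image_set_diff[OF inj])
  have eq: "f ` X = f ` Y \<longleftrightarrow> X = Y" if "X \<subseteq> pverts G" "Y \<subseteq> pverts G" for X Y
    using that inj by (metis inj_on_image_eq_iff)
  have "card {w \<in> pverts H - set (map f us). nbrs H w = (!) (map f us) ` S} = multiplicity_of E a S"
    if S: "S \<subseteq> {..<5}" for S
  proof -
    have im: "(!) (map f us) ` S = f ` (!) us ` S" using S us(1) by (force simp: image_iff)
    have sub: "(!) us ` S \<subseteq> pverts G" using S us(1,3) by (auto dest!: nth_mem[of _ us] subsetD)
    have "{w \<in> pverts H - set (map f us). nbrs H w = (!) (map f us) ` S}
        = f ` {w \<in> pverts G - set us. nbrs G w = (!) us ` S}"
      unfolding diff im using nb eq[OF G.nbrs_subset sub] by auto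
    moreover have "inj_on f {w \<in> pverts G - set us. nbrs G w = (!) us ` S}"
      using inj by (rule inj_on_subset) auto
    ultimately show ?thesis using card[OF S] by (simp add: card_image)
  qed
  moreover have "nbrs H u \<inter> set (map f us) = {}" if u: "u \<in> set (map f us)" for u
  proof -
    obtain v where v: "v \<in> set us" "u = f v" using u by auto
    then have vG: "v \<in> pverts G" using us(3) by blast
    have "f ` nbrs G v \<inter> f ` set us = f ` (nbrs G v \<inter> set us)"
      using inj_on_image_Int[OF inj G.nbrs_subset us(3)] by simp
    then show ?thesis using nC[OF v(1)] nb[OF vG] v(2) by simp
  qed
  moreover have "nbrs H w \<subseteq> set (map f us)" if "w \<in> pverts H - set (map f us)" for w
  proof -
    obtain v where v: "v \<in> pverts G - set us" "w = f v" using \<open>w \<in> _\<close> unfolding diff by blast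
    then show ?thesis using nI[OF v(1)] nb[of v] by auto
  qed
  ultimately show ?thesis
    using H us fV inj by (auto simp: tree_model_def distinct_map intro: inj_on_subset)
qed

text \<open>Outer vertices with equal neighbourhoods are interchangeable. Bijections between the
  classes for each index set \<open>S\<close>, glued to the map of centres by index, form the
  isomorphism.\<close>

lemma tree_model_isomorphic:
  assumes G: "tree_model G us E a" and H: "tree_model H vs E a"
  shows "G \<cong>\<^sub>g H"
proof -
  interpret G: pair_graph G using G by (simp add: tree_model_def)
  interpret H: pair_graph H using H by (simp add: tree_model_def)
  have us: "length us = 5" "distinct us" "set us \<subseteq> pverts G"
    and nC: "\<And>u. u \<in> set us \<Longrightarrow> nbrs G u \<inter> set us = {}"
    and nI: "\<And>w. w \<in> pverts G - set us \<Longrightarrow> nbrs G w \<subseteq> set us"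
    and card: "\<And>S. S \<subseteq> {..<5} \<Longrightarrow>
      card {w \<in> pverts G - set us. nbrs G w = (!) us ` S} = multiplicity_of E a S"
    using G by (auto simp: tree_model_def)
  have vs: "length vs = 5" "distinct vs" "set vs \<subseteq> pverts H"
    and nC': "\<And>u. u \<in> set vs \<Longrightarrow> nbrs H u \<inter> set vs = {}"
    and nI': "\<And>w. w \<in> pverts H - set vs \<Longrightarrow> nbrs H w \<subseteq> set vs"
    and card': "\<And>S. S \<subseteq> {..<5} \<Longrightarrow>
      card {w \<in> pverts H - set vs. nbrs H w = (!) vs ` S} = multiplicity_of E a S"
    using H by (auto simp: tree_model_def)
  define I where "I S = {w \<in> pverts G - set us. nbrs G w = (!) us ` S}" for S
  define J where "J S = {w \<in> pverts H - set vs. nbrs H w = (!) vs ` S}" for S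
  have "finite (I S)" "finite (J S)" for S
    using G.pair_finite_verts H.pair_finite_verts by (auto simp: I_def J_def)
  then have "\<exists>h. bij_betw h (I S) (J S)" if "S \<subseteq> {..<5}" for S
    using card[OF that] card'[OF that] by (intro finite_same_card_bij) (auto simp: I_def J_def)
  then obtain \<phi> where \<phi>: "\<And>S. S \<subseteq> {..<5} \<Longrightarrow> bij_betw (\<phi> S) (I S) (J S)" by metis
  have injU: "inj_on ((!) us) {..<5}" and injV: "inj_on ((!) vs) {..<5}"
    using us vs by (auto simp: inj_on_nth)
  have setU: "(!) us ` {..<5} = set us" and setV: "(!) vs ` {..<5} = set vs"
    using us(1) vs(1) by (auto simp: in_set_conv_nth image_iff)
  define ix where "ix v = inv_into {..<5} ((!) us) v" for v
  have ix: "ix (us ! i) = i" if "i < 5" for i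
    using inv_into_f_f[OF injU] that by (simp add: ix_def)
  define N where "N w = ix ` nbrs G w" for w
  have ix': "ix v < 5 \<and> us ! ix v = v" if "v \<in> set us" for v
    using that ix us(1) by (auto simp: in_set_conv_nth)
  have N: "N w \<subseteq> {..<5}" "nbrs G w = (!) us ` N w" if "w \<in> pverts G - set us" for w
    using nI[OF that] ix' by (auto simp: N_def image_iff subset_iff) 
  have NI: "N w = S" if "S \<subseteq> {..<5}" "w \<in> I S" for S w
    using that ix by (force simp: N_def I_def image_iff subset_iff)
  define f where "f v = (if v \<in> set us then vs ! ix v else \<phi> (N v) v)" for v
  have f_us: "f (us ! i) = vs ! i" if "i < 5" for i
    using that us(1) ix by (simp add: f_def)
  have f_out: "f w \<in> J (N w)" "f w \<notin> set vs" "f w \<in> pverts H" "nbrs H (f w) = (!) vs ` N w"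
    if w: "w \<in> pverts G - set us" for w
  proof -
    have "w \<in> I (N w)" using w N[OF w] by (simp add: I_def)
    then have "\<phi> (N w) w \<in> J (N w)" using \<phi>[OF N(1)[OF w]] by (auto dest: bij_betwE)
    then show "f w \<in> J (N w)" using w by (simp add: f_def)
    then show "f w \<notin> set vs" "f w \<in> pverts H" "nbrs H (f w) = (!) vs ` N w" by (auto simp: J_def)
  qed
  have split: "(\<exists>i<5. v = us ! i) \<or> v \<in> pverts G - set us" if "v \<in> pverts G" for v
    using that us(1) by (auto simp: in_set_conv_nth)
  have memV: "vs ! i \<in> set vs" if "i < 5" for i using that vs(1) by simp
  have memU: "us ! i \<in> set us" if "i < 5" for i using that us(1) by simp
  have inj: "inj_on f (pverts G)"
  proof (rule inj_onI)
    fix x y assume xy: "x \<in> pverts G" "y \<in> pverts G" "f x = f y"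
    consider i j where "i < 5" "j < 5" "x = us ! i" "y = us ! j"
      | i where "i < 5" "x = us ! i" "y \<in> pverts G - set us"
      | i where "i < 5" "y = us ! i" "x \<in> pverts G - set us"
      | "x \<in> pverts G - set us" "y \<in> pverts G - set us"
      using split xy by meson
    then show "x = y"
    proof cases
      case 1
      then have "i = j" using xy(3) f_us vs by (simp add: nth_eq_iff_index_eq)
      then show ?thesis using 1 by simp
    next
      case 2
      then show ?thesis using xy(3) f_us memV f_out(2)[of y] by metis
    next
      case 3
      then show ?thesis using xy(3) f_us memV f_out(2)[of x] by metis
    next
      case 4
      have "(!) vs ` N x = (!) vs ` N y" using f_out(4)[OF 4(1)] f_out(4)[OF 4(2)] xy(3) by simp
      then have Nxy: "N x = N y"
        using inj_on_image_eq_iff[OF injV N(1)[OF 4(1)] N(1)[OF 4(2)]] by simp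
      have "x \<in> I (N x)" "y \<in> I (N x)" using 4 N Nxy by (auto simp: I_def)
      moreover have "\<phi> (N x) x = \<phi> (N x) y" using xy(3) 4 Nxy by (simp add: f_def)
      ultimately show ?thesis
        using \<phi>[OF N(1)[OF 4(1)]] by (auto simp: bij_betw_def dest: inj_onD)
    qed
  qed
  have surj: "f ` pverts G = pverts H"
  proof (intro equalityI subsetI)
    fix y assume "y \<in> f ` pverts G"
    then obtain v where v: "v \<in> pverts G" "y = f v" by blast
    then show "y \<in> pverts H" using split[OF v(1)] f_us memV vs(3) f_out(3) by auto
  next
    fix y assume y: "y \<in> pverts H"
    show "y \<in> f ` pverts G"
    proof (cases "y \<in> set vs")
      case True
      then obtain i where "i < 5" "y = vs ! i" using vs(1) by (auto simp: in_set_conv_nth)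
      then show ?thesis using f_us memU us(3) by (intro image_eqI[of _ _ "us ! i"]) auto
    next
      case False
      define S where "S = {i. i < 5 \<and> vs ! i \<in> nbrs H y}"
      have S: "S \<subseteq> {..<5}" by (auto simp: S_def)
      have "nbrs H y \<subseteq> set vs" using nI' y False by blast
      then have "nbrs H y = (!) vs ` S" using vs(1) by (fastforce simp: S_def in_set_conv_nth)
      then have "y \<in> J S" using y False by (simp add: J_def)
      then have "y \<in> \<phi> S ` I S" using bij_betw_imp_surj_on[OF \<phi>[OF S]] by simp
      then obtain w where w: "w \<in> I S" "\<phi> S w = y" by blast
      then have "N w = S" using NI[OF S] by simp
      then have "f w = y" using w by (simp add: f_def I_def)
      then show ?thesis using w(1) by (auto simp: I_def)
    qed
  qed
  have cross: "(us ! i, w) \<in> parcs G \<longleftrightarrow> (vs ! i, f w) \<in> parcs H"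
    if i: "i < 5" and w: "w \<in> pverts G - set us" for i w
  proof -
    have "(us ! i, w) \<in> parcs G \<longleftrightarrow> us ! i \<in> (!) us ` N w"
      using N(2)[OF w] G.nbrs_sym by (auto simp: nbrs_def)
    also have "\<dots> \<longleftrightarrow> i \<in> N w"
      using inj_on_image_mem_iff[OF injU] N(1)[OF w] i by auto
    also have "\<dots> \<longleftrightarrow> vs ! i \<in> (!) vs ` N w"
      using inj_on_image_mem_iff[OF injV] N(1)[OF w] i by auto
    also have "\<dots> \<longleftrightarrow> (vs ! i, f w) \<in> parcs H"
      using f_out(4)[OF w] H.nbrs_sym by (auto simp: nbrs_def)
    finally show ?thesis .
  qed
  have "(f u, f v) \<in> parcs H \<longleftrightarrow> (u, v) \<in> parcs G" if uv: "u \<in> pverts G" "v \<in> pverts G" for u v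
  proof -
    consider i j where "i < 5" "j < 5" "u = us ! i" "v = us ! j"
      | i where "i < 5" "u = us ! i" "v \<in> pverts G - set us"
      | i where "i < 5" "v = us ! i" "u \<in> pverts G - set us"
      | "u \<in> pverts G - set us" "v \<in> pverts G - set us"
      using split uv by meson
    then show ?thesis
    proof cases
      case 1
      have "(u, v) \<notin> parcs G" using nC[of u] memU 1 by (auto simp: nbrs_def)
      moreover have "(f u, f v) \<notin> parcs H" using nC'[of "f u"] memV 1 f_us by (auto simp: nbrs_def)
      ultimately show ?thesis by simp
    next
      case 2
      then show ?thesis using cross f_us by simp
    next
      case 3
      then show ?thesis using cross[of i u] f_us G.arcs_symmetric H.arcs_symmetric by metis
    next
      case 4
      have "(u, v) \<notin> parcs G" using nI[OF 4(1)] 4(2) by (auto simp: nbrs_def)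
      moreover have "(f u, f v) \<notin> parcs H"
        using nI'[of "f u"] f_out(2,3)[OF 4(1)] f_out(2)[OF 4(2)] by (auto simp: nbrs_def)
      ultimately show ?thesis by simp
    qed
  qed
  then show ?thesis
    using inj surj G.pair_graph H.pair_graph by (intro isomorphicI[of _ _ f]) (auto simp: bij_betw_def)
qed

text \<open>Connected with one edge fewer than vertices, hence a tree; connectedness is again a cut
  condition. The orientation \<open>i < j\<close> makes an edge recoverable from the set
  \<open>{i, j}\<close> and keeps edges apart from singletons.\<close>

definition index_tree :: "(nat \<times> nat) list \<Rightarrow> bool" where
  "index_tree E \<longleftrightarrow> distinct E \<and> length E = 4 \<and> (\<forall>(i, j)\<in>set E. i < j \<and> j < 5) \<and>
     (\<forall>X. X \<inter> {..<5} \<noteq> {} \<longrightarrow> (\<forall>(i, j)\<in>set E. i \<in> X \<longleftrightarrow> j \<in> X) \<longrightarrow> {..<5} \<subseteq> X)"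

lemma index_tree_inj:
  assumes "index_tree E"
  shows "inj_on (\<lambda>(i, j). {i, j}) (set E)"
proof -
  have "i < j" if "(i, j) \<in> set E" for i j using assms that by (auto simp: index_tree_def)
  then show ?thesis by (auto simp: inj_on_def doubleton_eq_iff) (meson less_asym)+
qed

lemma multiplicity_of_singleton:
  assumes "index_tree E" "i < 5"
  shows "multiplicity_of E a {i} = a i"
proof -
  have "{i} \<notin> (\<lambda>(i, j). {i, j}) ` set E"
    using assms by (fastforce simp: index_tree_def)
  moreover have "(\<Sum>j<5. if i = j then a j else 0) = a i" using assms(2) by simp
  ultimately show ?thesis by (simp add: multiplicity_of_def)
qed

lemma multiplicity_of_edge:
  assumes "index_tree E" "(i, j) \<in> set E"
  shows "multiplicity_of E a {i, j} = 1"
proof -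
  have "{i, j} \<noteq> {k}" for k using assms by (fastforce simp: index_tree_def)
  then show ?thesis using assms(2) by (auto simp: multiplicity_of_def image_iff)
qed

lemma multiplicity_of_eq_0:
  assumes "\<And>i. i < 5 \<Longrightarrow> S \<noteq> {i}" "\<And>i j. (i, j) \<in> set E \<Longrightarrow> S \<noteq> {i, j}"
  shows "multiplicity_of E a S = 0"
  using assms by (auto simp: multiplicity_of_def)

section \<open>Order, connectedness, independence number and spectral radius of the encoded
  graphs\<close>

locale pendant_tree =
  fixes G :: "'a pair_pre_digraph" and us E a
  assumes model: "tree_model G us E a" and tree: "index_tree E"
begin

sublocale cover_graph G "set us"
  using model by (auto simp: tree_model_def cover_graph_def cover_graph_axioms_def)

lemma length_us [simp]: "length us = 5" and distinct_us [simp]: "distinct us"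
  using model by (auto simp: tree_model_def)

lemma nth_in_us [simp]: "i < 5 \<Longrightarrow> us ! i \<in> set us" by simp

lemma us_eq_iff [simp]: "i < 5 \<Longrightarrow> j < 5 \<Longrightarrow> us ! i = us ! j \<longleftrightarrow> i = j"
  by (simp add: nth_eq_iff_index_eq)

lemma inj_us: "inj_on ((!) us) {..<5}" by (auto simp: inj_on_nth)

lemma image_us: "(!) us ` {..<5} = set us" by (auto simp: in_set_conv_nth image_iff)

lemma sum_us: "(\<Sum>u\<in>set us. h u) = (\<Sum>i<5. h (us ! i))"
  unfolding image_us[symmetric] by (rule sum.reindex_cong[OF inj_us refl refl])

lemma nbrs_centre: "i < 5 \<Longrightarrow> nbrs G (us ! i) \<inter> set us = {}"
  using model by (auto simp: tree_model_def)

lemma card_nbrs_eq: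
  "S \<subseteq> {..<5} \<Longrightarrow> card {w \<in> pverts G - set us. nbrs G w = (!) us ` S} = multiplicity_of E a S"
  using model by (auto simp: tree_model_def)

lemma edge_bounds: "(i, j) \<in> set E \<Longrightarrow> i < j \<and> j < 5 \<and> i < 5"
  using tree by (auto simp: index_tree_def)

text \<open>Groups the outer vertices by neighbourhood. The vertex count, the eigenvalue equation
  and the quadratic form are all obtained by choosing \<open>g\<close>.\<close>

lemma sum_outside:
  fixes g :: "'a set \<Rightarrow> real"
  shows "(\<Sum>w\<in>pverts G - set us. g (nbrs G w))
    = (\<Sum>i<5. real (a i) * g {us ! i}) + (\<Sum>(i, j)\<in>set E. g {us ! i, us ! j})"
proof -
  let ?I = "pverts G - set us"
  let ?c = "\<lambda>(i, j). {i, j}"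
  have "(\<Sum>w\<in>?I. g (nbrs G w)) = (\<Sum>Y\<in>Pow (set us). \<Sum>w\<in>{w \<in> ?I. nbrs G w = Y}. g (nbrs G w))"
    using nbrs_outside by (intro sum.group[symmetric]) auto
  also have "\<dots> = (\<Sum>Y\<in>Pow (set us). real (card {w \<in> ?I. nbrs G w = Y}) * g Y)"
    by (intro sum.cong refl) simp
  also have "\<dots> = (\<Sum>S\<in>Pow {..<5}. real (card {w \<in> ?I. nbrs G w = (!) us ` S}) * g ((!) us ` S))"
    unfolding image_us[symmetric] image_Pow_surj[OF refl, symmetric]
    by (rule sum.reindex_cong[OF inj_on_image_Pow[OF inj_us] refl refl])
  also have "\<dots> = (\<Sum>S\<in>Pow {..<5}. real (multiplicity_of E a S) * g ((!) us ` S))"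
    by (intro sum.cong refl) (metis card_nbrs_eq PowD)
  also have "\<dots> = (\<Sum>S\<in>Pow {..<5}. \<Sum>i<5. if S = {i} then real (a i) * g ((!) us ` S) else 0)
      + (\<Sum>S\<in>Pow {..<5}. if S \<in> ?c ` set E then g ((!) us ` S) else 0)"
    unfolding sum.distrib[symmetric]
    by (intro sum.cong refl) (auto simp: multiplicity_of_def distrib_right sum_distrib_right
        if_distrib[of real] if_distrib[of "\<lambda>x. x * _"] cong: if_cong)
  also have "(\<Sum>S\<in>Pow {..<5}. \<Sum>i<5. if S = {i} then real (a i) * g ((!) us ` S) else 0)
      = (\<Sum>i<5. real (a i) * g {us ! i})"
    by (subst sum.swap) (intro sum.cong refl, simp)
  also have "(\<Sum>S\<in>Pow {..<5}. if S \<in> ?c ` set E then g ((!) us ` S) else 0)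
      = (\<Sum>S\<in>?c ` set E. g ((!) us ` S))"
  proof -
    have "Pow {..<5} \<inter> ?c ` set E = ?c ` set E" using edge_bounds by auto
    then show ?thesis by (simp add: sum.inter_restrict[symmetric])
  qed
  also have "\<dots> = (\<Sum>(i, j)\<in>set E. g {us ! i, us ! j})"
    by (rule sum.reindex_cong[OF index_tree_inj[OF tree] refl]) auto
  finally show ?thesis .
qed

lemma card_edges: "card (set E) = 4"
  using tree by (simp add: index_tree_def distinct_card)

lemma card_outside: "card (pverts G - set us) = (\<Sum>i<5. a i) + 4"
  using sum_outside[of "\<lambda>_. 1"] by (simp add: card_edges case_prod_unfold flip: of_nat_sum)

lemma card_pverts: "card (pverts G) = (\<Sum>i<5. a i) + 9"
  using card_Diff_subset[OF finite_cover cover_subset] card_mono[OF pair_finite_verts cover_subset]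
    card_outside by (simp add: distinct_card)

lemma exists_pendant:
  assumes "i < 5" "a i > 0"
  obtains p where "p \<in> pverts G - set us" "nbrs G p = {us ! i}"
proof -
  have "card {w \<in> pverts G - set us. nbrs G w = (!) us ` {i}} > 0"
    using assms card_nbrs_eq[of "{i}"] multiplicity_of_singleton[OF tree] by simp
  then have "{w \<in> pverts G - set us. nbrs G w = (!) us ` {i}} \<noteq> {}" by (metis card.empty less_irrefl)
  then show thesis using that by auto
qed

lemma exists_edge_vertex:
  assumes "(i, j) \<in> set E"
  obtains w where "w \<in> pverts G - set us" "nbrs G w = {us ! i, us ! j}"
proof -
  have "card {w \<in> pverts G - set us. nbrs G w = (!) us ` {i, j}} > 0"
    using assms edge_bounds[OF assms] card_nbrs_eq[of "{i, j}"] multiplicity_of_edge[OF tree] by simp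
  then have "{w \<in> pverts G - set us. nbrs G w = (!) us ` {i, j}} \<noteq> {}" by (metis card.empty less_irrefl)
  then show thesis using that by auto
qed

lemma nbrs_outside_ne:
  assumes "w \<in> pverts G - set us"
  shows "nbrs G w \<noteq> {}"
proof
  assume "nbrs G w = {}"
  then have "w \<in> {w \<in> pverts G - set us. nbrs G w = (!) us ` {}}" using assms by simp
  moreover have "card {w \<in> pverts G - set us. nbrs G w = (!) us ` {}} = 0"
    using card_nbrs_eq[of "{}"] multiplicity_of_eq_0[of "{}" E a] by simp
  ultimately show False using finite_outside by (auto simp: card_eq_0_iff)
qed

text \<open>A nonempty closed set contains a centre, the edge vertices transmit membership along
  \<open>E\<close>, and the cut condition of \<open>index_tree\<close> yields all centres; every
  outer vertex is next to one of them.\<close>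

lemma connected_pendant_tree: "Digraph_Component.connected (with_proj G)"
  unfolding connected_iff_cut
proof (intro conjI allI impI)
  show "pverts G \<noteq> {}" using card_pverts by force
  fix X assume X: "X \<subseteq> pverts G" "X \<noteq> {}" "\<forall>u\<in>X. nbrs G u \<subseteq> X"
  have step: "v \<in> X" if "u \<in> X" "v \<in> nbrs G u" for u v using X that by blast
  let ?Y = "{i. us ! i \<in> X}"
  obtain v where v: "v \<in> X" using X by blast
  have "\<exists>u\<in>X. u \<in> set us"
  proof (cases "v \<in> set us")
    case False
    then have v': "v \<in> pverts G - set us" using v X(1) by blast
    then obtain u where "u \<in> nbrs G v" using nbrs_outside_ne by blast
    then show ?thesis using nbrs_outside[OF v'] step[OF v] by blast
  qed (use v in blast)
  then have "?Y \<inter> {..<5} \<noteq> {}" by (auto simp: in_set_conv_nth)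
  moreover have "i \<in> ?Y \<longleftrightarrow> j \<in> ?Y" if "(i, j) \<in> set E" for i j
  proof -
    obtain w where w: "nbrs G w = {us ! i, us ! j}" using exists_edge_vertex[OF \<open>(i, j) \<in> set E\<close>] by metis
    then have "w \<in> nbrs G (us ! i)" "w \<in> nbrs G (us ! j)" using nbrs_sym by blast+
    then show ?thesis using step[of _ w] step[of w] w by blast
  qed
  then have "\<forall>(i, j)\<in>set E. i \<in> ?Y \<longleftrightarrow> j \<in> ?Y" by blast
  moreover have "X \<inter> {..<5} \<noteq> {} \<longrightarrow> (\<forall>(i, j)\<in>set E. i \<in> X \<longleftrightarrow> j \<in> X) \<longrightarrow> {..<5} \<subseteq> X" for X
    using tree unfolding index_tree_def by meson
  ultimately have "{..<5} \<subseteq> ?Y" by meson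
  then have us: "set us \<subseteq> X" by (auto simp: in_set_conv_nth)
  have "w \<in> X" if w: "w \<in> pverts G - set us" for w
  proof -
    obtain u where "u \<in> nbrs G w" using nbrs_outside_ne[OF w] by blast
    then show ?thesis using nbrs_outside[OF w] us step nbrs_sym by blast
  qed
  then show "X = pverts G" using X(1) us by blast
qed

text \<open>Each centre and one of its pendant vertices form an edge, and these five edges are
  disjoint. An independent set misses an end of each, chosen by \<open>q\<close>; the set of all
  outer vertices misses exactly five vertices.\<close>

lemma independence_number_pendant_tree:
  assumes pos: "\<And>i. i < 5 \<Longrightarrow> a i > 0"
  shows "independence_number G = (\<Sum>i<5. a i) + 4"
  unfolding independence_number_def
proof (rule Max_eqI)
  have "{S. independent_set G S} \<subseteq> Pow (pverts G)" by (auto simp: independent_set_def)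
  then show "finite (card ` {S. independent_set G S})"
    using pair_finite_verts by (meson finite_Pow_iff finite_imageI finite_subset)
  have "independent_set G (pverts G - set us)"
    using nbrs_outside by (auto simp: independent_set_def nbrs_def)
  then show "(\<Sum>i<5. a i) + 4 \<in> card ` {S. independent_set G S}"
    using card_outside by (metis imageI mem_Collect_eq)
  fix y assume "y \<in> card ` {S. independent_set G S}"
  then obtain S where S: "independent_set G S" "y = card S" by blast
  obtain p where p: "\<And>i. i < 5 \<Longrightarrow> p i \<in> pverts G - set us \<and> nbrs G (p i) = {us ! i}"
  proof -
    have "\<forall>i. \<exists>p. i < 5 \<longrightarrow> p \<in> pverts G - set us \<and> nbrs G p = {us ! i}"
      using exists_pendant pos by (metis (no_types))
    from choice[OF this] show thesis using that by blast
  qed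
  define q where "q i = (if us ! i \<in> S then p i else us ! i)" for i
  have "q i \<in> pverts G - S" if i: "i < 5" for i
  proof (cases "us ! i \<in> S")
    case True
    moreover have "(p i, us ! i) \<in> parcs G" using p[OF i] by (auto simp: nbrs_def)
    ultimately have "p i \<notin> S" using S by (auto simp: independent_set_def)
    then show ?thesis using p[OF i] True by (simp add: q_def)
  next
    case False
    then show ?thesis using i cover_subset by (auto simp: q_def)
  qed
  then have sub: "q ` {..<5} \<subseteq> pverts G - S" by auto
  have "inj_on q {..<5}"
  proof (rule inj_onI)
    fix i j assume ij: "i \<in> {..<5}" "j \<in> {..<5}" "q i = q j"
    then have "nbrs G (p i) = {us ! i}" "nbrs G (p j) = {us ! j}" "p i \<notin> set us" "p j \<notin> set us"
      using p by auto
    moreover have "us ! i \<in> set us" "us ! j \<in> set us" using ij by auto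
    ultimately have "us ! i = us ! j"
      using ij(3) unfolding q_def by (metis singleton_inject)
    then show "i = j" using ij by simp
  qed
  then have "5 \<le> card (pverts G - S)"
    using card_mono[OF _ sub] pair_finite_verts by (simp add: card_image)
  moreover have "S \<subseteq> pverts G" using S by (simp add: independent_set_def)
  ultimately show "y \<le> (\<Sum>i<5. a i) + 4"
    using card_pverts S(2) pair_finite_verts card_mono[OF pair_finite_verts \<open>S \<subseteq> _\<close>]
    by (simp add: card_Diff_subset finite_subset)
qed

lemma in_graph_class:
  assumes "\<And>i. i < 5 \<Longrightarrow> a i > 0"
  shows "G \<in> graph_class ((\<Sum>i<5. a i) + 9) ((\<Sum>i<5. a i) + 4)"
  unfolding graph_class_def
  using pair_graph connected_pendant_tree card_pverts independence_number_pendant_tree[OF assms]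
  by blast

text \<open>On the centres the square of the adjacency matrix is the adjacency matrix of
  \<open>E\<close> plus a diagonal with entries \<open>a i\<close> plus the degree of
  \<open>i\<close>. A positive eigenvector of it for \<open>\<theta>\<close> extends to a positive
  eigenvector of \<open>G\<close> for \<open>sqrt \<theta>\<close>.\<close>

lemma spectral_radius_pendant_tree:
  assumes pos: "\<theta> > 0" "\<And>i. i < 5 \<Longrightarrow> x i > 0"
    and eig: "\<And>i. i < 5 \<Longrightarrow>
      real (a i) * x i + (\<Sum>(j, k)\<in>set E. if i = j \<or> i = k then x j + x k else 0) = \<theta> * x i"
  shows "graph_spectral_radius G = sqrt \<theta>"
proof -
  define \<sigma> where "\<sigma> = sqrt \<theta>"
  have \<sigma>: "\<sigma> > 0" "\<sigma> * \<sigma> = \<theta>" using pos by (auto simp: \<sigma>_def)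
  define h where "h v = x (inv_into {..<5} ((!) us) v)" for v
  have h: "h (us ! i) = x i" if "i < 5" for i
    using inv_into_f_f[OF inj_us] that by (simp add: h_def)
  define f where "f v = (if v \<in> set us then h v else (\<Sum>u\<in>nbrs G v. h u) / \<sigma>)" for v
  have f_us: "f u = h u" if "u \<in> set us" for u using that by (simp add: f_def)
  have h_pos: "h u > 0" if "u \<in> set us" for u using that pos(2) h by (auto simp: in_set_conv_nth)
  have out: "(\<Sum>u\<in>nbrs G w. f u) = \<sigma> * f w" if w: "w \<in> pverts G - set us" for w
  proof -
    have "(\<Sum>u\<in>nbrs G w. f u) = (\<Sum>u\<in>nbrs G w. h u)"
      using nbrs_outside[OF w] f_us by (intro sum.cong) auto
    then show ?thesis using w \<sigma> by (simp add: f_def)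
  qed
  have ins: "(\<Sum>u\<in>nbrs G (us ! i). f u) = \<sigma> * f (us ! i)" if i: "i < 5" for i
  proof -
    let ?g = "\<lambda>Y. if us ! i \<in> Y then (\<Sum>u\<in>Y. h u) / \<sigma> else 0"
    have "nbrs G (us ! i) = (pverts G - set us) \<inter> {w. us ! i \<in> nbrs G w}"
      using nbrs_centre[OF i] nbrs_subset nbrs_sym by blast
    then have "(\<Sum>u\<in>nbrs G (us ! i). f u) = (\<Sum>w\<in>pverts G - set us. if us ! i \<in> nbrs G w then f w else 0)"
      by (simp add: sum.inter_restrict)
    also have "\<dots> = (\<Sum>w\<in>pverts G - set us. ?g (nbrs G w))"
      by (intro sum.cong) (auto simp: f_def)
    also have "\<dots> = (\<Sum>j<5. real (a j) * ?g {us ! j}) + (\<Sum>(j, k)\<in>set E. ?g {us ! j, us ! k})"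
      by (rule sum_outside)
    also have "(\<Sum>j<5. real (a j) * ?g {us ! j}) = (\<Sum>j<5. if j = i then real (a i) * x i / \<sigma> else 0)"
      using i by (intro sum.cong) (auto simp: h)
    also have "\<dots> = real (a i) * x i / \<sigma>" using i by simp
    also have "(\<Sum>(j, k)\<in>set E. ?g {us ! j, us ! k})
        = (\<Sum>(j, k)\<in>set E. if i = j \<or> i = k then x j + x k else 0) / \<sigma>"
      unfolding sum_divide_distrib[where A = "set E"]
    proof (intro sum.cong refl)
      fix e assume "e \<in> set E"
      then obtain j k where e: "e = (j, k)" "j < k" "k < 5" "j < 5"
        using edge_bounds by (metis surj_pair)
      then show "(case e of (j, k) \<Rightarrow> ?g {us ! j, us ! k})
          = (case e of (j, k) \<Rightarrow> if i = j \<or> i = k then x j + x k else 0) / \<sigma>"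
        using i by (auto simp: h)
    qed
    also have "real (a i) * x i / \<sigma> + \<dots> = \<theta> * x i / \<sigma>"
      unfolding add_divide_distrib[symmetric] using eig[OF i] by simp
    also have "\<dots> = \<sigma> * f (us ! i)"
      using \<sigma> f_us[of "us ! i"] h[OF i] i by (simp add: field_simps flip: \<sigma>(2))
    finally show ?thesis .
  qed
  show ?thesis
    unfolding \<sigma>_def[symmetric]
  proof (rule spectral_radius_eqI)
    show "pverts G \<noteq> {}" using card_pverts by force
    show "f v > 0" if "v \<in> pverts G" for v
    proof (cases "v \<in> set us")
      case False
      then have v: "v \<in> pverts G - set us" using that by blast
      have "(\<Sum>u\<in>nbrs G v. h u) > 0"
        using nbrs_outside[OF v] nbrs_outside_ne[OF v] h_pos by (intro sum_pos) auto
      then show ?thesis using False \<sigma> by (simp add: f_def)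
    qed (use f_us h_pos in auto)
    show "(\<Sum>u\<in>nbrs G v. f u) = \<sigma> * f v" if "v \<in> pverts G" for v
      using that out ins by (cases "v \<in> set us") (auto simp: in_set_conv_nth)
  qed
qed

end

section \<open>Trees on five indices\<close>

text \<open>The indices follow the ordered vertices of \<open>F5_1\<close>, \<open>F5_2\<close> and
  \<open>F5_3\<close>: contracting each path of length 2 between listed vertices to an edge turns
  these trees into star, fork and path.\<close>

definition star_tree :: "(nat \<times> nat) list" where "star_tree = [(0, 1), (1, 2), (1, 3), (1, 4)]"
definition fork_tree :: "(nat \<times> nat) list" where "fork_tree = [(0, 1), (1, 2), (2, 3), (1, 4)]"
definition path_tree :: "(nat \<times> nat) list" where "path_tree = [(0, 1), (1, 2), (2, 3), (3, 4)]"

lemma lessThan_5: "{..<5} = {0, 1, 2, 3, 4 :: nat}"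
  by auto

lemma index_tree_star: "index_tree star_tree"
  and index_tree_fork: "index_tree fork_tree"
  and index_tree_path: "index_tree path_tree"
  by (auto simp: index_tree_def star_tree_def fork_tree_def path_tree_def lessThan_5)

text \<open>The trees on five vertices, in growth order: three connected vertices contain a path, a
  fourth gives a path or a claw, and the position of the fifth decides among star, fork and
  path.\<close>

lemma five_vertex_tree:
  assumes sym: "\<And>u v. R u v \<Longrightarrow> R v u" and dist: "distinct [c0, c1, c2, c3, c4]"
    and R: "R c0 c1" "R c0 c2 \<or> R c1 c2" "R c0 c3 \<or> R c1 c3 \<or> R c2 c3"
      "R c0 c4 \<or> R c1 c4 \<or> R c2 c4 \<or> R c3 c4"
  obtains us E where "E \<in> {star_tree, fork_tree, path_tree}" "length us = 5" "distinct us"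
    "set us = {c0, c1, c2, c3, c4}" "\<And>i j. (i, j) \<in> set E \<Longrightarrow> R (us ! i) (us ! j)"
proof -
  note ex = that
  have *: thesis if "E \<in> {star_tree, fork_tree, path_tree}" "length us = 5" "set us = {c0, c1, c2, c3, c4}"
    "\<forall>(i, j)\<in>set E. R (us ! i) (us ! j)" for us E
  proof (rule ex[of E us])
    show "distinct us" using that(2,3) dist by (intro card_distinct) (simp add: card_insert_if)
  qed (use that in auto)
  obtain p q r where 3: "{p, q, r} = {c0, c1, c2}" "R p q" "R q r"
    using R(1,2) sym by (metis insert_commute)
  have mem: "(\<exists>u\<in>{p, q, r}. R u c) \<longleftrightarrow> R c0 c \<or> R c1 c \<or> R c2 c" for c
    unfolding 3(1) by simp
  have c3: "R p c3 \<or> R q c3 \<or> R r c3" using R(3) mem[of c3] by simp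
  have c4: "R p c4 \<or> R q c4 \<or> R r c4 \<or> R c3 c4" using R(4) mem[of c4] by auto
  have C: "{c0, c1, c2, c3, c4} = {p, q, r, c3, c4}" using 3(1) by auto
  \<comment> \<open>Settles all cases in which the first four vertices form a path: the fifth joins
    an end, giving the path, or an inner vertex, giving the fork.\<close>
  have P: thesis if "{w, x, y, z} = {p, q, r, c3}" "R w x" "R x y" "R y z" for w x y z
  proof -
    have W: "{c0, c1, c2, c3, c4} = {w, x, y, z, c4}" using that(1) C by auto
    have "\<exists>u\<in>{w, x, y, z}. R u c4" unfolding that(1) using c4 by auto
    then consider "R w c4" | "R x c4" | "R y c4" | "R z c4" by auto
    then show thesis
    proof cases
      case 1 then show ?thesis
        by (intro *[of path_tree "[c4, w, x, y, z]"]) (use that sym W in \<open>auto simp: path_tree_def\<close>)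
    next
      case 2 then show ?thesis
        by (intro *[of fork_tree "[w, x, y, z, c4]"]) (use that sym W in \<open>auto simp: fork_tree_def\<close>)
    next
      case 3 then show ?thesis
        by (intro *[of fork_tree "[z, y, x, w, c4]"]) (use that sym W in \<open>auto simp: fork_tree_def\<close>)
    next
      case 4 then show ?thesis
        by (intro *[of path_tree "[w, x, y, z, c4]"]) (use that sym W in \<open>auto simp: path_tree_def\<close>)
    qed
  qed
  consider "R p c3" | "R r c3" | "R q c3" using c3 by blast
  then show thesis
  proof cases
    case 1
    then show ?thesis by (intro P[of c3 p q r]) (use 3 sym in auto)
  next
    case 2
    then show ?thesis by (intro P[of p q r c3]) (use 3 sym in auto)
  next
    \<comment> \<open>The first four vertices form a claw with centre \<open>q\<close>: only
      \<open>q\<close> itself gives the star, each leaf gives the fork.\<close>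
    case q: 3
    consider "R p c4" | "R q c4" | "R r c4" | "R c3 c4" using c4 by blast
    then show ?thesis
    proof cases
      case 1 then show ?thesis
        by (intro *[of fork_tree "[r, q, p, c4, c3]"]) (use 3 q sym C in \<open>auto simp: fork_tree_def\<close>)
    next
      case 2 then show ?thesis
        by (intro *[of star_tree "[p, q, r, c3, c4]"]) (use 3 q sym C in \<open>auto simp: star_tree_def\<close>)
    next
      case 3 then show ?thesis
        by (intro *[of fork_tree "[p, q, r, c4, c3]"])
          (use \<open>R p q\<close> \<open>R q r\<close> q sym C in \<open>auto simp: fork_tree_def\<close>)
    next
      case 4 then show ?thesis
        by (intro *[of fork_tree "[p, q, c3, c4, r]"]) (use 3 q sym C in \<open>auto simp: fork_tree_def\<close>)
    qed
  qed
qed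

context connected_cover_graph
begin

text \<open>With no edges inside \<open>C\<close> and outer degrees at most 2, every link is an
  outer vertex whose neighbourhood is exactly a pair, so growing a set of centres produces a tree of
  such pairs.\<close>

lemma exists_index_tree:
  assumes card: "card C = 5"
    and nC: "\<And>u. u \<in> C \<Longrightarrow> nbrs G u \<inter> C = {}"
    and d: "\<And>w. w \<in> pverts G - C \<Longrightarrow> card (nbrs G w) \<le> 2"
  obtains us E where "E \<in> {star_tree, fork_tree, path_tree}" "length us = 5" "distinct us" "set us = C"
    "\<And>i j. (i, j) \<in> set E \<Longrightarrow> \<exists>w\<in>pverts G - C. nbrs G w = {us ! i, us ! j}"
proof -
  define R where "R u v \<longleftrightarrow> (\<exists>w\<in>pverts G - C. nbrs G w = {u, v})" for u v
  have sym: "R v u" if "R u v" for u v using that by (simp add: R_def insert_commute)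
  have step: "\<exists>v\<in>C - S. \<exists>u\<in>S. R u v" if S: "S \<subseteq> C" "S \<noteq> {}" "card S < 5" for S
  proof -
    have "S \<noteq> C" using S card by auto
    then obtain u v where uv: "u \<in> S" "v \<in> C - S" "linked u v"
      using exists_linked[OF S(1,2)] by metis
    then have "v \<notin> nbrs G u" using nC[of u] S by blast
    then obtain w where w: "w \<in> pverts G - C" "{u, v} \<subseteq> nbrs G w"
      using uv(3) by (auto simp: linked_def)
    have "u \<noteq> v" using uv by blast
    then have "card {u, v} = 2" by simp
    then have "nbrs G w = {u, v}" using card_seteq[OF finite_nbrs w(2)] d[OF w(1)] by simp
    then show ?thesis using uv w by (auto simp: R_def)
  qed
  have "C \<noteq> {}" using card by auto
  then obtain c0 where c0: "c0 \<in> C" by blast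
  obtain c1 where c1: "c1 \<in> C - {c0}" "R c0 c1" using step[of "{c0}"] c0 by auto
  obtain c2 where c2: "c2 \<in> C - {c0, c1}" "R c0 c2 \<or> R c1 c2"
  proof -
    have "\<exists>v\<in>C - {c0, c1}. \<exists>u\<in>{c0, c1}. R u v"
      using c0 c1 by (intro step) (auto simp: card_insert_if)
    then show thesis using that by blast
  qed
  obtain c3 where c3: "c3 \<in> C - {c0, c1, c2}" "R c0 c3 \<or> R c1 c3 \<or> R c2 c3"
  proof -
    have "\<exists>v\<in>C - {c0, c1, c2}. \<exists>u\<in>{c0, c1, c2}. R u v"
      using c0 c1 c2 by (intro step) (auto simp: card_insert_if)
    then show thesis using that by blast
  qed
  obtain c4 where c4: "c4 \<in> C - {c0, c1, c2, c3}" "R c0 c4 \<or> R c1 c4 \<or> R c2 c4 \<or> R c3 c4"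
  proof -
    have "\<exists>v\<in>C - {c0, c1, c2, c3}. \<exists>u\<in>{c0, c1, c2, c3}. R u v"
      using c0 c1 c2 c3 by (intro step) (auto simp: card_insert_if)
    then show thesis using that by blast
  qed
  have dist: "distinct [c0, c1, c2, c3, c4]" using c1 c2 c3 c4 by auto
  have "{c0, c1, c2, c3, c4} \<subseteq> C" using c0 c1 c2 c3 c4 by blast
  moreover have "card {c0, c1, c2, c3, c4} = 5" using distinct_card[OF dist] by simp
  ultimately have C: "{c0, c1, c2, c3, c4} = C" using card card_subset_eq finite_cover by metis
  show thesis
    by (rule five_vertex_tree[of R, OF sym dist c1(2) c2(2) c3(2) c4(2)])
      (use that C in \<open>auto simp: R_def\<close>)
qed

text \<open>Pigeonhole: the four edges need four different neighbourhoods, and only four outer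
  vertices have degree 2. So \<open>nbrs G\<close> is injective on these, and no further pair
  occurs.\<close>

lemma tree_modelI:
  assumes E: "index_tree E" and us: "length us = 5" "distinct us" "set us = C"
    and nC: "\<And>u. u \<in> C \<Longrightarrow> nbrs G u \<inter> C = {}"
    and d: "\<And>w. w \<in> pverts G - C \<Longrightarrow> card (nbrs G w) = 1 \<or> card (nbrs G w) = 2"
    and four: "card {w \<in> pverts G - C. card (nbrs G w) = 2} = 4"
    and edge: "\<And>i j. (i, j) \<in> set E \<Longrightarrow> \<exists>w\<in>pverts G - C. nbrs G w = {us ! i, us ! j}"
  shows "tree_model G us E (\<lambda>i. card {w \<in> pverts G - C. nbrs G w = {us ! i}})"
proof -
  let ?a = "\<lambda>i. card {w \<in> pverts G - C. nbrs G w = {us ! i}}"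
  let ?c = "\<lambda>(i, j). {i, j}"
  let ?D = "{w \<in> pverts G - C. card (nbrs G w) = 2}"
  have inj: "inj_on ((!) us) {..<5}" using us by (auto simp: inj_on_nth)
  have bounds: "i < j \<and> j < 5 \<and> i < 5" if "(i, j) \<in> set E" for i j
    using E that by (auto simp: index_tree_def)
  have Esub: "?c ` set E \<subseteq> Pow {..<5}" using bounds by auto
  let ?T = "(`) ((!) us) ` ?c ` set E"
  have finD: "finite ?D" using finite_outside by simp
  have "card ?T = card (?c ` set E)"
    by (rule card_image[OF inj_on_subset[OF inj_on_image_Pow[OF inj] Esub]])
  also have "\<dots> = 4"
    using card_image[OF index_tree_inj[OF E]] E by (simp add: index_tree_def distinct_card)
  finally have cT: "card ?T = 4" .
  have TD: "?T \<subseteq> nbrs G ` ?D"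
  proof
    fix Y assume "Y \<in> ?T"
    then obtain i j where ij: "(i, j) \<in> set E" "Y = {us ! i, us ! j}" by auto
    then obtain w where w: "w \<in> pverts G - C" "nbrs G w = Y" using edge by blast
    have "us ! i \<noteq> us ! j" using bounds[OF ij(1)] us by (simp add: nth_eq_iff_index_eq)
    then have "w \<in> ?D" using w ij by simp
    then show "Y \<in> nbrs G ` ?D" using w by blast
  qed
  have "card (nbrs G ` ?D) \<le> 4" using card_image_le[OF finD, of "nbrs G"] four by simp
  then have T: "?T = nbrs G ` ?D" using card_seteq[OF _ TD] finD cT by simp
  then have injD: "inj_on (nbrs G) ?D" using finD four cT by (intro eq_card_imp_inj_on) auto
  have "card {w \<in> pverts G - C. nbrs G w = (!) us ` S} = multiplicity_of E ?a S"
    if S: "S \<subseteq> {..<5}" for S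
  proof -
    have cS: "card ((!) us ` S) = card S" using card_image[OF inj_on_subset[OF inj S]] .
    consider i where "i < 5" "S = {i}" | i j where "(i, j) \<in> set E" "S = {i, j}"
      | "\<And>i. i < 5 \<Longrightarrow> S \<noteq> {i}" "\<And>i j. (i, j) \<in> set E \<Longrightarrow> S \<noteq> {i, j}" by blast
    then show ?thesis
    proof cases
      case 1
      then show ?thesis using multiplicity_of_singleton[OF E] by simp
    next
      case 2
      obtain w where w: "w \<in> pverts G - C" "nbrs G w = {us ! i, us ! j}" using edge 2 by blast
      have "us ! i \<noteq> us ! j" using bounds[OF 2(1)] us by (simp add: nth_eq_iff_index_eq)
      then have "{w' \<in> pverts G - C. nbrs G w' = (!) us ` S} = {w}"
        using w 2 inj_onD[OF injD] by auto
      then show ?thesis using multiplicity_of_edge[OF E] 2 by simp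
    next
      case 3
      have "{w \<in> pverts G - C. nbrs G w = (!) us ` S} = {}"
      proof (rule ccontr)
        assume "{w \<in> pverts G - C. nbrs G w = (!) us ` S} \<noteq> {}"
        then obtain w where w: "w \<in> pverts G - C" "nbrs G w = (!) us ` S" by blast
        have "card S \<noteq> 1" using 3(1) S by (auto simp: card_1_singleton_iff)
        then have "w \<in> ?D" using d[OF w(1)] w cS by auto
        then have "(!) us ` S \<in> ?T" unfolding T w(2)[symmetric] by (rule imageI)
        then obtain S' where S': "S' \<in> ?c ` set E" "(!) us ` S = (!) us ` S'" by (rule imageE)
        have "S' \<subseteq> {..<5}" using Esub S'(1) by auto
        then have "S = S'" using inj_on_image_eq_iff[OF inj S, of S'] S'(2) by blast
        then show False using 3(2) S'(1) by auto
      qed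
      then show ?thesis using multiplicity_of_eq_0[OF 3] by simp
    qed
  qed
  then show ?thesis
    using us nC nbrs_outside cover_subset pair_graph by (simp add: tree_model_def)
qed

lemma tree_model_if_spectral_radius_small:
  fixes \<sigma> :: real
  assumes "card C = 5" "\<sigma> \<ge> 5 / 2" "5 * \<sigma>\<^sup>2 < card (pverts G) + 8" "graph_spectral_radius G \<le> \<sigma>"
  obtains us E a where "E \<in> {star_tree, fork_tree, path_tree}" "tree_model G us E a"
proof -
  note T = bipartite_tree_if_spectral_radius_small[OF assms]
  obtain us E where E: "E \<in> {star_tree, fork_tree, path_tree}" "length us = 5" "distinct us" "set us = C"
    "\<And>i j. (i, j) \<in> set E \<Longrightarrow> \<exists>w\<in>pverts G - C. nbrs G w = {us ! i, us ! j}"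
    by (rule exists_index_tree[OF assms(1) T(1)]) (use T(2) in fastforce)+
  have "index_tree E" using E(1) index_tree_star index_tree_fork index_tree_path by blast
  then show thesis using that[OF E(1)] tree_modelI[OF _ E(2-4) T E(5)] by blast
qed

end

section \<open>From the spectral radius to a form in five variables\<close>

definition edge_degree :: "(nat \<times> nat) list \<Rightarrow> nat \<Rightarrow> nat" where
  "edge_degree E i = (\<Sum>(j, k)\<in>set E. if i = j \<or> i = k then 1 else 0)"

text \<open>That is, the largest eigenvalue of the adjacency matrix of \<open>E\<close> plus the diagonal matrix with entries
  \<open>d i\<close> is at most \<open>l\<close>.\<close>

definition potential_bound :: "(nat \<times> nat) list \<Rightarrow> (nat \<Rightarrow> int) \<Rightarrow> real \<Rightarrow> bool" where
  "potential_bound E d l \<longleftrightarrow> (\<forall>x :: nat \<Rightarrow> real.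
     (\<Sum>i<5. real_of_int (d i) * (x i)\<^sup>2) + 2 * (\<Sum>(i, j)\<in>set E. x i * x j) \<le> l * (\<Sum>i<5. (x i)\<^sup>2))"

lemma sum_edges_endpoints:
  fixes y :: "nat \<Rightarrow> real"
  assumes "index_tree E"
  shows "(\<Sum>(i, j)\<in>set E. y i + y j) = (\<Sum>i<5. real (edge_degree E i) * y i)"
proof -
  have "(\<Sum>i<5. real (edge_degree E i) * y i)
      = (\<Sum>i<5. \<Sum>(j, k)\<in>set E. if i = j \<or> i = k then y i else 0)"
    by (auto simp: edge_degree_def sum_distrib_right case_prod_unfold intro!: sum.cong)
  also have "\<dots> = (\<Sum>e\<in>set E. \<Sum>i<5. case e of (j, k) \<Rightarrow> if i = j \<or> i = k then y i else 0)"
    by (rule sum.swap)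
  also have "\<dots> = (\<Sum>(i, j)\<in>set E. y i + y j)"
  proof (intro sum.cong refl)
    fix e assume "e \<in> set E"
    then obtain j k where e: "e = (j, k)" "j < k" "k < 5"
      using assms by (auto simp: index_tree_def)
    have "(\<Sum>i<5. if i = j \<or> i = k then y i else 0) = (\<Sum>i<5. (if i = j then y i else 0) + (if i = k then y i else 0))"
      using e by (intro sum.cong) auto
    also have "\<dots> = y j + y k" using e by (simp add: sum.distrib)
    finally show "(\<Sum>i<5. case e of (j, k) \<Rightarrow> if i = j \<or> i = k then y i else 0) = (case e of (i, j) \<Rightarrow> y i + y j)"
      using e by simp
  qed
  finally show ?thesis ..
qed

lemma sum_edge_degree:
  assumes "index_tree E"
  shows "(\<Sum>i<5. edge_degree E i) = 8"
proof -
  have "real (\<Sum>i<5. edge_degree E i) = 8"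
    using sum_edges_endpoints[OF assms, of "\<lambda>_. 1"] assms
    by (simp add: case_prod_unfold index_tree_def distinct_card)
  then show ?thesis by linarith
qed

text \<open>An edge vertex contributes \<open>(x i + x j)^2\<close>: its squares add the degrees to
  the diagonal, its mixed term is the adjacency form of \<open>E\<close>. The shift subtracts
  \<open>K\<close> times the squared norm on both sides.\<close>

lemma (in pendant_tree) potential_bound_if_spectral_radius_le:
  fixes \<sigma> :: real and K :: int
  assumes "\<sigma> > 0" "graph_spectral_radius G \<le> \<sigma>"
  shows "potential_bound E (\<lambda>i. int (a i) + int (edge_degree E i) - K) (\<sigma>\<^sup>2 - K)"
  unfolding potential_bound_def
proof
  fix x :: "nat \<Rightarrow> real"
  define h where "h v = x (inv_into {..<5} ((!) us) v)" for v
  have h: "h (us ! i) = x i" if "i < 5" for i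
    using inv_into_f_f[OF inj_us] that by (simp add: h_def)
  have "pverts G \<noteq> {}" using card_pverts by force
  note cover_form_le[OF this assms, of h]
  moreover have "(\<Sum>u\<in>set us. h u * (\<Sum>v\<in>nbrs G u \<inter> set us. h v)) = 0"
    unfolding sum_us by (simp add: nbrs_centre)
  moreover have "(\<Sum>u\<in>set us. (h u)\<^sup>2) = (\<Sum>i<5. (x i)\<^sup>2)"
    unfolding sum_us by (simp add: h)
  moreover have "(\<Sum>w\<in>pverts G - set us. (\<Sum>u\<in>nbrs G w. h u)\<^sup>2)
      = (\<Sum>i<5. real (a i) * (x i)\<^sup>2) + (\<Sum>(i, j)\<in>set E. ((x i)\<^sup>2 + (x j)\<^sup>2) + 2 * (x i * x j))"
  proof -
    have "(\<Sum>u\<in>{us ! i, us ! j}. h u)\<^sup>2 = ((x i)\<^sup>2 + (x j)\<^sup>2) + 2 * (x i * x j)" if "(i, j) \<in> set E" for i j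
      using edge_bounds[OF that] by (simp add: h power2_sum)
    then have "(\<Sum>(i, j)\<in>set E. (\<Sum>u\<in>{us ! i, us ! j}. h u)\<^sup>2)
        = (\<Sum>(i, j)\<in>set E. ((x i)\<^sup>2 + (x j)\<^sup>2) + 2 * (x i * x j))"
      by (intro sum.cong refl) auto
    then show ?thesis
      unfolding sum_outside[of "\<lambda>Y. (\<Sum>u\<in>Y. h u)\<^sup>2"] by (simp add: h)
  qed
  moreover have "(\<Sum>(i, j)\<in>set E. ((x i)\<^sup>2 + (x j)\<^sup>2) + 2 * (x i * x j))
      = (\<Sum>i<5. real (edge_degree E i) * (x i)\<^sup>2) + 2 * (\<Sum>(i, j)\<in>set E. x i * x j)"
    unfolding sum_edges_endpoints[OF tree, symmetric]
    by (simp add: case_prod_unfold sum.distrib sum_distrib_left)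
  ultimately have "(\<Sum>i<5. real (a i) * (x i)\<^sup>2) + ((\<Sum>i<5. real (edge_degree E i) * (x i)\<^sup>2)
      + 2 * (\<Sum>(i, j)\<in>set E. x i * x j)) \<le> \<sigma>\<^sup>2 * (\<Sum>i<5. (x i)\<^sup>2)" by simp
  moreover have "(\<Sum>i<5. real_of_int (int (a i) + int (edge_degree E i) - K) * (x i)\<^sup>2)
      = (\<Sum>i<5. real (a i) * (x i)\<^sup>2) + (\<Sum>i<5. real (edge_degree E i) * (x i)\<^sup>2) - K * (\<Sum>i<5. (x i)\<^sup>2)"
    by (simp add: algebra_simps sum.distrib sum_subtractf sum_distrib_left)
  ultimately show "(\<Sum>i<5. real_of_int (int (a i) + int (edge_degree E i) - K) * (x i)\<^sup>2)
      + 2 * (\<Sum>(i, j)\<in>set E. x i * x j) \<le> (\<sigma>\<^sup>2 - K) * (\<Sum>i<5. (x i)\<^sup>2)"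
    by (simp add: algebra_simps)
qed

section \<open>The trees of the theorem\<close>

text \<open>\<open>m\<close> names the vertex subdividing an edge of \<open>E\<close>. The given
  edge set \<open>B\<close> follows the path orientation while \<open>R\<close> points away from the
  subdividing vertices, so only the symmetric closures are required to agree.\<close>

lemma tree_model_attach_pendants:
  fixes m :: "nat \<times> nat \<Rightarrow> tree_vertex"
  assumes E: "index_tree E" and us: "length us = 5" "distinct us"
    and m: "inj_on m (set E)" "m ` set E \<inter> set us = {}"
    and pend: "\<And>u k. Pendant u k \<notin> m ` set E \<union> set us"
    and F: "Field B = set us \<union> m ` set E"
    and B: "B \<union> B\<inverse> = R \<union> R\<inverse>" "R = (\<Union>(i, j)\<in>set E. {(m (i, j), us ! i), (m (i, j), us ! j)})"
  shows "tree_model (attach_pendants (graph_of_edges B, us) as) us E ((!) as)" (is "tree_model ?G us E _")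
proof -
  define N where "N = pendant_edges us as"
  have N: "N = {(us ! i, Pendant (us ! i) k) | i k. i < 5 \<and> k < as ! i}"
    by (simp add: N_def pendant_edges_def us)
  have V: "pverts ?G = set us \<union> m ` set E \<union> Range N"
    and A: "parcs ?G = R \<union> R\<inverse> \<union> N \<union> N\<inverse>"
    using F B(1) by (simp_all add: attach_pendants_def graph_of_edges_def N_def Let_def)
  have bounds: "i < j \<and> j < 5 \<and> i < 5" if "(i, j) \<in> set E" for i j
    using E that by (auto simp: index_tree_def)
  have useq: "us ! i = us ! j \<longleftrightarrow> i = j" if "i < 5" "j < 5" for i j
    using us that by (simp add: nth_eq_iff_index_eq)
  have mem: "us ! i \<in> set us" if "i < 5" for i using us that by simp
  have RnN: "Range N = (\<Union>i<5. Pendant (us ! i) ` {..<as ! i})"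
    by (force simp: N)
  have finN: "finite N"
  proof -
    have "N \<subseteq> set us \<times> (\<Union>i<5. Pendant (us ! i) ` {..<as ! i})" using mem by (auto simp: N)
    then show ?thesis by (rule finite_subset) simp
  qed
  have Rsub: "R \<subseteq> m ` set E \<times> set us" using bounds mem by (auto simp: B(2))
  have Nsub: "N \<subseteq> set us \<times> Range N" using mem by (auto simp: N)
  have RnNp: "\<exists>u k. p = Pendant u k" if "p \<in> Range N" for p using that by (auto simp: N)
  have disj: "m ` set E \<inter> set us = {}" "Range N \<inter> set us = {}" "Range N \<inter> m ` set E = {}"
  proof -
    have "p \<notin> m ` set E \<union> set us" if "p \<in> Range N" for p using RnNp[OF that] pend by auto
    then show "m ` set E \<inter> set us = {}" "Range N \<inter> set us = {}" "Range N \<inter> m ` set E = {}"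
      using m(2) by blast+
  qed
  have pg: "pair_graph ?G"
  proof
    fix e assume e: "e \<in> parcs ?G"
    obtain u v where uv: "e = (u, v)" by (cases e)
    have "u \<in> pverts ?G \<and> v \<in> pverts ?G" using e Rsub Nsub unfolding V A uv by blast
    then show "fst e \<in> pverts ?G" "snd e \<in> pverts ?G" using uv by simp_all
    show "fst e \<noteq> snd e" using e Rsub Nsub disj unfolding A uv by auto
  next
    have "finite (Range N)" using finN by (rule finite_Range)
    then show "finite (pverts ?G)" unfolding V by simp
    have "finite R" using Rsub by (rule finite_subset) simp
    then show "finite (parcs ?G)" unfolding A using finN by simp
    show "symmetric (with_proj ?G)" by (auto simp: symmetric_def A intro!: symI)
  qed
  then interpret pair_graph ?G .
  have nb: "nbrs ?G v = {u. (v, u) \<in> R \<or> (u, v) \<in> R \<or> (v, u) \<in> N \<or> (u, v) \<in> N}" for v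
    by (auto simp: nbrs_def A)
  have nm: "nbrs ?G (m (i, j)) = {us ! i, us ! j}" if ij: "(i, j) \<in> set E" for i j
  proof -
    have mm: "m (i, j) \<in> m ` set E" using ij by blast
    then have "m (i, j) \<notin> set us" "m (i, j) \<notin> Range N" using disj by blast+
    then have "nbrs ?G (m (i, j)) = {u. (m (i, j), u) \<in> R}"
      unfolding nb using Rsub Nsub by blast
    also have "\<dots> = {us ! i, us ! j}"
      using ij inj_onD[OF m(1)] by (auto simp: B(2))
    finally show ?thesis .
  qed
  have np: "nbrs ?G (Pendant (us ! i) k) = {us ! i}" if "i < 5" "k < as ! i" for i k
  proof -
    have "Pendant (us ! i) k \<notin> set us" "Pendant (us ! i) k \<notin> m ` set E" using pend by blast+
    then have "nbrs ?G (Pendant (us ! i) k) = {u. (u, Pendant (us ! i) k) \<in> N}"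
      unfolding nb using Rsub Nsub by blast
    also have "\<dots> = {us ! i}" using that useq by (auto simp: N)
    finally show ?thesis .
  qed
  have out: "pverts ?G - set us = m ` set E \<union> Range N" unfolding V using disj by blast
  have "card {w \<in> pverts ?G - set us. nbrs ?G w = (!) us ` S} = multiplicity_of E ((!) as) S"
    if S: "S \<subseteq> {..<5}" for S
  proof -
    have inj: "inj_on ((!) us) {..<5}" using us by (auto simp: inj_on_nth)
    have im: "{us ! i, us ! j} = (!) us ` S \<longleftrightarrow> S = {i, j}" if "i < 5" "j < 5" for i j
      using inj_on_image_eq_iff[OF inj _ S, of "{i, j}"] that by auto
    have im1: "{us ! i} = (!) us ` S \<longleftrightarrow> S = {i}" if "i < 5" for i
      using im[of i i] that by simp
    let ?M = "{w \<in> m ` set E. nbrs ?G w = (!) us ` S}"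
    let ?P = "{w \<in> Range N. nbrs ?G w = (!) us ` S}"
    have fin: "finite ?M" "finite ?P" using finite_Range[OF finN] by auto
    have M: "?M = m ` {(i, j) \<in> set E. S = {i, j}}" using nm im bounds by auto
    have P: "?P = (\<Union>i\<in>{i. i < 5 \<and> S = {i}}. Pendant (us ! i) ` {..<as ! i})"
      unfolding RnN using np im1 by auto
    have "{w \<in> pverts ?G - set us. nbrs ?G w = (!) us ` S} = ?M \<union> ?P" unfolding out by blast
    moreover have "?M \<inter> ?P = {}" using disj(3) by blast
    ultimately have "card {w \<in> pverts ?G - set us. nbrs ?G w = (!) us ` S} = card ?M + card ?P"
      using card_Un_disjoint[OF fin] by simp
    also have "\<dots> = multiplicity_of E ((!) as) S"
    proof -
      consider i where "i < 5" "S = {i}" | i j where "(i, j) \<in> set E" "S = {i, j}"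
        | "\<And>i. i < 5 \<Longrightarrow> S \<noteq> {i}" "\<And>i j. (i, j) \<in> set E \<Longrightarrow> S \<noteq> {i, j}" by blast
      then show ?thesis
      proof cases
        case 1
        have "?M = {}" unfolding M using 1 bounds by fastforce
        then have cM: "card ?M = 0" by (simp only: card.empty)
        have "?P = Pendant (us ! i) ` {..<as ! i}" unfolding P using 1 by auto
        moreover have "card (Pendant (us ! i) ` {..<as ! i}) = as ! i" by (simp add: card_image inj_on_def)
        ultimately have cP: "card ?P = as ! i" by (simp only:)
        show ?thesis unfolding cM cP using 1 multiplicity_of_singleton[OF E] by simp
      next
        case 2
        have "{(i, j) \<in> set E. S = {i, j}} = {(i, j)}"
          using 2 bounds by (auto simp: doubleton_eq_iff) (meson less_asym)+
        then have cM: "card ?M = 1" unfolding M by simp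
        have "?P = {}" unfolding P using 2 bounds[OF 2(1)] by auto
        then have cP: "card ?P = 0" by (simp only: card.empty)
        show ?thesis unfolding cM cP using 2 multiplicity_of_edge[OF E 2(1)] by simp
      next
        case 3
        have "?M = {}" "?P = {}" unfolding M P using 3 by auto
        then have cMP: "card ?M = 0" "card ?P = 0" by (simp_all only: card.empty)
        show ?thesis unfolding cMP using multiplicity_of_eq_0[OF 3] by simp
      qed
    qed
    finally show ?thesis .
  qed
  moreover have "nbrs ?G u \<inter> set us = {}" if "u \<in> set us" for u
    unfolding nb using that Rsub Nsub disj by blast
  moreover have "nbrs ?G w \<subseteq> set us" if "w \<in> pverts ?G - set us" for w
    using that Rsub Nsub unfolding nb by blast
  ultimately show ?thesis using pg us V unfolding tree_model_def by blast
qed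

lemma path_edges_Suc: "path_edges (Suc k) = insert (PathV k, PathV (Suc k)) (path_edges k)"
  by (auto simp: path_edges_def less_Suc_eq)

lemma path_edges_0: "path_edges 0 = {}"
  by (simp add: path_edges_def)

lemmas path_edges_numeral = path_edges_Suc path_edges_0

lemma tree_model_F5_1: "tree_model (attach_pendants F5_1 as) (snd F5_1) star_tree ((!) as)"
proof -
  have *: "path_edges 4 = {(PathV 0, PathV 1), (PathV 1, PathV 2), (PathV 2, PathV 3), (PathV 3, PathV 4)}"
    by (auto simp: eval_nat_numeral path_edges_numeral)
  \<comment> \<open>In each of the three index trees the larger endpoint \<open>j\<close> determines
    the edge, so the subdividing vertex is a function of \<open>j\<close> alone.\<close>
  define m where "m = (\<lambda>(i :: nat, j). if j = 1 then PathV 1 else if j = 2 then PathV 3 else MidV 1 (j - 2))"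
  show ?thesis
    unfolding F5_1_def snd_conv
    by (rule tree_model_attach_pendants[where m = m, OF index_tree_star _ _ _ _ _ _ _ refl])
      (auto simp: * m_def star_tree_def inj_on_def Field_def)
qed

lemma tree_model_F5_2: "tree_model (attach_pendants F5_2 as) (snd F5_2) fork_tree ((!) as)"
proof -
  have *: "path_edges 6 = {(PathV 0, PathV 1), (PathV 1, PathV 2), (PathV 2, PathV 3), (PathV 3, PathV 4),
      (PathV 4, PathV 5), (PathV 5, PathV 6)}"
    by (auto simp: eval_nat_numeral path_edges_numeral)
  define m where "m = (\<lambda>(i :: nat, j). if j = 4 then MidV 1 1 else PathV (2 * j - 1))"
  show ?thesis
    unfolding F5_2_def snd_conv
    by (rule tree_model_attach_pendants[where m = m, OF index_tree_fork _ _ _ _ _ _ _ refl])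
      (auto simp: * m_def fork_tree_def inj_on_def Field_def)
qed

lemma tree_model_F5_3: "tree_model (attach_pendants F5_3 as) (snd F5_3) path_tree ((!) as)"
proof -
  have *: "path_edges 8 = {(PathV 0, PathV 1), (PathV 1, PathV 2), (PathV 2, PathV 3), (PathV 3, PathV 4),
      (PathV 4, PathV 5), (PathV 5, PathV 6), (PathV 6, PathV 7), (PathV 7, PathV 8)}"
    by (auto simp: eval_nat_numeral path_edges_numeral)
  define m where "m = (\<lambda>(i :: nat, j). PathV (2 * j - 1))"
  show ?thesis
    unfolding F5_3_def snd_conv
    by (rule tree_model_attach_pendants[where m = m, OF index_tree_path _ _ _ _ _ _ _ refl])
      (auto simp: * m_def path_tree_def inj_on_def Field_def)
qed

section \<open>Integer potentials\<close>

lemma sum_lessThan_5: "(\<Sum>i<5. f i) = f 0 + f 1 + f 2 + f 3 + f (4 :: nat)" for f :: "nat \<Rightarrow> 'b :: comm_monoid_add"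
  by (simp add: eval_nat_numeral add.assoc)

lemma nth_list_of_5 [simp]:
  "[x0, x1, x2, x3, x4] ! 2 = x2" "[x0, x1, x2, x3, x4] ! 3 = x3" "[x0, x1, x2, x3, x4] ! 4 = x4"
  by (simp_all add: eval_nat_numeral)

lemma potential_bound_star:
  assumes "potential_bound star_tree d l"
  shows "d 0 * x0\<^sup>2 + d 1 * x1\<^sup>2 + d 2 * x2\<^sup>2 + d 3 * x3\<^sup>2 + d 4 * x4\<^sup>2
    + 2 * (x0 * x1 + x1 * x2 + x1 * x3 + x1 * x4) \<le> l * (x0\<^sup>2 + x1\<^sup>2 + x2\<^sup>2 + x3\<^sup>2 + x4\<^sup>2)"
  using assms[unfolded potential_bound_def, rule_format, of "(!) [x0, x1, x2, x3, x4]"]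
  by (simp add: sum_lessThan_5 star_tree_def)

lemma potential_bound_fork:
  assumes "potential_bound fork_tree d l"
  shows "d 0 * x0\<^sup>2 + d 1 * x1\<^sup>2 + d 2 * x2\<^sup>2 + d 3 * x3\<^sup>2 + d 4 * x4\<^sup>2
    + 2 * (x0 * x1 + x1 * x2 + x2 * x3 + x1 * x4) \<le> l * (x0\<^sup>2 + x1\<^sup>2 + x2\<^sup>2 + x3\<^sup>2 + x4\<^sup>2)"
  using assms[unfolded potential_bound_def, rule_format, of "(!) [x0, x1, x2, x3, x4]"]
  by (simp add: sum_lessThan_5 fork_tree_def)

lemma potential_bound_path:
  assumes "potential_bound path_tree d l"
  shows "d 0 * x0\<^sup>2 + d 1 * x1\<^sup>2 + d 2 * x2\<^sup>2 + d 3 * x3\<^sup>2 + d 4 * x4\<^sup>2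
    + 2 * (x0 * x1 + x1 * x2 + x2 * x3 + x3 * x4) \<le> l * (x0\<^sup>2 + x1\<^sup>2 + x2\<^sup>2 + x3\<^sup>2 + x4\<^sup>2)"
  using assms[unfolded potential_bound_def, rule_format, of "(!) [x0, x1, x2, x3, x4]"]
  by (simp add: sum_lessThan_5 path_tree_def)

text \<open>The bound is tested on integer vectors. The constant vectors \<open>q\<close> raised or lowered by 1 at a
  single index already pin every \<open>d i\<close> down to at most two values; the other test vectors, found by
  computer search, exclude the remaining configurations.\<close>

lemma star_potential_3:
  fixes d :: "nat \<Rightarrow> int"
  assumes b: "potential_bound star_tree d l" and l: "l \<le> 2237 / 1000" and s: "(\<Sum>i<5. d i) = 3"
  shows "d 0 = 1 \<and> d 1 = -1 \<and> d 2 = 1 \<and> d 3 = 1 \<and> d 4 = 1"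
proof -
  note H = potential_bound_star[OF b]
  note sum = s[unfolded sum_lessThan_5]
  \<comment> \<open>The mixed terms are moved to the right and the bound is rounded down, the left
    side being an integer: \<open>[2, 1, 1, 1, 1]\<close> gives
    \<open>8 * l - 10 \<le> 7.896\<close>, hence 7.\<close>
  have c:
    "4 * d 0 + d 1 + d 2 + d 3 + d 4 \<le> 7"
    "d 0 + 4 * d 1 + d 2 + d 3 + d 4 \<le> 1"
    "d 0 + d 1 + 4 * d 2 + d 3 + d 4 \<le> 7"
    "d 0 + d 1 + d 2 + 4 * d 3 + d 4 \<le> 7"
    "d 0 + d 1 + d 2 + d 3 + 4 * d 4 \<le> 7"
    using l H[of 2 1 1 1 1] H[of 1 2 1 1 1] H[of 1 1 2 1 1] H[of 1 1 1 2 1] H[of 1 1 1 1 2] by simp_all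
  have u: "d 0 \<le> 1" "d 1 \<le> -1" "d 2 \<le> 1" "d 3 \<le> 1" "d 4 \<le> 1"
    using c(1-5) sum by linarith+
  \<comment> \<open>The five upper bounds add up to exactly the prescribed trace 3, so all are
    equalities.\<close>
  then show ?thesis using sum by linarith
qed

lemma fork_potential_3:
  fixes d :: "nat \<Rightarrow> int"
  assumes b: "potential_bound fork_tree d l" and l: "l \<le> 2237 / 1000" and s: "(\<Sum>i<5. d i) = 3"
  shows False
proof -
  note H = potential_bound_fork[OF b]
  note sum = s[unfolded sum_lessThan_5]
  \<comment> \<open>At the branching index \<open>[1, 2, 1, 1, 1]\<close> would only give
    \<open>d 1 \<le> 0\<close>, leaving upper bounds with sum 3; the finer vector
    \<open>[2, 3, 2, 2, 2]\<close> gains the missing unit.\<close>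
  have c:
    "4 * d 0 + d 1 + d 2 + d 3 + d 4 \<le> 7"
    "4 * d 0 + 9 * d 1 + 4 * d 2 + 4 * d 3 + 4 * d 4 \<le> 11"
    "d 0 + d 1 + 4 * d 2 + d 3 + d 4 \<le> 5"
    "d 0 + d 1 + d 2 + 4 * d 3 + d 4 \<le> 7"
    "d 0 + d 1 + d 2 + d 3 + 4 * d 4 \<le> 7"
    using l H[of 2 1 1 1 1] H[of 2 3 2 2 2] H[of 1 1 2 1 1] H[of 1 1 1 2 1] H[of 1 1 1 1 2] by simp_all
  have u: "d 0 \<le> 1" "d 1 \<le> -1" "d 2 \<le> 0" "d 3 \<le> 1" "d 4 \<le> 1"
    using c(1-5) sum by linarith+
  then show ?thesis using sum by linarith
qed

lemma path_potential_3:
  fixes d :: "nat \<Rightarrow> int"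
  assumes b: "potential_bound path_tree d l" and l: "l \<le> 2237 / 1000" and s: "(\<Sum>i<5. d i) = 3"
  shows False
proof -
  note H = potential_bound_path[OF b]
  note sum = s[unfolded sum_lessThan_5]
  have c:
    "4 * d 0 + d 1 + d 2 + d 3 + d 4 \<le> 7"
    "d 0 + 4 * d 1 + d 2 + d 3 + d 4 \<le> 5"
    "d 0 + d 1 + 4 * d 2 + d 3 + d 4 \<le> 5"
    "d 0 + d 1 + d 2 + 4 * d 3 + d 4 \<le> 5"
    "d 0 + d 1 + d 2 + d 3 + 4 * d 4 \<le> 7"
    using l H[of 2 1 1 1 1] H[of 1 2 1 1 1] H[of 1 1 2 1 1] H[of 1 1 1 2 1] H[of 1 1 1 1 2] by simp_all
  have u: "d 0 \<le> 1" "d 1 \<le> 0" "d 2 \<le> 0" "d 3 \<le> 0" "d 4 \<le> 1"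
    using c(1-5) sum by linarith+
  then show ?thesis using sum by linarith
qed

lemma star_potential_4:
  fixes d :: "nat \<Rightarrow> int"
  assumes b: "potential_bound star_tree d l" and l: "l \<le> 1241 / 500" and s: "(\<Sum>i<5. d i) = 4"
  shows False
proof -
  note H = potential_bound_star[OF b]
  note sum = s[unfolded sum_lessThan_5]
  have c:
    "4 * d 0 + d 1 + d 2 + d 3 + d 4 \<le> 9"
    "d 0 + 4 * d 1 + d 2 + d 3 + d 4 \<le> 3"
    "d 0 + d 1 + 4 * d 2 + d 3 + d 4 \<le> 9"
    "d 0 + d 1 + d 2 + 4 * d 3 + d 4 \<le> 9"
    "d 0 + d 1 + d 2 + d 3 + 4 * d 4 \<le> 9"
    using l H[of 2 1 1 1 1] H[of 1 2 1 1 1] H[of 1 1 2 1 1] H[of 1 1 1 2 1] H[of 1 1 1 1 2] by simp_all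
  have u: "d 0 \<le> 1" "d 1 \<le> -1" "d 2 \<le> 1" "d 3 \<le> 1" "d 4 \<le> 1"
    using c(1-5) sum by linarith+
  then show ?thesis using sum by linarith
qed

lemma fork_potential_4:
  fixes d :: "nat \<Rightarrow> int"
  assumes b: "potential_bound fork_tree d l" and l: "l \<le> 1241 / 500" and s: "(\<Sum>i<5. d i) = 4"
  shows False
proof -
  note H = potential_bound_fork[OF b]
  note sum = s[unfolded sum_lessThan_5]
  have c:
    "4 * d 0 + d 1 + d 2 + d 3 + d 4 \<le> 9"
    "d 0 + 4 * d 1 + d 2 + d 3 + d 4 \<le> 5"
    "d 0 + d 1 + 4 * d 2 + d 3 + d 4 \<le> 7"
    "d 0 + d 1 + d 2 + 4 * d 3 + d 4 \<le> 9"
    "d 0 + d 1 + d 2 + d 3 + 4 * d 4 \<le> 9"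
    "4 * d 0 + 9 * d 1 + 9 * d 2 + 4 * d 3 + 4 * d 4 \<le> 20"
    using l H[of 2 1 1 1 1] H[of 1 2 1 1 1] H[of 1 1 2 1 1] H[of 1 1 1 2 1] H[of 1 1 1 1 2] H[of 2 3 3 2 2] by simp_all
  have u: "d 0 \<le> 1" "d 1 \<le> 0" "d 2 \<le> 1" "d 3 \<le> 1" "d 4 \<le> 1"
    using c(1-5) sum by linarith+
  \<comment> \<open>The upper bounds add up to 4, leaving the single candidate
    \<open>(1, 0, 1, 1, 1)\<close>, for which the last inequality would read
    \<open>21 \<le> 20\<close>.\<close>
  then show ?thesis using c sum by linarith
qed

lemma path_potential_4:
  fixes d :: "nat \<Rightarrow> int"
  assumes b: "potential_bound path_tree d l" and l: "l \<le> 1241 / 500" and s: "(\<Sum>i<5. d i) = 4"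
  shows "d 0 = 1 \<and> d 1 = 1 \<and> d 2 = 0 \<and> d 3 = 1 \<and> d 4 = 1"
proof -
  note H = potential_bound_path[OF b]
  note sum = s[unfolded sum_lessThan_5]
  have c:
    "4 * d 0 + d 1 + d 2 + d 3 + d 4 \<le> 9"
    "d 0 + 4 * d 1 + d 2 + d 3 + d 4 \<le> 7"
    "d 0 + d 1 + 4 * d 2 + d 3 + d 4 \<le> 7"
    "d 0 + d 1 + d 2 + 4 * d 3 + d 4 \<le> 7"
    "d 0 + d 1 + d 2 + d 3 + 4 * d 4 \<le> 9"
    "d 1 + d 2 + d 3 + d 4 \<le> 3"
    "d 0 + d 1 + d 2 + d 3 \<le> 3"
    "4 * d 0 + 9 * d 1 + 16 * d 2 + 9 * d 3 + 4 * d 4 \<le> 32"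
    using l H[of 2 1 1 1 1] H[of 1 2 1 1 1] H[of 1 1 2 1 1] H[of 1 1 1 2 1] H[of 1 1 1 1 2] H[of 0 1 1 1 1] H[of 1 1 1 1 0] H[of 2 3 4 3 2] by simp_all
  have u: "d 0 \<le> 1" "d 1 \<le> 1" "d 2 \<le> 1" "d 3 \<le> 1" "d 4 \<le> 1"
    using c(1-5) sum by linarith+
  have v: "1 \<le> d 0" "0 \<le> d 1" "0 \<le> d 2" "0 \<le> d 3" "1 \<le> d 4"
    using u c sum by linarith+
  have "d 1 = 0 \<or> d 1 = 1" "d 2 = 0 \<or> d 2 = 1" "d 3 = 0 \<or> d 3 = 1"
    using u v by linarith+
  \<comment> \<open>Exactly one entry is 0. The vectors vanishing at an end exclude the ends, and
    \<open>[2, 3, 4, 3, 2]\<close> excludes the neighbours of the middle, where it would give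
    \<open>33 \<le> 32\<close>.\<close>
  then show ?thesis using c(6-) u v sum by (elim disjE; simp)
qed

lemma star_potential_5:
  fixes d :: "nat \<Rightarrow> int"
  assumes b: "potential_bound star_tree d l" and l: "l \<le> 669 / 250" and s: "(\<Sum>i<5. d i) = 5"
  shows False
proof -
  note H = potential_bound_star[OF b]
  note sum = s[unfolded sum_lessThan_5]
  have c:
    "4 * d 0 + d 1 + d 2 + d 3 + d 4 \<le> 11"
    "4 * d 0 + 9 * d 1 + 4 * d 2 + 4 * d 3 + 4 * d 4 \<le> 18"
    "d 0 + d 1 + 4 * d 2 + d 3 + d 4 \<le> 11"
    "d 0 + d 1 + d 2 + 4 * d 3 + d 4 \<le> 11"
    "d 0 + d 1 + d 2 + d 3 + 4 * d 4 \<le> 11"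
    "d 1 + d 2 + d 3 + d 4 \<le> 4"
    "9 * d 0 + 4 * d 1 + 9 * d 2 + 9 * d 3 + 9 * d 4 \<le> 59"
    "d 0 + d 1 + d 3 + d 4 \<le> 4"
    "d 0 + d 1 + d 2 + d 4 \<le> 4"
    "d 0 + d 1 + d 2 + d 3 \<le> 4"
    "d 0 + 4 * d 1 + 4 * d 2 + 4 * d 3 + 9 * d 4 \<le> 26"
    "4 * d 0 + 4 * d 1 + 4 * d 2 + 9 * d 3 + d 4 \<le> 26"
    "9 * d 0 + 4 * d 1 + 4 * d 2 + d 3 + 4 * d 4 \<le> 26"
    "4 * d 0 + 4 * d 1 + d 2 + 4 * d 3 + 9 * d 4 \<le> 26"
    using l H[of 2 1 1 1 1] H[of 2 3 2 2 2] H[of 1 1 2 1 1] H[of 1 1 1 2 1] H[of 1 1 1 1 2] H[of 0 1 1 1 1] H[of 3 2 3 3 3] H[of 1 1 0 1 1] H[of 1 1 1 0 1] H[of 1 1 1 1 0] H[of 1 2 2 2 3] H[of 2 2 2 3 1] H[of 3 2 2 1 2] H[of 2 2 1 2 3] by simp_all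
  have u: "d 0 \<le> 2" "d 1 \<le> -1" "d 2 \<le> 2" "d 3 \<le> 2" "d 4 \<le> 2"
    using c(1-5) sum by linarith+
  have v: "1 \<le> d 0" "-2 \<le> d 1" "1 \<le> d 2" "1 \<le> d 3" "1 \<le> d 4"
    using u c sum by linarith+
  have "d 0 = 1 \<or> d 0 = 2" "d 1 = -2 \<or> d 1 = -1" "d 2 = 1 \<or> d 2 = 2" "d 3 = 1 \<or> d 3 = 2" "d 4 = 1 \<or> d 4 = 2"
    using u v by linarith+
  then show ?thesis using c(6-) sum by (elim disjE; simp)
qed

lemma fork_potential_5:
  fixes d :: "nat \<Rightarrow> int"
  assumes b: "potential_bound fork_tree d l" and l: "l \<le> 669 / 250" and s: "(\<Sum>i<5. d i) = 5"
  shows False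
proof -
  note H = potential_bound_fork[OF b]
  note sum = s[unfolded sum_lessThan_5]
  have c:
    "4 * d 0 + d 1 + d 2 + d 3 + d 4 \<le> 11"
    "d 0 + 4 * d 1 + d 2 + d 3 + d 4 \<le> 7"
    "d 0 + d 1 + 4 * d 2 + d 3 + d 4 \<le> 9"
    "d 0 + d 1 + d 2 + 4 * d 3 + d 4 \<le> 11"
    "d 0 + d 1 + d 2 + d 3 + 4 * d 4 \<le> 11"
    "d 1 + d 2 + d 3 + d 4 \<le> 4"
    "4 * d 0 + d 1 + 4 * d 2 + 4 * d 3 + 4 * d 4 \<le> 25"
    "4 * d 0 + 4 * d 1 + d 2 + 4 * d 3 + 4 * d 4 \<le> 21"
    "d 0 + d 1 + d 2 + d 4 \<le> 4"
    "d 0 + d 1 + d 2 + d 3 \<le> 4"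
    "d 0 + d 1 + 4 * d 2 + 4 * d 3 + d 4 \<le> 13"
    "d 0 + 4 * d 1 + d 2 + d 3 + 9 * d 4 \<le> 20"
    "9 * d 0 + 4 * d 1 + d 2 + d 3 + d 4 \<le> 20"
    "4 * d 0 + 4 * d 1 + 4 * d 2 + d 3 + 9 * d 4 \<le> 26"
    "9 * d 0 + 4 * d 1 + 4 * d 2 + 9 * d 3 + 9 * d 4 \<le> 49"
    using l H[of 2 1 1 1 1] H[of 1 2 1 1 1] H[of 1 1 2 1 1] H[of 1 1 1 2 1] H[of 1 1 1 1 2] H[of 0 1 1 1 1] H[of 2 1 2 2 2] H[of 2 2 1 2 2] H[of 1 1 1 0 1] H[of 1 1 1 1 0] H[of 1 1 2 2 1] H[of 1 2 1 1 3] H[of 3 2 1 1 1] H[of 2 2 2 1 3] H[of 3 2 2 3 3] by simp_all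
  have u: "d 0 \<le> 2" "d 1 \<le> 0" "d 2 \<le> 1" "d 3 \<le> 2" "d 4 \<le> 2"
    using c(1-5) sum by linarith+
  have v: "1 \<le> d 0" "-1 \<le> d 1" "0 \<le> d 2" "1 \<le> d 3" "1 \<le> d 4"
    using u c sum by linarith+
  have "d 0 = 1 \<or> d 0 = 2" "d 1 = -1 \<or> d 1 = 0" "d 2 = 0 \<or> d 2 = 1" "d 3 = 1 \<or> d 3 = 2" "d 4 = 1 \<or> d 4 = 2"
    using u v by linarith+
  then show ?thesis using c(6-) sum by (elim disjE; simp)
qed

lemma path_potential_5:
  fixes d :: "nat \<Rightarrow> int"
  assumes b: "potential_bound path_tree d l" and l: "l \<le> 669 / 250" and s: "(\<Sum>i<5. d i) = 5"
  shows "d 0 = 2 \<and> d 1 = 0 \<and> d 2 = 1 \<and> d 3 = 0 \<and> d 4 = 2"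
proof -
  note H = potential_bound_path[OF b]
  note sum = s[unfolded sum_lessThan_5]
  have c:
    "4 * d 0 + d 1 + d 2 + d 3 + d 4 \<le> 11"
    "d 0 + 4 * d 1 + d 2 + d 3 + d 4 \<le> 9"
    "d 0 + d 1 + 4 * d 2 + d 3 + d 4 \<le> 9"
    "d 0 + d 1 + d 2 + 4 * d 3 + d 4 \<le> 9"
    "d 0 + d 1 + d 2 + d 3 + 4 * d 4 \<le> 11"
    "d 1 + d 2 + d 3 + d 4 \<le> 4"
    "4 * d 0 + d 1 + 4 * d 2 + 4 * d 3 + 4 * d 4 \<le> 21"
    "4 * d 0 + 4 * d 1 + d 2 + 4 * d 3 + 4 * d 4 \<le> 21"
    "4 * d 0 + 4 * d 1 + 4 * d 2 + d 3 + 4 * d 4 \<le> 21"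
    "d 0 + d 1 + d 2 + d 3 \<le> 4"
    "d 2 + 4 * d 3 + 9 * d 4 \<le> 21"
    "9 * d 0 + 4 * d 1 + d 2 \<le> 21"
    "d 0 + 4 * d 1 + 4 * d 2 + 4 * d 3 + d 4 \<le> 13"
    "d 0 + 4 * d 1 + 4 * d 2 + 4 * d 3 + 9 * d 4 \<le> 26"
    "9 * d 0 + 4 * d 1 + 4 * d 2 + 4 * d 3 + d 4 \<le> 26"
    using l H[of 2 1 1 1 1] H[of 1 2 1 1 1] H[of 1 1 2 1 1] H[of 1 1 1 2 1] H[of 1 1 1 1 2] H[of 0 1 1 1 1] H[of 2 1 2 2 2] H[of 2 2 1 2 2] H[of 2 2 2 1 2] H[of 1 1 1 1 0] H[of 0 0 1 2 3] H[of 3 2 1 0 0] H[of 1 2 2 2 1] H[of 1 2 2 2 3] H[of 3 2 2 2 1] by simp_all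
  have u: "d 0 \<le> 2" "d 1 \<le> 1" "d 2 \<le> 1" "d 3 \<le> 1" "d 4 \<le> 2"
    using c(1-5) sum by linarith+
  have v: "1 \<le> d 0" "0 \<le> d 1" "0 \<le> d 2" "0 \<le> d 3" "1 \<le> d 4"
    using u c sum by linarith+
  have "d 0 = 1 \<or> d 0 = 2" "d 1 = 0 \<or> d 1 = 1" "d 2 = 0 \<or> d 2 = 1" "d 3 = 0 \<or> d 3 = 1" "d 4 = 1 \<or> d 4 = 2"
    using u v by linarith+
  then show ?thesis using c(6-) sum by (elim disjE; simp)
qed

lemma star_potential_6:
  fixes d :: "nat \<Rightarrow> int"
  assumes b: "potential_bound star_tree d l" and l: "l \<le> 2829 / 1000" and s: "(\<Sum>i<5. d i) = 6"
  shows "d 0 = 2 \<and> d 1 = -2 \<and> d 2 = 2 \<and> d 3 = 2 \<and> d 4 = 2"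
proof -
  note H = potential_bound_star[OF b]
  note sum = s[unfolded sum_lessThan_5]
  have c:
    "4 * d 0 + d 1 + d 2 + d 3 + d 4 \<le> 12"
    "4 * d 0 + 9 * d 1 + 4 * d 2 + 4 * d 3 + 4 * d 4 \<le> 22"
    "d 0 + d 1 + 4 * d 2 + d 3 + d 4 \<le> 12"
    "d 0 + d 1 + d 2 + 4 * d 3 + d 4 \<le> 12"
    "d 0 + d 1 + d 2 + d 3 + 4 * d 4 \<le> 12"
    "d 0 + 4 * d 1 + 4 * d 2 + 4 * d 3 + 4 * d 4 \<le> 20"
    "4 * d 0 + 4 * d 1 + d 2 + 4 * d 3 + 4 * d 4 \<le> 20"
    "4 * d 0 + 4 * d 1 + 4 * d 2 + d 3 + 4 * d 4 \<le> 20"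
    "4 * d 0 + 4 * d 1 + 4 * d 2 + 4 * d 3 + d 4 \<le> 20"
    using l H[of 2 1 1 1 1] H[of 2 3 2 2 2] H[of 1 1 2 1 1] H[of 1 1 1 2 1] H[of 1 1 1 1 2] H[of 1 2 2 2 2] H[of 2 2 1 2 2] H[of 2 2 2 1 2] H[of 2 2 2 2 1] by simp_all
  have u: "d 0 \<le> 2" "d 1 \<le> -1" "d 2 \<le> 2" "d 3 \<le> 2" "d 4 \<le> 2"
    using c(1-5) sum by linarith+
  have v: "2 \<le> d 0" "-2 \<le> d 1" "2 \<le> d 2" "2 \<le> d 3" "2 \<le> d 4"
    using u c sum by linarith+
  \<comment> \<open>The upper bounds exceed the trace by one, and no leaf may be lowered, so the
    unit is lost at the centre.\<close>
  then show ?thesis using u sum by linarith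
qed

lemma fork_potential_6:
  fixes d :: "nat \<Rightarrow> int"
  assumes b: "potential_bound fork_tree d l" and l: "l \<le> 2829 / 1000" and s: "(\<Sum>i<5. d i) = 6"
  shows False
proof -
  note H = potential_bound_fork[OF b]
  note sum = s[unfolded sum_lessThan_5]
  have c:
    "4 * d 0 + d 1 + d 2 + d 3 + d 4 \<le> 12"
    "d 0 + 4 * d 1 + d 2 + d 3 + d 4 \<le> 8"
    "d 0 + d 1 + 4 * d 2 + d 3 + d 4 \<le> 10"
    "d 0 + d 1 + d 2 + 4 * d 3 + d 4 \<le> 12"
    "d 0 + d 1 + d 2 + d 3 + 4 * d 4 \<le> 12"
    "d 0 + 4 * d 1 + 4 * d 2 + 4 * d 3 + 4 * d 4 \<le> 20"
    "16 * d 0 + 9 * d 1 + 16 * d 2 + 16 * d 3 + 16 * d 4 \<le> 102"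
    "9 * d 0 + 9 * d 1 + 4 * d 2 + 9 * d 3 + 9 * d 4 \<le> 53"
    "4 * d 0 + 4 * d 1 + 4 * d 2 + d 3 + 4 * d 4 \<le> 20"
    "4 * d 0 + 4 * d 1 + 4 * d 2 + 4 * d 3 + d 4 \<le> 20"
    using l H[of 2 1 1 1 1] H[of 1 2 1 1 1] H[of 1 1 2 1 1] H[of 1 1 1 2 1] H[of 1 1 1 1 2] H[of 1 2 2 2 2] H[of 4 3 4 4 4] H[of 3 3 2 3 3] H[of 2 2 2 1 2] H[of 2 2 2 2 1] by simp_all
  have u: "d 0 \<le> 2" "d 1 \<le> 0" "d 2 \<le> 1" "d 3 \<le> 2" "d 4 \<le> 2"
    using c(1-5) sum by linarith+
  \<comment> \<open>Here the lower bounds decide: they add up to 7, more than the trace. At index 1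
    this takes \<open>[4, 3, 4, 4, 4]\<close>, since \<open>[3, 2, 3, 3, 3]\<close> gives only
    -1.\<close>
  have v: "2 \<le> d 0" "0 \<le> d 1" "1 \<le> d 2" "2 \<le> d 3" "2 \<le> d 4"
    using u c sum by linarith+
  then show ?thesis using sum by linarith
qed

lemma path_potential_6:
  fixes d :: "nat \<Rightarrow> int"
  assumes b: "potential_bound path_tree d l" and l: "l \<le> 2829 / 1000" and s: "(\<Sum>i<5. d i) = 6"
  shows False
proof -
  note H = potential_bound_path[OF b]
  note sum = s[unfolded sum_lessThan_5]
  have c:
    "4 * d 0 + d 1 + d 2 + d 3 + d 4 \<le> 12"
    "d 0 + 4 * d 1 + d 2 + d 3 + d 4 \<le> 10"
    "d 0 + d 1 + 4 * d 2 + d 3 + d 4 \<le> 10"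
    "d 0 + d 1 + d 2 + 4 * d 3 + d 4 \<le> 10"
    "d 0 + d 1 + d 2 + d 3 + 4 * d 4 \<le> 12"
    "d 0 + 4 * d 1 + 4 * d 2 + 4 * d 3 + 4 * d 4 \<le> 20"
    "9 * d 0 + 4 * d 1 + 9 * d 2 + 9 * d 3 + 9 * d 4 \<le> 53"
    "9 * d 0 + 9 * d 1 + 4 * d 2 + 9 * d 3 + 9 * d 4 \<le> 53"
    "9 * d 0 + 9 * d 1 + 9 * d 2 + 4 * d 3 + 9 * d 4 \<le> 53"
    "4 * d 0 + 4 * d 1 + 4 * d 2 + 4 * d 3 + d 4 \<le> 20"
    using l H[of 2 1 1 1 1] H[of 1 2 1 1 1] H[of 1 1 2 1 1] H[of 1 1 1 2 1] H[of 1 1 1 1 2] H[of 1 2 2 2 2] H[of 3 2 3 3 3] H[of 3 3 2 3 3] H[of 3 3 3 2 3] H[of 2 2 2 2 1] by simp_all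
  have u: "d 0 \<le> 2" "d 1 \<le> 1" "d 2 \<le> 1" "d 3 \<le> 1" "d 4 \<le> 2"
    using c(1-5) sum by linarith+
  have v: "2 \<le> d 0" "1 \<le> d 1" "1 \<le> d 2" "1 \<le> d 3" "2 \<le> d 4"
    using u c sum by linarith+
  then show ?thesis using sum by linarith
qed

text \<open>For bound 3 the solution is 3 minus the degree at each index, which makes the constant
  vector an eigenvector. The upper bounds add up to \<open>15 - 8 = 7\<close>, so it is the only
  one; fork and path behave alike.\<close>

lemma star_potential_7:
  fixes d :: "nat \<Rightarrow> int"
  assumes b: "potential_bound star_tree d l" and l: "l \<le> 3" and s: "(\<Sum>i<5. d i) = 7"
  shows "d 0 = 2 \<and> d 1 = -1 \<and> d 2 = 2 \<and> d 3 = 2 \<and> d 4 = 2"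
proof -
  note H = potential_bound_star[OF b]
  note sum = s[unfolded sum_lessThan_5]
  have c:
    "4 * d 0 + d 1 + d 2 + d 3 + d 4 \<le> 14"
    "4 * d 0 + 9 * d 1 + 4 * d 2 + 4 * d 3 + 4 * d 4 \<le> 27"
    "d 0 + d 1 + 4 * d 2 + d 3 + d 4 \<le> 14"
    "d 0 + d 1 + d 2 + 4 * d 3 + d 4 \<le> 14"
    "d 0 + d 1 + d 2 + d 3 + 4 * d 4 \<le> 14"
    using l H[of 2 1 1 1 1] H[of 2 3 2 2 2] H[of 1 1 2 1 1] H[of 1 1 1 2 1] H[of 1 1 1 1 2] by simp_all
  have u: "d 0 \<le> 2" "d 1 \<le> -1" "d 2 \<le> 2" "d 3 \<le> 2" "d 4 \<le> 2"
    using c(1-5) sum by linarith+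
  then show ?thesis using sum by linarith
qed

lemma fork_potential_7:
  fixes d :: "nat \<Rightarrow> int"
  assumes b: "potential_bound fork_tree d l" and l: "l \<le> 3" and s: "(\<Sum>i<5. d i) = 7"
  shows "d 0 = 2 \<and> d 1 = 0 \<and> d 2 = 1 \<and> d 3 = 2 \<and> d 4 = 2"
proof -
  note H = potential_bound_fork[OF b]
  note sum = s[unfolded sum_lessThan_5]
  have c:
    "4 * d 0 + d 1 + d 2 + d 3 + d 4 \<le> 14"
    "4 * d 0 + 9 * d 1 + 4 * d 2 + 4 * d 3 + 4 * d 4 \<le> 31"
    "d 0 + d 1 + 4 * d 2 + d 3 + d 4 \<le> 12"
    "d 0 + d 1 + d 2 + 4 * d 3 + d 4 \<le> 14"
    "d 0 + d 1 + d 2 + d 3 + 4 * d 4 \<le> 14"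
    using l H[of 2 1 1 1 1] H[of 2 3 2 2 2] H[of 1 1 2 1 1] H[of 1 1 1 2 1] H[of 1 1 1 1 2] by simp_all
  have u: "d 0 \<le> 2" "d 1 \<le> 0" "d 2 \<le> 1" "d 3 \<le> 2" "d 4 \<le> 2"
    using c(1-5) sum by linarith+
  then show ?thesis using sum by linarith
qed

lemma path_potential_7:
  fixes d :: "nat \<Rightarrow> int"
  assumes b: "potential_bound path_tree d l" and l: "l \<le> 3" and s: "(\<Sum>i<5. d i) = 7"
  shows "d 0 = 2 \<and> d 1 = 1 \<and> d 2 = 1 \<and> d 3 = 1 \<and> d 4 = 2"
proof -
  note H = potential_bound_path[OF b]
  note sum = s[unfolded sum_lessThan_5]
  have c:
    "4 * d 0 + d 1 + d 2 + d 3 + d 4 \<le> 14"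
    "d 0 + 4 * d 1 + d 2 + d 3 + d 4 \<le> 12"
    "d 0 + d 1 + 4 * d 2 + d 3 + d 4 \<le> 12"
    "d 0 + d 1 + d 2 + 4 * d 3 + d 4 \<le> 12"
    "d 0 + d 1 + d 2 + d 3 + 4 * d 4 \<le> 14"
    using l H[of 2 1 1 1 1] H[of 1 2 1 1 1] H[of 1 1 2 1 1] H[of 1 1 1 2 1] H[of 1 1 1 1 2] by simp_all
  have u: "d 0 \<le> 2" "d 1 \<le> 1" "d 2 \<le> 1" "d 3 \<le> 1" "d 4 \<le> 2"
    using c(1-5) sum by linarith+
  then show ?thesis using sum by linarith
qed

section \<open>Minimizers\<close>

text \<open>Turns isomorphism with a listed tree into a condition on \<open>T\<close> alone,
  whatever its vertex type.\<close>

lemma isomorphic_iff_tree_model: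
  assumes H: "tree_model H vs E a"
  shows "T \<cong>\<^sub>g H \<longleftrightarrow> (\<exists>us. tree_model T us E a)"
proof
  assume iso: "T \<cong>\<^sub>g H"
  have "pair_graph H" using H by (simp add: tree_model_def)
  from isomorphicE[OF iso this] obtain f where T: "pair_graph T" and f: "bij_betw f (pverts T) (pverts H)"
    and arcs: "\<And>u v. u \<in> pverts T \<Longrightarrow> v \<in> pverts T \<Longrightarrow> (f u, f v) \<in> parcs H \<longleftrightarrow> (u, v) \<in> parcs T"
    by blast
  define g where "g = inv_into (pverts T) f"
  have g: "bij_betw g (pverts H) (pverts T)" unfolding g_def using f by (rule bij_betw_inv_into)
  have "f (g u) = u" "g u \<in> pverts T" if "u \<in> pverts H" for u
    using f g that by (auto simp: g_def bij_betw_inv_into_right dest: bij_betwE)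
  then have "(g u, g v) \<in> parcs T \<longleftrightarrow> (u, v) \<in> parcs H" if "u \<in> pverts H" "v \<in> pverts H" for u v
    using arcs[of "g u" "g v"] that by simp
  then show "\<exists>us. tree_model T us E a" using tree_model_transfer[OF H T g] by blast
next
  assume "\<exists>us. tree_model T us E a"
  then show "T \<cong>\<^sub>g H" using tree_model_isomorphic H by blast
qed

lemma exists_tree_model:
  assumes "E \<in> {star_tree, fork_tree, path_tree}"
  obtains G :: "tree_vertex pair_pre_digraph" and us where "tree_model G us E a"
proof -
  let ?as = "map a [0..<5]"
  have a: "?as ! i = a i" if "i < 5" for i using that by simp
  have "tree_model G us E ((!) ?as) \<Longrightarrow> tree_model G us E a" for G :: "tree_vertex pair_pre_digraph" and us E
    using tree_model_cong[of "(!) ?as" a] a by blast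
  then show thesis
    using assms that tree_model_F5_1[of ?as] tree_model_F5_2[of ?as] tree_model_F5_3[of ?as] by blast
qed

lemma index_tree_if_mem: "E \<in> {star_tree, fork_tree, path_tree} \<Longrightarrow> index_tree E"
  using index_tree_star index_tree_fork index_tree_path by blast

text \<open>The scheme shared by all residues: \<open>opt\<close> certifies by a positive
  eigenvector that the candidates have radius \<open>sqrt \<theta>\<close>, and \<open>uniq\<close>
  says that the integer problem has no other solutions. A graph with radius at most
  \<open>sqrt \<theta>\<close> is then a candidate, so none lies strictly below.\<close>

lemma minimizer_graph_iff_tree_model:
  fixes T :: "'a pair_pre_digraph" and \<theta> :: real and K :: int
  assumes \<theta>: "5 * \<theta> < n + 8" "\<theta> \<ge> 25 / 4" and ne: "Opt \<noteq> {}"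
    and opt: "\<And>E a. (E, a) \<in> Opt \<Longrightarrow> E \<in> {star_tree, fork_tree, path_tree} \<and> (\<forall>i<5. a i > 0) \<and>
      (\<Sum>i<5. a i) + 9 = n \<and> (\<exists>x :: nat \<Rightarrow> real. (\<forall>i<5. x i > 0) \<and>
        (\<forall>i<5. real (a i) * x i + (\<Sum>(j, k)\<in>set E. if i = j \<or> i = k then x j + x k else 0) = \<theta> * x i))"
    and uniq: "\<And>E d. E \<in> {star_tree, fork_tree, path_tree} \<Longrightarrow> potential_bound E d (\<theta> - K) \<Longrightarrow>
      (\<Sum>i<5. d i) = int n - 1 - 5 * K \<Longrightarrow>
      \<exists>a. (E, a) \<in> Opt \<and> (\<forall>i<5. d i = int (a i) + int (edge_degree E i) - K)"
  shows "minimizer_graph n (n - 5) T \<longleftrightarrow> (\<exists>(E, a)\<in>Opt. \<exists>us. tree_model T us E a)"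
    and "minimizer_graph n (n - 5) T \<Longrightarrow> graph_spectral_radius T = sqrt \<theta>"
proof -
  have cls: "G \<in> graph_class n (n - 5) \<and> graph_spectral_radius G = sqrt \<theta>"
    if "(E, a) \<in> Opt" "tree_model G us E a" for G :: "'a pair_pre_digraph" and E a us
  proof -
    note o = opt[OF that(1)]
    interpret pendant_tree G us E a
      using that(2) index_tree_if_mem o by unfold_locales auto
    have n: "n = (\<Sum>i<5. a i) + 9" "n - 5 = (\<Sum>i<5. a i) + 4" using o by auto
    have "G \<in> graph_class ((\<Sum>i<5. a i) + 9) ((\<Sum>i<5. a i) + 4)"
      by (rule in_graph_class) (use o in blast)
    then have "G \<in> graph_class n (n - 5)" using n by metis
    moreover have "graph_spectral_radius G = sqrt \<theta>"
      using o \<theta>(2) spectral_radius_pendant_tree[of \<theta>] by auto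
    ultimately show ?thesis by blast
  qed
  have low: "\<exists>(E, a)\<in>Opt. \<exists>us. tree_model G us E a"
    if G: "G \<in> graph_class n (n - 5)" and le: "graph_spectral_radius G \<le> sqrt \<theta>" for G :: "'a pair_pre_digraph"
  proof -
    interpret pair_graph G using G by (simp add: graph_class_def)
    have n: "card (pverts G) = n" and ind: "independence_number G = n - 5"
      and conn: "Digraph_Component.connected (with_proj G)"
      using G by (auto simp: graph_class_def)
    have "{S. independent_set G S} \<subseteq> Pow (pverts G)" by (auto simp: independent_set_def)
    then have "finite (card ` {S. independent_set G S})"
      using pair_finite_verts by (meson finite_Pow_iff finite_imageI finite_subset)
    moreover have "independent_set G {}" by (simp add: independent_set_def)
    ultimately have "independence_number G \<in> card ` {S. independent_set G S}"
      unfolding independence_number_def by (intro Max_in) auto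
    then obtain S where S: "independent_set G S" "card S = n - 5" using ind by auto
    have "n \<ge> 5" using \<theta> by linarith
    define C where "C = pverts G - S"
    have SV: "S \<subseteq> pverts G" "pverts G - C = S" using S by (auto simp: independent_set_def C_def)
    have cC: "card C = 5"
      using SV(1) S(2) n \<open>n \<ge> 5\<close> pair_finite_verts by (simp add: C_def card_Diff_subset finite_subset)
    interpret connected_cover_graph G C
    proof
      show "C \<subseteq> pverts G" by (auto simp: C_def)
      show "nbrs G w \<subseteq> C" if "w \<in> pverts G - C" for w
        using that S nbrs_subset[of w] unfolding SV(2) by (auto simp: C_def independent_set_def nbrs_def)
      show "Digraph_Component.connected (with_proj G)" by (rule conn)
    qed
    have "5 / 2 \<le> sqrt \<theta>" using \<theta>(2) by (intro real_le_rsqrt) (simp add: power2_eq_square)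
    moreover have "5 * (sqrt \<theta>)\<^sup>2 < card (pverts G) + 8" using \<theta> n by simp
    ultimately obtain us E a where E: "E \<in> {star_tree, fork_tree, path_tree}" and M: "tree_model G us E a"
      using tree_model_if_spectral_radius_small[OF cC _ _ le] by metis
    have iE: "index_tree E" using E by (rule index_tree_if_mem)
    interpret M: pendant_tree G us E a using M iE by unfold_locales
    let ?d = "\<lambda>i. int (a i) + int (edge_degree E i) - K"
    have "potential_bound E ?d ((sqrt \<theta>)\<^sup>2 - K)"
      using \<theta>(2) le by (intro M.potential_bound_if_spectral_radius_le) auto
    then have b: "potential_bound E ?d (\<theta> - K)" using \<theta>(2) by simp
    have "(\<Sum>i<5. ?d i) = int (\<Sum>i<5. a i) + int (\<Sum>i<5. edge_degree E i) - 5 * K"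
      by (simp add: sum.distrib sum_subtractf)
    \<comment> \<open>There are \<open>n - 9\<close> pendant vertices, the others being five centres
      and four edge vertices, and the degrees of the index tree add up to 8.\<close>
    also have "\<dots> = int n - 1 - 5 * K"
      using M.card_pverts n sum_edge_degree[OF iE] by simp
    finally obtain a' where a': "(E, a') \<in> Opt" "\<forall>i<5. ?d i = int (a' i) + int (edge_degree E i) - K"
      using uniq[OF E b] by blast
    then have "a i = a' i" if "i < 5" for i using that by auto
    then have "tree_model G us E a'" using M tree_model_cong[of a a'] by blast
    then show ?thesis using a'(1) by blast
  qed
  have min: "\<not> graph_spectral_radius G < sqrt \<theta>" if G: "G \<in> graph_class n (n - 5)" for G :: "'a pair_pre_digraph"
  proof
    assume less: "graph_spectral_radius G < sqrt \<theta>"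
    then obtain E a us where "(E, a) \<in> Opt" "tree_model G us E a" using low[OF G] by auto
    then show False using cls less by fastforce
  qed
  have model: "\<exists>(E, a)\<in>Opt. \<exists>us. tree_model T us E a" if T: "minimizer_graph n (n - 5) T"
  proof -
    have Tc: "T \<in> graph_class n (n - 5)"
      and Tm: "\<And>G :: 'a pair_pre_digraph. G \<in> graph_class n (n - 5) \<Longrightarrow> \<not> graph_spectral_radius G < graph_spectral_radius T"
      using T by (auto simp: minimizer_graph_def is_arg_min_def)
    obtain E a where Ea: "(E, a) \<in> Opt" using ne by auto
    note o = opt[OF Ea]
    obtain G :: "tree_vertex pair_pre_digraph" and us where G: "tree_model G us E a"
      using exists_tree_model o by blast
    interpret G: pendant_tree G us E a using G index_tree_if_mem o by unfold_locales auto
    have "card (pverts G) = card (pverts T)" "finite (pverts T)"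
      using G.card_pverts o Tc pair_fin_digraph.pair_finite_verts
      by (auto simp: graph_class_def pair_graph_def pair_digraph_def)
    \<comment> \<open>The type of \<open>T\<close> may be finite; it has room for a candidate
      because \<open>T\<close> itself has \<open>n\<close> vertices there.\<close>
    then obtain f where f: "bij_betw f (pverts G) (pverts T)"
      using finite_same_card_bij G.pair_finite_verts by blast
    then have inj: "inj_on f (pverts G)" by (simp add: bij_betw_def)
    have "bij_betw f (pverts G) (pverts (image_graph f G))"
      using inj by (simp add: image_graph_def bij_betw_def)
    from tree_model_transfer[OF G image_graph(1)[OF G.pair_graph inj] this image_graph(2)[OF G.pair_graph inj]]
    have "image_graph f G \<in> graph_class n (n - 5) \<and> graph_spectral_radius (image_graph f G) = sqrt \<theta>"
      by (intro cls[OF Ea]) auto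
    then show ?thesis using Tm low[OF Tc] by force
  qed
  show "minimizer_graph n (n - 5) T \<longleftrightarrow> (\<exists>(E, a)\<in>Opt. \<exists>us. tree_model T us E a)"
  proof
    assume "\<exists>(E, a)\<in>Opt. \<exists>us. tree_model T us E a"
    then have "T \<in> graph_class n (n - 5)" "graph_spectral_radius T = sqrt \<theta>" using cls by auto
    then show "minimizer_graph n (n - 5) T" using min by (auto simp: minimizer_graph_def is_arg_min_def)
  qed (rule model)
  show "graph_spectral_radius T = sqrt \<theta>" if "minimizer_graph n (n - 5) T"
    using model[OF that] cls by auto
qed

lemma all_less_5: "(\<forall>i<5. P i) \<longleftrightarrow> P 0 \<and> P 1 \<and> P 2 \<and> P 3 \<and> P (4 :: nat)"
  by (auto simp: eval_nat_numeral less_Suc_eq)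

lemma edge_degree_star: "edge_degree star_tree 0 = 1" "edge_degree star_tree (Suc 0) = 4"
    "edge_degree star_tree 2 = 1" "edge_degree star_tree 3 = 1" "edge_degree star_tree 4 = 1"
  and edge_degree_fork: "edge_degree fork_tree 0 = 1" "edge_degree fork_tree (Suc 0) = 3"
    "edge_degree fork_tree 2 = 2" "edge_degree fork_tree 3 = 1" "edge_degree fork_tree 4 = 1"
  and edge_degree_path: "edge_degree path_tree 0 = 1" "edge_degree path_tree (Suc 0) = 2"
    "edge_degree path_tree 2 = 2" "edge_degree path_tree 3 = 2" "edge_degree path_tree 4 = 1"
  by (simp_all add: edge_degree_def star_tree_def fork_tree_def path_tree_def)

definition ordered_tree_of :: "(nat \<times> nat) list \<Rightarrow> ordered_tree" where
  "ordered_tree_of E = (if E = star_tree then F5_1 else if E = fork_tree then F5_2 else F5_3)"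

lemma ordered_tree_of_simps [simp]:
  "ordered_tree_of star_tree = F5_1" "ordered_tree_of fork_tree = F5_2" "ordered_tree_of path_tree = F5_3"
  by (simp_all add: ordered_tree_of_def star_tree_def fork_tree_def path_tree_def)

lemma minimizer_graph_iff_isomorphic:
  fixes T :: "'a pair_pre_digraph" and \<theta> :: real and K :: int and Opt :: "((nat \<times> nat) list \<times> nat list) set"
  assumes \<theta>: "5 * \<theta> < n + 8" "\<theta> \<ge> 25 / 4" and ne: "Opt \<noteq> {}"
    and trees: "\<And>E as. (E, as) \<in> Opt \<Longrightarrow> E \<in> {star_tree, fork_tree, path_tree}"
    and pos: "\<And>E as. (E, as) \<in> Opt \<Longrightarrow> (\<forall>i<5. as ! i > 0) \<and> (\<Sum>i<5. as ! i) + 9 = n"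
    and eig: "\<And>E as. (E, as) \<in> Opt \<Longrightarrow> \<exists>x :: nat \<Rightarrow> real. (\<forall>i<5. x i > 0) \<and>
        (\<forall>i<5. real (as ! i) * x i + (\<Sum>(j, k)\<in>set E. if i = j \<or> i = k then x j + x k else 0) = \<theta> * x i)"
    and uniq: "\<And>E d. E \<in> {star_tree, fork_tree, path_tree} \<Longrightarrow> potential_bound E d (\<theta> - K) \<Longrightarrow>
      (\<Sum>i<5. d i) = int n - 1 - 5 * K \<Longrightarrow>
      \<exists>as. (E, as) \<in> Opt \<and> (\<forall>i<5. d i = int (as ! i) + int (edge_degree E i) - K)"
  shows "minimizer_graph n (n - 5) T \<longleftrightarrow> (\<exists>(E, as)\<in>Opt. T \<cong>\<^sub>g attach_pendants (ordered_tree_of E) as)"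
    and "minimizer_graph n (n - 5) T \<Longrightarrow> graph_spectral_radius T = sqrt \<theta>"
proof -
  let ?O = "(\<lambda>(E, as). (E, (!) as)) ` Opt"
  have iso: "T \<cong>\<^sub>g attach_pendants (ordered_tree_of E) as \<longleftrightarrow> (\<exists>us. tree_model T us E ((!) as))"
    if "(E, as) \<in> Opt" for E as
    using trees[OF that] isomorphic_iff_tree_model[OF tree_model_F5_1, of T as]
      isomorphic_iff_tree_model[OF tree_model_F5_2, of T as]
      isomorphic_iff_tree_model[OF tree_model_F5_3, of T as] by auto
  have opt: "E \<in> {star_tree, fork_tree, path_tree} \<and> (\<forall>i<5. a i > 0) \<and>
      (\<Sum>i<5. a i) + 9 = n \<and> (\<exists>x :: nat \<Rightarrow> real. (\<forall>i<5. x i > 0) \<and>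
        (\<forall>i<5. real (a i) * x i + (\<Sum>(j, k)\<in>set E. if i = j \<or> i = k then x j + x k else 0) = \<theta> * x i))"
    if "(E, a) \<in> ?O" for E a
  proof -
    obtain as where *: "(E, as) \<in> Opt" "a = (!) as" using \<open>(E, a) \<in> ?O\<close> by auto
    show ?thesis using trees[OF *(1)] pos[OF *(1)] eig[OF *(1)] *(2) by auto
  qed
  have unq: "\<exists>a. (E, a) \<in> ?O \<and> (\<forall>i<5. d i = int (a i) + int (edge_degree E i) - K)"
    if hyp: "E \<in> {star_tree, fork_tree, path_tree}" "potential_bound E d (\<theta> - K)"
      "(\<Sum>i<5. d i) = int n - 1 - 5 * K" for E d
  proof -
    obtain as where "(E, as) \<in> Opt" "\<forall>i<5. d i = int (as ! i) + int (edge_degree E i) - K"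
      using uniq[OF hyp] by blast
    then show ?thesis by (intro exI[of _ "(!) as"]) force
  qed
  have ne': "?O \<noteq> {}" using ne by simp
  have M: "minimizer_graph n (n - 5) T \<longleftrightarrow> (\<exists>(E, a)\<in>?O. \<exists>us. tree_model T us E a)"
    by (rule minimizer_graph_iff_tree_model(1)[OF \<theta> ne' opt unq])
  have "(\<exists>(E, a)\<in>?O. \<exists>us. tree_model T us E a) \<longleftrightarrow> (\<exists>(E, as)\<in>Opt. \<exists>us. tree_model T us E ((!) as))"
    by (simp add: case_prod_unfold)
  also have "\<dots> \<longleftrightarrow> (\<exists>(E, as)\<in>Opt. T \<cong>\<^sub>g attach_pendants (ordered_tree_of E) as)"
    by (rule bex_cong) (auto simp: iso)
  finally show "minimizer_graph n (n - 5) T \<longleftrightarrow> (\<exists>(E, as)\<in>Opt. T \<cong>\<^sub>g attach_pendants (ordered_tree_of E) as)"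
    unfolding M .
  show "minimizer_graph n (n - 5) T \<Longrightarrow> graph_spectral_radius T = sqrt \<theta>"
    by (rule minimizer_graph_iff_tree_model(2)[OF \<theta> ne' opt unq])
qed

section \<open>The five residue classes\<close>

lemma minimizers_r0:
  fixes T :: "'a pair_pre_digraph"
  assumes k: "k \<ge> 6"
  shows "minimizer_graph (5 * k + 4) (5 * k + 4 - 5) T \<longleftrightarrow> T \<cong>\<^sub>g attach_pendants F5_1 [k, k - 5, k, k, k]"
    and "minimizer_graph (5 * k + 4) (5 * k + 4 - 5) T \<Longrightarrow> graph_spectral_radius T = sqrt (k + sqrt 5)"
proof -
  let ?as = "[k, k - 5, k, k, k]"
  \<comment> \<open>Eigenvector for the shifted diagonal \<open>(1, -1, 1, 1, 1)\<close> on the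
    star: a leaf equation gives the centre value, and the centre equation becomes
    \<open>(sqrt 5 - 1) * (sqrt 5 + 1) = 4\<close>.\<close>
  let ?x = "(!) [1, sqrt 5 - 1, 1, 1, 1]"
  let ?O = "{(star_tree, ?as)}"
  have s: "sqrt 5 * sqrt 5 = (5 :: real)" by simp
  have u: "sqrt 5 \<le> 2237 / 1000" by (rule real_le_lsqrt) (auto simp: power2_eq_square)
  have l: "sqrt 5 \<ge> 2" by (rule real_le_rsqrt) simp
  then have pos: "0 < sqrt 5 - 1" by linarith
  have eig: "\<exists>x :: nat \<Rightarrow> real. (\<forall>i<5. x i > 0) \<and>
      (\<forall>i<5. real (as ! i) * x i + (\<Sum>(j, k)\<in>set E. if i = j \<or> i = k then x j + x k else 0) = (k + sqrt 5) * x i)"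
    if "(E, as) \<in> ?O" for E as
  proof (intro exI[of _ ?x] conjI)
    show "\<forall>i<5. real (as ! i) * ?x i + (\<Sum>(j, k)\<in>set E. if i = j \<or> i = k then ?x j + ?x k else 0)
        = (k + sqrt 5) * ?x i"
      using that k s by (simp add: all_less_5 star_tree_def of_nat_diff algebra_simps)
  qed (use pos in \<open>simp add: all_less_5\<close>)
  have uniq: "\<exists>as. (E, as) \<in> ?O \<and> (\<forall>i<5. d i = int (as ! i) + int (edge_degree E i) - int k)"
    if E: "E \<in> {star_tree, fork_tree, path_tree}" and bd: "potential_bound E d (k + sqrt 5 - int k)"
      and sd: "(\<Sum>i<5. d i) = int (5 * k + 4) - 1 - 5 * int k" for E d
  proof -
    have h: "potential_bound E d (sqrt 5)" "(\<Sum>i<5. d i) = 3" using bd sd by simp_all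
    have "E = star_tree"
      using E h(1) fork_potential_3[OF _ u h(2)] path_potential_3[OF _ u h(2)] by blast
    then show ?thesis
      using k star_potential_3[OF _ u h(2)] h(1)
      by (intro exI[of _ ?as]) (simp add: all_less_5 edge_degree_star of_nat_diff)
  qed
  have b: "5 * (k + sqrt 5) < real (5 * k + 4) + 8" "25 / 4 \<le> k + sqrt 5"
    unfolding of_nat_add of_nat_mult of_nat_numeral using u l of_nat_mono[OF k, where ?'a = real] by simp_all
  have as: "(\<forall>i<5. as ! i > 0) \<and> (\<Sum>i<5. as ! i) + 9 = 5 * k + 4" if "(E, as) \<in> ?O" for E as
    using that k by (auto simp: all_less_5 sum_lessThan_5)
  have O: "?O \<noteq> {}" "\<And>E as. (E, as) \<in> ?O \<Longrightarrow> E \<in> {star_tree, fork_tree, path_tree}" by auto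
  note M = minimizer_graph_iff_isomorphic[where T = T, OF b O as eig uniq]
  show "minimizer_graph (5 * k + 4) (5 * k + 4 - 5) T \<longleftrightarrow> T \<cong>\<^sub>g attach_pendants F5_1 ?as"
    using M(1) by simp
  show "minimizer_graph (5 * k + 4) (5 * k + 4 - 5) T \<Longrightarrow> graph_spectral_radius T = sqrt (k + sqrt 5)"
    by (rule M(2))
qed

lemma minimizers_r1:
  fixes T :: "'a pair_pre_digraph" and c :: real
  assumes k: "k \<ge> 6"
    and c: "c * (c * c) = 2 * (c * c) + 2 * c - 2" "24811 / 10000 \<le> c" "c \<le> 24813 / 10000"
  shows "minimizer_graph (5 * k + 5) (5 * k + 5 - 5) T \<longleftrightarrow> T \<cong>\<^sub>g attach_pendants F5_3 [k, k - 1, k - 2, k - 1, k]"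
    and "minimizer_graph (5 * k + 5) (5 * k + 5 - 5) T \<Longrightarrow> graph_spectral_radius T = sqrt (k + c)"
proof -
  let ?as = "[k, k - 1, k - 2, k - 1, k]"
  \<comment> \<open>For the diagonal \<open>(1, 1, 0, 1, 1)\<close> on the path, the first two
    equations determine a symmetric eigenvector. The middle equation
    \<open>2 * (c - 1) = c * ((c - 1)^2 - 1)\<close> is the cubic assumed for
    \<open>c\<close>.\<close>
  let ?x = "(!) [1, c - 1, (c - 1) * (c - 1) - 1, c - 1, 1]"
  let ?O = "{(path_tree, ?as)}"
  note s = c(1)
  have u: "c \<le> 1241 / 500" and l: "c \<ge> 248 / 100" using c by auto
  have "148 / 100 * (148 / 100) \<le> (c - 1) * (c - 1)" using l by (intro mult_mono) auto
  then have pos: "0 < c - 1" "0 < (c - 1) * (c - 1) - 1" using l by auto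
  have eig: "\<exists>x :: nat \<Rightarrow> real. (\<forall>i<5. x i > 0) \<and>
      (\<forall>i<5. real (as ! i) * x i + (\<Sum>(j, k)\<in>set E. if i = j \<or> i = k then x j + x k else 0) = (k + c) * x i)"
    if "(E, as) \<in> ?O" for E as
  proof (intro exI[of _ ?x] conjI)
    show "\<forall>i<5. real (as ! i) * ?x i + (\<Sum>(j, k)\<in>set E. if i = j \<or> i = k then ?x j + ?x k else 0)
        = (k + c) * ?x i"
      using that k s by (simp add: all_less_5 path_tree_def of_nat_diff algebra_simps)
  qed (use pos in \<open>simp add: all_less_5\<close>)
  have uniq: "\<exists>as. (E, as) \<in> ?O \<and> (\<forall>i<5. d i = int (as ! i) + int (edge_degree E i) - int k)"
    if E: "E \<in> {star_tree, fork_tree, path_tree}" and bd: "potential_bound E d (k + c - int k)"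
      and sd: "(\<Sum>i<5. d i) = int (5 * k + 5) - 1 - 5 * int k" for E d
  proof -
    have h: "potential_bound E d (c)" "(\<Sum>i<5. d i) = 4" using bd sd by simp_all
    have "E = path_tree"
      using E h(1) star_potential_4[OF _ u h(2)] fork_potential_4[OF _ u h(2)] by blast
    then show ?thesis
      using k path_potential_4[OF _ u h(2)] h(1)
      by (intro exI[of _ ?as]) (simp add: all_less_5 edge_degree_path of_nat_diff)
  qed
  have b: "5 * (k + c) < real (5 * k + 5) + 8" "25 / 4 \<le> k + c"
    unfolding of_nat_add of_nat_mult of_nat_numeral using u l of_nat_mono[OF k, where ?'a = real] by simp_all
  have as: "(\<forall>i<5. as ! i > 0) \<and> (\<Sum>i<5. as ! i) + 9 = 5 * k + 5" if "(E, as) \<in> ?O" for E as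
    using that k by (auto simp: all_less_5 sum_lessThan_5)
  have O: "?O \<noteq> {}" "\<And>E as. (E, as) \<in> ?O \<Longrightarrow> E \<in> {star_tree, fork_tree, path_tree}" by auto
  note M = minimizer_graph_iff_isomorphic[where T = T, OF b O as eig uniq]
  show "minimizer_graph (5 * k + 5) (5 * k + 5 - 5) T \<longleftrightarrow> T \<cong>\<^sub>g attach_pendants F5_3 ?as"
    using M(1) by simp
  show "minimizer_graph (5 * k + 5) (5 * k + 5 - 5) T \<Longrightarrow> graph_spectral_radius T = sqrt (k + c)"
    by (rule M(2))
qed

lemma minimizers_r2:
  fixes T :: "'a pair_pre_digraph" and c :: real
  assumes k: "k \<ge> 6"
    and c: "c * (c * c) = 3 * (c * c) + c - 5" "26750 / 10000 \<le> c" "c \<le> 26752 / 10000"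
  shows "minimizer_graph (5 * k + 6) (5 * k + 6 - 5) T \<longleftrightarrow> T \<cong>\<^sub>g attach_pendants F5_3 [k + 1, k - 2, k - 1, k - 2, k + 1]"
    and "minimizer_graph (5 * k + 6) (5 * k + 6 - 5) T \<Longrightarrow> graph_spectral_radius T = sqrt (k + c)"
proof -
  let ?as = "[k + 1, k - 2, k - 1, k - 2, k + 1]"
  \<comment> \<open>The same for the diagonal \<open>(2, 0, 1, 0, 2)\<close>; the middle equation is
    \<open>(c - 1) * (c * (c - 2) - 1) = 2 * (c - 2)\<close>.\<close>
  let ?x = "(!) [1, c - 2, c * (c - 2) - 1, c - 2, 1]"
  let ?O = "{(path_tree, ?as)}"
  note s = c(1)
  have u: "c \<le> 669 / 250" and l: "c \<ge> 267 / 100" using c by auto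
  have "267 / 100 * (67 / 100) \<le> c * (c - 2)" using l by (intro mult_mono) auto
  then have pos: "0 < c - 2" "0 < c * (c - 2) - 1" using l by auto
  have eig: "\<exists>x :: nat \<Rightarrow> real. (\<forall>i<5. x i > 0) \<and>
      (\<forall>i<5. real (as ! i) * x i + (\<Sum>(j, k)\<in>set E. if i = j \<or> i = k then x j + x k else 0) = (k + c) * x i)"
    if "(E, as) \<in> ?O" for E as
  proof (intro exI[of _ ?x] conjI)
    show "\<forall>i<5. real (as ! i) * ?x i + (\<Sum>(j, k)\<in>set E. if i = j \<or> i = k then ?x j + ?x k else 0)
        = (k + c) * ?x i"
      using that k s by (simp add: all_less_5 path_tree_def of_nat_diff algebra_simps)
  qed (use pos in \<open>simp add: all_less_5\<close>)
  have uniq: "\<exists>as. (E, as) \<in> ?O \<and> (\<forall>i<5. d i = int (as ! i) + int (edge_degree E i) - int k)"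
    if E: "E \<in> {star_tree, fork_tree, path_tree}" and bd: "potential_bound E d (k + c - int k)"
      and sd: "(\<Sum>i<5. d i) = int (5 * k + 6) - 1 - 5 * int k" for E d
  proof -
    have h: "potential_bound E d (c)" "(\<Sum>i<5. d i) = 5" using bd sd by simp_all
    have "E = path_tree"
      using E h(1) star_potential_5[OF _ u h(2)] fork_potential_5[OF _ u h(2)] by blast
    then show ?thesis
      using k path_potential_5[OF _ u h(2)] h(1)
      by (intro exI[of _ ?as]) (simp add: all_less_5 edge_degree_path of_nat_diff)
  qed
  have b: "5 * (k + c) < real (5 * k + 6) + 8" "25 / 4 \<le> k + c"
    unfolding of_nat_add of_nat_mult of_nat_numeral using u l of_nat_mono[OF k, where ?'a = real] by simp_all
  have as: "(\<forall>i<5. as ! i > 0) \<and> (\<Sum>i<5. as ! i) + 9 = 5 * k + 6" if "(E, as) \<in> ?O" for E as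
    using that k by (auto simp: all_less_5 sum_lessThan_5)
  have O: "?O \<noteq> {}" "\<And>E as. (E, as) \<in> ?O \<Longrightarrow> E \<in> {star_tree, fork_tree, path_tree}" by auto
  note M = minimizer_graph_iff_isomorphic[where T = T, OF b O as eig uniq]
  show "minimizer_graph (5 * k + 6) (5 * k + 6 - 5) T \<longleftrightarrow> T \<cong>\<^sub>g attach_pendants F5_3 ?as"
    using M(1) by simp
  show "minimizer_graph (5 * k + 6) (5 * k + 6 - 5) T \<Longrightarrow> graph_spectral_radius T = sqrt (k + c)"
    by (rule M(2))
qed

lemma minimizers_r3:
  fixes T :: "'a pair_pre_digraph"
  assumes k: "k \<ge> 7"
  shows "minimizer_graph (5 * k + 7) (5 * k + 7 - 5) T \<longleftrightarrow> T \<cong>\<^sub>g attach_pendants F5_1 [k + 1, k - 6, k + 1, k + 1, k + 1]"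
    and "minimizer_graph (5 * k + 7) (5 * k + 7 - 5) T \<Longrightarrow> graph_spectral_radius T = sqrt (k + sqrt 8)"
proof -
  let ?as = "[k + 1, k - 6, k + 1, k + 1, k + 1]"
  \<comment> \<open>For the diagonal \<open>(2, -2, 2, 2, 2)\<close> on the star the centre equation
    is \<open>(sqrt 8 - 2) * (sqrt 8 + 2) = 4\<close>.\<close>
  let ?x = "(!) [1, sqrt 8 - 2, 1, 1, 1]"
  let ?O = "{(star_tree, ?as)}"
  have s: "sqrt 8 * sqrt 8 = (8 :: real)" by simp
  have u: "sqrt 8 \<le> 2829 / 1000" by (rule real_le_lsqrt) (auto simp: power2_eq_square)
  have l: "sqrt 8 \<ge> 5 / 2" by (rule real_le_rsqrt) (simp add: power2_eq_square)
  then have pos: "0 < sqrt 8 - 2" by linarith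
  have eig: "\<exists>x :: nat \<Rightarrow> real. (\<forall>i<5. x i > 0) \<and>
      (\<forall>i<5. real (as ! i) * x i + (\<Sum>(j, k)\<in>set E. if i = j \<or> i = k then x j + x k else 0) = (k + sqrt 8) * x i)"
    if "(E, as) \<in> ?O" for E as
  proof (intro exI[of _ ?x] conjI)
    show "\<forall>i<5. real (as ! i) * ?x i + (\<Sum>(j, k)\<in>set E. if i = j \<or> i = k then ?x j + ?x k else 0)
        = (k + sqrt 8) * ?x i"
      using that k s by (simp add: all_less_5 star_tree_def of_nat_diff algebra_simps)
  qed (use pos in \<open>simp add: all_less_5\<close>)
  have uniq: "\<exists>as. (E, as) \<in> ?O \<and> (\<forall>i<5. d i = int (as ! i) + int (edge_degree E i) - int k)"
    if E: "E \<in> {star_tree, fork_tree, path_tree}" and bd: "potential_bound E d (k + sqrt 8 - int k)"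
      and sd: "(\<Sum>i<5. d i) = int (5 * k + 7) - 1 - 5 * int k" for E d
  proof -
    have h: "potential_bound E d (sqrt 8)" "(\<Sum>i<5. d i) = 6" using bd sd by simp_all
    have "E = star_tree"
      using E h(1) fork_potential_6[OF _ u h(2)] path_potential_6[OF _ u h(2)] by blast
    then show ?thesis
      using k star_potential_6[OF _ u h(2)] h(1)
      by (intro exI[of _ ?as]) (simp add: all_less_5 edge_degree_star of_nat_diff)
  qed
  have b: "5 * (k + sqrt 8) < real (5 * k + 7) + 8" "25 / 4 \<le> k + sqrt 8"
    unfolding of_nat_add of_nat_mult of_nat_numeral using u l of_nat_mono[OF k, where ?'a = real] by simp_all
  have as: "(\<forall>i<5. as ! i > 0) \<and> (\<Sum>i<5. as ! i) + 9 = 5 * k + 7" if "(E, as) \<in> ?O" for E as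
    using that k by (auto simp: all_less_5 sum_lessThan_5)
  have O: "?O \<noteq> {}" "\<And>E as. (E, as) \<in> ?O \<Longrightarrow> E \<in> {star_tree, fork_tree, path_tree}" by auto
  note M = minimizer_graph_iff_isomorphic[where T = T, OF b O as eig uniq]
  show "minimizer_graph (5 * k + 7) (5 * k + 7 - 5) T \<longleftrightarrow> T \<cong>\<^sub>g attach_pendants F5_1 ?as"
    using M(1) by simp
  show "minimizer_graph (5 * k + 7) (5 * k + 7 - 5) T \<Longrightarrow> graph_spectral_radius T = sqrt (k + sqrt 8)"
    by (rule M(2))
qed

text \<open>In all three trees the number of pendant vertices plus twice the index degree is
  \<open>k + 3\<close> at every centre, so the constant vector is an eigenvector for each and the
  radii coincide.\<close>

lemma minimizers_r4:
  fixes T :: "'a pair_pre_digraph"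
  assumes k: "k \<ge> 6"
  shows "minimizer_graph (5 * k + 8) (5 * k + 8 - 5) T \<longleftrightarrow>
      T \<cong>\<^sub>g attach_pendants F5_1 [k + 1, k - 5, k + 1, k + 1, k + 1] \<or>
      T \<cong>\<^sub>g attach_pendants F5_2 [k + 1, k - 3, k - 1, k + 1, k + 1] \<or>
      T \<cong>\<^sub>g attach_pendants F5_3 [k + 1, k - 1, k - 1, k - 1, k + 1]"
    and "minimizer_graph (5 * k + 8) (5 * k + 8 - 5) T \<Longrightarrow> graph_spectral_radius T = sqrt (real k + 3)"
proof -
  let ?O = "{(star_tree, [k + 1, k - 5, k + 1, k + 1, k + 1]), (fork_tree, [k + 1, k - 3, k - 1, k + 1, k + 1]),
    (path_tree, [k + 1, k - 1, k - 1, k - 1, k + 1])}"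
  have eig: "\<exists>x :: nat \<Rightarrow> real. (\<forall>i<5. x i > 0) \<and>
      (\<forall>i<5. real (as ! i) * x i + (\<Sum>(j, k)\<in>set E. if i = j \<or> i = k then x j + x k else 0) = (real k + 3) * x i)"
    if "(E, as) \<in> ?O" for E as
    using that k
    by (intro exI[of _ "\<lambda>_. 1"]) (auto simp: all_less_5 star_tree_def fork_tree_def path_tree_def of_nat_diff)
  have uniq: "\<exists>as. (E, as) \<in> ?O \<and> (\<forall>i<5. d i = int (as ! i) + int (edge_degree E i) - int k)"
    if E: "E \<in> {star_tree, fork_tree, path_tree}" and bd: "potential_bound E d (real k + 3 - int k)"
      and sd: "(\<Sum>i<5. d i) = int (5 * k + 8) - 1 - 5 * int k" for E d
  proof -
    have b: "potential_bound E d 3" "(\<Sum>i<5. d i) = 7" using bd sd by simp_all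
    consider "E = star_tree" | "E = fork_tree" | "E = path_tree" using E by blast
    then show ?thesis
    proof cases
      case 1
      then show ?thesis using star_potential_7[of d 3] b k
        by (intro exI[of _ "[k + 1, k - 5, k + 1, k + 1, k + 1]"]) (auto simp: all_less_5 edge_degree_star of_nat_diff)
    next
      case 2
      then show ?thesis using fork_potential_7[of d 3] b k
        by (intro exI[of _ "[k + 1, k - 3, k - 1, k + 1, k + 1]"]) (auto simp: all_less_5 edge_degree_fork of_nat_diff)
    next
      case 3
      then show ?thesis using path_potential_7[of d 3] b k
        by (intro exI[of _ "[k + 1, k - 1, k - 1, k - 1, k + 1]"]) (auto simp: all_less_5 edge_degree_path of_nat_diff)
    qed
  qed
  have b: "5 * (real k + 3) < real (5 * k + 8) + 8" "25 / 4 \<le> real k + 3"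
    unfolding of_nat_add of_nat_mult of_nat_numeral using of_nat_mono[OF k, where ?'a = real] by simp_all
  have as: "(\<forall>i<5. as ! i > 0) \<and> (\<Sum>i<5. as ! i) + 9 = 5 * k + 8" if "(E, as) \<in> ?O" for E as
    using that k by (auto simp: all_less_5 sum_lessThan_5)
  have O: "?O \<noteq> {}" "\<And>E as. (E, as) \<in> ?O \<Longrightarrow> E \<in> {star_tree, fork_tree, path_tree}" by auto
  note M = minimizer_graph_iff_isomorphic[where T = T, OF b O as eig uniq]
  show "minimizer_graph (5 * k + 8) (5 * k + 8 - 5) T \<longleftrightarrow>
      T \<cong>\<^sub>g attach_pendants F5_1 [k + 1, k - 5, k + 1, k + 1, k + 1] \<or>
      T \<cong>\<^sub>g attach_pendants F5_2 [k + 1, k - 3, k - 1, k + 1, k + 1] \<or>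
      T \<cong>\<^sub>g attach_pendants F5_3 [k + 1, k - 1, k - 1, k - 1, k + 1]"
    using M(1) by simp
  show "minimizer_graph (5 * k + 8) (5 * k + 8 - 5) T \<Longrightarrow> graph_spectral_radius T = sqrt (real k + 3)"
    by (rule M(2))
qed

theorem theorem5p1:
  shows "\<exists>c1 c2 :: real.
    \<bar>c1 - 2.4812\<bar> < 0.00005 \<and> \<bar>c2 - 2.6751\<bar> < 0.00005 \<and>
    (\<forall>r n \<alpha> :: nat. r \<in> {0, 1, 2, 3, 4} \<and> [n + 1 = r] (mod 5) \<and> n \<ge> 69 - 4 * r \<and> \<alpha> = n - 5 \<longrightarrow>
      (r = 0 \<longrightarrow>
        (\<forall>T :: 'a pair_pre_digraph. minimizer_graph n \<alpha> T \<longleftrightarrow>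
          T \<cong>\<^sub>g attach_pendants F5_1
            [(n - 4) div 5, (n - 29) div 5, (n - 4) div 5, (n - 4) div 5, (n - 4) div 5]) \<and>
        (\<forall>T :: 'a pair_pre_digraph. minimizer_graph n \<alpha> T \<longrightarrow>
          graph_spectral_radius T = sqrt ((real n - 4) / 5 + sqrt 5))) \<and>
      (r = 1 \<longrightarrow>
        (\<forall>T :: 'a pair_pre_digraph. minimizer_graph n \<alpha> T \<longleftrightarrow>
          T \<cong>\<^sub>g attach_pendants F5_3
            [(n - 5) div 5, (n - 10) div 5, (n - 15) div 5, (n - 10) div 5, (n - 5) div 5]) \<and>
        (\<forall>T :: 'a pair_pre_digraph. minimizer_graph n \<alpha> T \<longrightarrow>
          graph_spectral_radius T = sqrt ((real n - 5) / 5 + c1))) \<and>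
      (r = 2 \<longrightarrow>
        (\<forall>T :: 'a pair_pre_digraph. minimizer_graph n \<alpha> T \<longleftrightarrow>
          T \<cong>\<^sub>g attach_pendants F5_3
            [(n - 1) div 5, (n - 16) div 5, (n - 11) div 5, (n - 16) div 5, (n - 1) div 5]) \<and>
        (\<forall>T :: 'a pair_pre_digraph. minimizer_graph n \<alpha> T \<longrightarrow>
          graph_spectral_radius T = sqrt ((real n - 6) / 5 + c2))) \<and>
      (r = 3 \<longrightarrow>
        (\<forall>T :: 'a pair_pre_digraph. minimizer_graph n \<alpha> T \<longleftrightarrow>
          T \<cong>\<^sub>g attach_pendants F5_1
            [(n - 2) div 5, (n - 37) div 5, (n - 2) div 5, (n - 2) div 5, (n - 2) div 5]) \<and>
        (\<forall>T :: 'a pair_pre_digraph. minimizer_graph n \<alpha> T \<longrightarrow>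
          graph_spectral_radius T = sqrt ((real n - 7) / 5 + sqrt 8))) \<and>
      (r = 4 \<longrightarrow>
        (\<forall>T :: 'a pair_pre_digraph. minimizer_graph n \<alpha> T \<longleftrightarrow>
          T \<cong>\<^sub>g attach_pendants F5_1
            [(n - 3) div 5, (n - 33) div 5, (n - 3) div 5, (n - 3) div 5, (n - 3) div 5] \<or>
          T \<cong>\<^sub>g attach_pendants F5_2
            [(n - 3) div 5, (n - 23) div 5, (n - 13) div 5, (n - 3) div 5, (n - 3) div 5] \<or>
          T \<cong>\<^sub>g attach_pendants F5_3
            [(n - 3) div 5, (n - 13) div 5, (n - 13) div 5, (n - 13) div 5, (n - 3) div 5]) \<and>
        (\<forall>T :: 'a pair_pre_digraph. minimizer_graph n \<alpha> T \<longrightarrow>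
          graph_spectral_radius T = sqrt ((real n + 7) / 5))))"
proof -
  \<comment> \<open>The interval is 2.4812 plus or minus 0.00004, strictly inside the tolerance. The
    cubic changes sign on it, so the constant is an exact root; \<open>c2\<close> is found in the
    same way.\<close>
  have "\<exists>c. 24811 / 10000 + 6 / 100000 \<le> c \<and> c \<le> 24812 / 10000 + 4 / 100000 \<and> c * (c * c) - 2 * (c * c) - 2 * c + 2 = (0 :: real)"
    by (rule IVT') (auto intro!: continuous_intros)
  then obtain c1 :: real where "24811 / 10000 + 6 / 100000 \<le> c1" "c1 \<le> 24812 / 10000 + 4 / 100000"
    "c1 * (c1 * c1) - 2 * (c1 * c1) - 2 * c1 + 2 = 0" by blast
  then have c1: "c1 * (c1 * c1) = 2 * (c1 * c1) + 2 * c1 - 2" "24811 / 10000 \<le> c1" "c1 \<le> 24813 / 10000"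
      "\<bar>c1 - 2.4812\<bar> < 0.00005"
    unfolding abs_less_iff by auto
  have "\<exists>c. 26750 / 10000 + 6 / 100000 \<le> c \<and> c \<le> 26751 / 10000 + 4 / 100000 \<and> c * (c * c) - 3 * (c * c) - c + 5 = (0 :: real)"
    by (rule IVT') (auto intro!: continuous_intros)
  then obtain c2 :: real where "26750 / 10000 + 6 / 100000 \<le> c2" "c2 \<le> 26751 / 10000 + 4 / 100000"
    "c2 * (c2 * c2) - 3 * (c2 * c2) - c2 + 5 = 0" by blast
  then have c2: "c2 * (c2 * c2) = 3 * (c2 * c2) + c2 - 5" "26750 / 10000 \<le> c2" "c2 \<le> 26752 / 10000"
      "\<bar>c2 - 2.6751\<bar> < 0.00005"
    unfolding abs_less_iff by auto
  have R0: "(\<forall>T :: 'a pair_pre_digraph. minimizer_graph n (n - 5) T \<longleftrightarrow>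
          T \<cong>\<^sub>g attach_pendants F5_1
            [(n - 4) div 5, (n - 29) div 5, (n - 4) div 5, (n - 4) div 5, (n - 4) div 5]) \<and>
        (\<forall>T :: 'a pair_pre_digraph. minimizer_graph n (n - 5) T \<longrightarrow>
          graph_spectral_radius T = sqrt ((real n - 4) / 5 + sqrt 5))"
    if n: "[n + 1 = 0] (mod 5)" "n \<ge> 69" for n
  proof -
    \<comment> \<open>Each numerator in the list of pendant counts is a multiple of 5 once
      \<open>n\<close> is written in \<open>k\<close>, so every \<open>div\<close> below is an exact
      division.\<close>
    have "\<exists>k. n = 5 * k + 4" using n unfolding cong_def by presburger
    then obtain k where k: "n = 5 * k + 4" ..
    have kn: "k \<ge> 7" using n(2) k by simp
    have d: "(n - 4) div 5 = k" "(n - 29) div 5 = k - 5"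
      using k kn by auto
    have q: "(real n - 4) / 5 + sqrt 5 = real k + sqrt 5" unfolding k by (simp add: field_simps)
    have "k \<ge> 6" using kn by simp
    note M = minimizers_r0
    show ?thesis
      unfolding d q unfolding k using M[OF \<open>k \<ge> 6\<close>] by blast
  qed
  have R1: "(\<forall>T :: 'a pair_pre_digraph. minimizer_graph n (n - 5) T \<longleftrightarrow>
          T \<cong>\<^sub>g attach_pendants F5_3
            [(n - 5) div 5, (n - 10) div 5, (n - 15) div 5, (n - 10) div 5, (n - 5) div 5]) \<and>
        (\<forall>T :: 'a pair_pre_digraph. minimizer_graph n (n - 5) T \<longrightarrow>
          graph_spectral_radius T = sqrt ((real n - 5) / 5 + c1))"
    if n: "[n + 1 = 1] (mod 5)" "n \<ge> 65" for n
  proof -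
    have "\<exists>k. n = 5 * k + 5" using n unfolding cong_def by presburger
    then obtain k where k: "n = 5 * k + 5" ..
    have kn: "k \<ge> 7" using n(2) k by simp
    have d: "(n - 5) div 5 = k" "(n - 10) div 5 = k - 1" "(n - 15) div 5 = k - 2"
      using k kn by auto
    have q: "(real n - 5) / 5 + c1 = real k + c1" unfolding k by (simp add: field_simps)
    have "k \<ge> 6" using kn by simp
    note M = minimizers_r1[where c = c1, OF \<open>k \<ge> 6\<close> c1(1-3)]
    show ?thesis
      unfolding d q unfolding k using M by blast
  qed
  have R2: "(\<forall>T :: 'a pair_pre_digraph. minimizer_graph n (n - 5) T \<longleftrightarrow>
          T \<cong>\<^sub>g attach_pendants F5_3
            [(n - 1) div 5, (n - 16) div 5, (n - 11) div 5, (n - 16) div 5, (n - 1) div 5]) \<and>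
        (\<forall>T :: 'a pair_pre_digraph. minimizer_graph n (n - 5) T \<longrightarrow>
          graph_spectral_radius T = sqrt ((real n - 6) / 5 + c2))"
    if n: "[n + 1 = 2] (mod 5)" "n \<ge> 61" for n
  proof -
    have "\<exists>k. n = 5 * k + 6" using n unfolding cong_def by presburger
    then obtain k where k: "n = 5 * k + 6" ..
    have kn: "k \<ge> 7" using n(2) k by simp
    have d: "(n - 1) div 5 = k + 1" "(n - 16) div 5 = k - 2" "(n - 11) div 5 = k - 1"
      using k kn by auto
    have q: "(real n - 6) / 5 + c2 = real k + c2" unfolding k by (simp add: field_simps)
    have "k \<ge> 6" using kn by simp
    note M = minimizers_r2[where c = c2, OF \<open>k \<ge> 6\<close> c2(1-3)]
    show ?thesis
      unfolding d q unfolding k using M by blast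
  qed
  have R3: "(\<forall>T :: 'a pair_pre_digraph. minimizer_graph n (n - 5) T \<longleftrightarrow>
          T \<cong>\<^sub>g attach_pendants F5_1
            [(n - 2) div 5, (n - 37) div 5, (n - 2) div 5, (n - 2) div 5, (n - 2) div 5]) \<and>
        (\<forall>T :: 'a pair_pre_digraph. minimizer_graph n (n - 5) T \<longrightarrow>
          graph_spectral_radius T = sqrt ((real n - 7) / 5 + sqrt 8))"
    if n: "[n + 1 = 3] (mod 5)" "n \<ge> 57" for n
  proof -
    have "\<exists>k. n = 5 * k + 7" using n unfolding cong_def by presburger
    then obtain k where k: "n = 5 * k + 7" ..
    have kn: "k \<ge> 7" using n(2) k by simp
    have d: "(n - 2) div 5 = k + 1" "(n - 37) div 5 = k - 6"
      using k kn by auto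
    have q: "(real n - 7) / 5 + sqrt 8 = real k + sqrt 8" unfolding k by (simp add: field_simps)
    have "k \<ge> 6" using kn by simp
    note M = minimizers_r3
    show ?thesis
      unfolding d q unfolding k using M[OF kn] by blast
  qed
  have R4: "(\<forall>T :: 'a pair_pre_digraph. minimizer_graph n (n - 5) T \<longleftrightarrow>
          T \<cong>\<^sub>g attach_pendants F5_1
            [(n - 3) div 5, (n - 33) div 5, (n - 3) div 5, (n - 3) div 5, (n - 3) div 5] \<or>
          T \<cong>\<^sub>g attach_pendants F5_2
            [(n - 3) div 5, (n - 23) div 5, (n - 13) div 5, (n - 3) div 5, (n - 3) div 5] \<or>
          T \<cong>\<^sub>g attach_pendants F5_3
            [(n - 3) div 5, (n - 13) div 5, (n - 13) div 5, (n - 13) div 5, (n - 3) div 5]) \<and>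
        (\<forall>T :: 'a pair_pre_digraph. minimizer_graph n (n - 5) T \<longrightarrow>
          graph_spectral_radius T = sqrt ((real n + 7) / 5))"
    if n: "[n + 1 = 4] (mod 5)" "n \<ge> 53" for n
  proof -
    have "\<exists>k. n = 5 * k + 8" using n unfolding cong_def by presburger
    then obtain k where k: "n = 5 * k + 8" ..
    have kn: "k \<ge> 7" using n(2) k by simp
    have d: "(n - 3) div 5 = k + 1" "(n - 33) div 5 = k - 5" "(n - 23) div 5 = k - 3" "(n - 13) div 5 = k - 1"
      using k kn by auto
    have q: "(real n + 7) / 5 = real k + 3" unfolding k by (simp add: field_simps)
    have "k \<ge> 6" using kn by simp
    note M = minimizers_r4
    show ?thesis
      unfolding d q unfolding k using M[OF \<open>k \<ge> 6\<close>] by blast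
  qed
  show ?thesis
    apply (rule exI[of _ c1], rule exI[of _ c2], rule conjI[OF c1(4)], rule conjI[OF c2(4)])
    apply (rule allI)+
    apply (rule impI)
    apply (elim conjE)
    apply (simp only:)
    apply (intro conjI[of "_ \<longrightarrow> _"] impI)
        apply (rule R0; simp)
       apply (rule R1; simp)
      apply (rule R2; simp)
     apply (rule R3; simp)
    apply (rule R4; simp)
    done
qed

end
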